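(* Let $\mu=\mathrm{ID}_0(\nu,\gamma)$ be a general multivariate gamma distribution (GMGD) on $\mathbb R^d$, i.e. $\gamma\in\mathbb R^d$ and $$\nu(B)=\int_{\mathbb S^{d-1}}\int_0^\infty 1_B(rs)\,q(r^p,s)\,r^{-1}\,\mathrm dr\,\sigma(\mathrm ds),\quad B\in\mathfrak B(\mathbb R^d),$$ where $p>0$, $\sigma$ is a finite Borel measure on $\mathbb S^{d-1}$, and $q:(0,\infty)\times\mathbb S^{d-1}\to[0,\infty)$ is a Borel function such that for each $s\in\mathbb S^{d-1}$, $\lim_{r\downarrow0}q(r,s)=1$ and $q(\cdot,s)$ is completely monotone. For $\epsilon>0$ let $X^\epsilon=\{X^\epsilon_t:t\ge0\}$ be a L\'evy process (the process of small jumps) with $X_1^\epsilon\sim\mathrm{ID}_0(\nu^\epsilon,0)$, where $\nu^\epsilon(B)=\int_{|x|\le\epsilon}1_B(x)\,\nu(\mathrm dx)$, $B\in\mathfrak B(\mathbb R^d)$. Let $Y^1=\{Y_t^1:t\ge0\}$ be a L\'evy process with $Y^1_1\sim\mathrm{MD}(\sigma)$. Then $\epsilon^{-1}X^\epsilon\stackrel{d}{\to}Y^1$ as $\epsilon\downarrow0$.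
   Context: $\mathbb S^{d-1}$ is the unit sphere in $\mathbb R^d$; $\mathfrak B(\cdot)$ denotes Borel sets. A L\'evy measure is a Borel measure $M$ on $\mathbb R^d$ with $M(\{0\})=0$ and $\int(|x|^2\wedge1)M(\mathrm dx)<\infty$. For a L\'evy measure $M$ with $\int(|x|\wedge1)M(\mathrm dx)<\infty$ and $\gamma\in\mathbb R^d$, $\mathrm{ID}_0(M,\gamma)$ is the infinitely divisible distribution on $\mathbb R^d$ with characteristic function $z\mapsto\exp\{i\langle\gamma,z\rangle+\int_{\mathbb R^d}(e^{i\langle z,x\rangle}-1)M(\mathrm dx)\}$. Writing $\mu=\mathrm{ID}_0(\nu,\gamma)$ presupposes that $\nu$ is a L\'evy measure with $\int(|x|\wedge1)\nu(\mathrm dx)<\infty$. For a finite Borel measure $\sigma$ on $\mathbb S^{d-1}$ with $\theta=\sigma(\mathbb S^{d-1})>0$, the multivariate Dickman distribution $\mathrm{MD}(\sigma)$ is the distribution of a random variable $X$ on $\mathbb R^d$ satisfying $X\stackrel{d}{=}U^{1/\theta}(X+\xi)$, where $X,\xi,U$ are independent on the right side, $U\sim U(0,1)$ and $\xi\sim\sigma/\theta$. If $\sigma=0$, $\mathrm{MD}(\sigma)$ is the point mass at $0$. For processes, $\stackrel{d}{\to}$ denotes weak convergence on $D([0,\infty),\mathbb R^d)$, the space of c\`adl\`ag functions from $[0,\infty)$ into $\mathbb R^d$ with the Skorokhod topology. *)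

theory Defs
  imports "HOL-Probability.Probability"
begin

section \<open>Infinitely divisible laws with jumps of finite variation\<close>

definition levy_measure :: "'a::euclidean_space measure \<Rightarrow> bool" where
  "levy_measure M \<longleftrightarrow>
     sets M = sets borel \<and> emeasure M {0} = 0 \<and>
     (\<integral>\<^sup>+x. ennreal (min ((norm x)\<^sup>2) 1) \<partial>M) < \<infinity>"

text \<open>\<open>ID0_law M \<gamma> \<mu>\<close> says \<open>\<mu> = ID\<^sub>0(M, \<gamma>)\<close>. The conditions on \<open>M\<close> that the notation
  presupposes are part of the predicate. A law is determined by its characteristic function, so
  at most one \<open>\<mu>\<close> qualifies; infinite divisibility follows from the form of the exponent.\<close>

definition ID0_law :: "'a::euclidean_space measure \<Rightarrow> 'a \<Rightarrow> 'a measure \<Rightarrow> bool" where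
  "ID0_law M \<gamma> \<mu> \<longleftrightarrow>
     levy_measure M \<and> (\<integral>\<^sup>+x. ennreal (min (norm x) 1) \<partial>M) < \<infinity> \<and>
     prob_space \<mu> \<and> sets \<mu> = sets borel \<and>
     (\<forall>z. (\<integral>x. exp (\<i> * complex_of_real (z \<bullet> x)) \<partial>\<mu>) =
          exp (\<i> * complex_of_real (\<gamma> \<bullet> z) +
               (\<integral>x. (exp (\<i> * complex_of_real (z \<bullet> x)) - 1) \<partial>M)))"

definition small_jumps :: "'a::euclidean_space measure \<Rightarrow> real \<Rightarrow> 'a measure" where
  "small_jumps \<nu> \<epsilon> = density \<nu> (indicator {x. norm x \<le> \<epsilon>})"


section \<open>Complete monotonicity on the positive half-line\<close>

text \<open>Values of \<open>f\<close> outside \<open>(0, \<infinity>)\<close> are irrelevant: iterated derivatives at a point of this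
  open set depend only on \<open>f\<close> near that point.\<close>

definition completely_monotone :: "(real \<Rightarrow> real) \<Rightarrow> bool" where
  "completely_monotone f \<longleftrightarrow>
     (\<forall>n. \<forall>r>0. (deriv ^^ n) f field_differentiable at r \<and> 0 \<le> (- 1) ^ n * (deriv ^^ n) f r)"


section \<open>Multivariate Dickman laws\<close>

definition finite_sphere_measure :: "'a::euclidean_space measure \<Rightarrow> bool" where
  "finite_sphere_measure \<sigma> \<longleftrightarrow>
     finite_measure \<sigma> \<and> sets \<sigma> = sets (restrict_space borel (sphere 0 1))"

text \<open>\<open>MD_law \<sigma> \<mu>\<close> says \<open>\<mu> = MD(\<sigma>)\<close>. The independent triple \<open>(X, \<xi>, U)\<close> with laws \<open>\<mu>\<close>,
  \<open>\<sigma>/\<theta>\<close> and \<open>U(0,1)\<close> is realised by the coordinates on the product space.\<close>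

definition MD_law :: "'a::euclidean_space measure \<Rightarrow> 'a measure \<Rightarrow> bool" where
  "MD_law \<sigma> \<mu> \<longleftrightarrow>
     (let \<theta> = measure \<sigma> (space \<sigma>) in
       if \<theta> = 0 then \<mu> = return borel 0
       else prob_space \<mu> \<and> sets \<mu> = sets borel \<and>
         \<mu> = distr (\<mu> \<Otimes>\<^sub>M (scale_measure (ennreal (1 / \<theta>)) \<sigma> \<Otimes>\<^sub>M uniform_measure lborel {0<..<1::real}))
                  borel (\<lambda>(x, s, u). u powr (1 / \<theta>) *\<^sub>R (x + s)))"


section \<open>Levy processes\<close>

definition cadlag :: "(real \<Rightarrow> 'a::topological_space) \<Rightarrow> bool" where
  "cadlag x \<longleftrightarrow>
     (\<forall>t\<ge>0. (x \<longlongrightarrow> x t) (at_right t)) \<and> (\<forall>t>0. \<exists>l. (x \<longlongrightarrow> l) (at_left t))"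

text \<open>All paths are cadlag, so that the process is a random element of \<open>D([0,\<infinity>), \<real>\<^sup>d)\<close>.
  Only the values at times \<open>t \<ge> 0\<close> matter.\<close>

locale levy_process = prob_space M
  for M :: "'w measure" and X :: "real \<Rightarrow> 'w \<Rightarrow> 'a::euclidean_space" +
  assumes measurable_at: "\<And>t. 0 \<le> t \<Longrightarrow> X t \<in> borel_measurable M"
    and starts_at_0: "AE \<omega> in M. X 0 \<omega> = 0"
    and independent_increments:
      "\<And>(t :: nat \<Rightarrow> real) n. 0 \<le> t 0 \<Longrightarrow> strict_mono t \<Longrightarrow>
         indep_vars (\<lambda>_. borel) (\<lambda>i \<omega>. X (t (Suc i)) \<omega> - X (t i) \<omega>) {..<n}"
    and stationary_increments:
      "\<And>s t. 0 \<le> s \<Longrightarrow> 0 \<le> t \<Longrightarrow>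
         distr M borel (\<lambda>\<omega>. X (s + t) \<omega> - X s \<omega>) = distr M borel (X t)"
    and stochastically_continuous:
      "\<And>t \<delta>. 0 \<le> t \<Longrightarrow> 0 < \<delta> \<Longrightarrow>
         ((\<lambda>s. prob {\<omega> \<in> space M. \<delta> < dist (X s \<omega>) (X t \<omega>)}) \<longlongrightarrow> 0) (at t within {0..})"
    and cadlag_paths: "\<And>\<omega>. \<omega> \<in> space M \<Longrightarrow> cadlag (\<lambda>t. X t \<omega>)"


section \<open>The Skorokhod space\<close>

text \<open>Functions on \<open>[0, \<infinity>)\<close> are represented as extensional functions, as for \<open>PiE\<close>.\<close>

definition skorokhod_space :: "(real \<Rightarrow> 'a::metric_space) set" where
  "skorokhod_space = {x \<in> extensional {0..}. cadlag x}"

definition time_change :: "(real \<Rightarrow> real) \<Rightarrow> bool" where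
  "time_change l \<longleftrightarrow>
     continuous_on {0..} l \<and> strict_mono_on {0..} l \<and> l 0 = 0 \<and> filterlim l at_top at_top"

definition skorokhod_converges :: "(nat \<Rightarrow> real \<Rightarrow> 'a::metric_space) \<Rightarrow> (real \<Rightarrow> 'a) \<Rightarrow> bool" where
  "skorokhod_converges xs x \<longleftrightarrow>
     (\<exists>l. (\<forall>n. time_change (l n)) \<and>
          uniform_limit {0..} l (\<lambda>t. t) sequentially \<and>
          (\<forall>T\<ge>0. uniform_limit {0..T} (\<lambda>n t. xs n (l n t)) x sequentially))"

text \<open>The Skorokhod (J1) topology is the metrizable topology on \<open>D\<close> whose convergent sequences
  are given by \<open>skorokhod_converges\<close> (Jacod and Shiryaev, Limit Theorems for Stochastic
  Processes, Theorem VI.1.14). Being metrizable, its open sets are the sequentially open ones.\<close>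

definition skorokhod_open :: "(real \<Rightarrow> 'a::metric_space) set \<Rightarrow> bool" where
  "skorokhod_open U \<longleftrightarrow>
     U \<subseteq> skorokhod_space \<and>
     (\<forall>x\<in>U. \<forall>xs. range xs \<subseteq> skorokhod_space \<longrightarrow> skorokhod_converges xs x \<longrightarrow>
        eventually (\<lambda>n. xs n \<in> U) sequentially)"

definition skorokhod_topology :: "(real \<Rightarrow> 'a::metric_space) topology" where
  "skorokhod_topology = topology skorokhod_open"

lemma istopology_skorokhod_open: "istopology skorokhod_open"
  unfolding istopology_def
proof (intro conjI allI impI)
  fix S T :: "(real \<Rightarrow> 'a) set"
  assume "skorokhod_open S" "skorokhod_open T"
  then show "skorokhod_open (S \<inter> T)"
    unfolding skorokhod_open_def by (auto simp: eventually_conj_iff)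
next
  fix K :: "(real \<Rightarrow> 'a) set set"
  assume K: "\<forall>S\<in>K. skorokhod_open S"
  have "eventually (\<lambda>n. xs n \<in> \<Union>K) sequentially"
    if "x \<in> S" "S \<in> K" "range xs \<subseteq> skorokhod_space" "skorokhod_converges xs x" for x S xs
  proof -
    have "eventually (\<lambda>n. xs n \<in> S) sequentially"
      using K that unfolding skorokhod_open_def by blast
    then show ?thesis
      by (rule eventually_mono) (use that in blast)
  qed
  moreover have "\<Union>K \<subseteq> skorokhod_space"
    using K unfolding skorokhod_open_def by blast
  ultimately show "skorokhod_open (\<Union>K)"
    unfolding skorokhod_open_def by blast
qed

lemma openin_skorokhod_topology: "openin skorokhod_topology U \<longleftrightarrow> skorokhod_open U"
  by (simp add: skorokhod_topology_def topology_inverse' istopology_skorokhod_open)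

lemma topspace_skorokhod_topology:
  "topspace (skorokhod_topology :: (real \<Rightarrow> 'a::metric_space) topology) = skorokhod_space"
proof (rule antisym)
  have "openin skorokhod_topology (topspace (skorokhod_topology :: (real \<Rightarrow> 'a) topology))"
    by simp
  then show "topspace (skorokhod_topology :: (real \<Rightarrow> 'a) topology) \<subseteq> skorokhod_space"
    unfolding openin_skorokhod_topology skorokhod_open_def by blast
  have "skorokhod_open (skorokhod_space :: (real \<Rightarrow> 'a) set)"
    unfolding skorokhod_open_def by (auto simp: image_subset_iff)
  then show "skorokhod_space \<subseteq> topspace (skorokhod_topology :: (real \<Rightarrow> 'a) topology)"
    unfolding openin_skorokhod_topology[symmetric] by (rule openin_subset)
qed


section \<open>Convergence in distribution\<close>

text \<open>The random elements may live on different probability spaces. The measurability clauses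
  exclude that the Bochner integrals take the default value for non-integrable functions.\<close>

definition converges_in_distribution ::
  "'s topology \<Rightarrow> ('i \<Rightarrow> 'w measure) \<Rightarrow> ('i \<Rightarrow> 'w \<Rightarrow> 's) \<Rightarrow> 'v measure \<Rightarrow> ('v \<Rightarrow> 's) \<Rightarrow> 'i filter \<Rightarrow> bool"
where
  "converges_in_distribution T M X N Y F \<longleftrightarrow>
     (\<forall>f. continuous_map T euclideanreal f \<and> bounded (f ` topspace T) \<longrightarrow>
        eventually (\<lambda>i. (\<lambda>\<omega>. f (X i \<omega>)) \<in> borel_measurable (M i)) F \<and>
        (\<lambda>\<omega>. f (Y \<omega>)) \<in> borel_measurable N \<and>
        ((\<lambda>i. \<integral>\<omega>. f (X i \<omega>) \<partial>(M i)) \<longlongrightarrow> (\<integral>\<omega>. f (Y \<omega>) \<partial>N)) F)"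

definition sample_path :: "(real \<Rightarrow> 'w \<Rightarrow> 'a) \<Rightarrow> 'w \<Rightarrow> real \<Rightarrow> 'a" where
  "sample_path X \<omega> = restrict (\<lambda>t. X t \<omega>) {0..}"

definition process_converges_in_distribution ::
  "('i \<Rightarrow> 'w measure) \<Rightarrow> ('i \<Rightarrow> real \<Rightarrow> 'w \<Rightarrow> 'a::metric_space) \<Rightarrow>
   'v measure \<Rightarrow> (real \<Rightarrow> 'v \<Rightarrow> 'a) \<Rightarrow> 'i filter \<Rightarrow> bool"
where
  "process_converges_in_distribution M X N Y F \<longleftrightarrow>
     converges_in_distribution skorokhod_topology M (\<lambda>i. sample_path (X i)) N (sample_path Y) F"

end

(* The scaled small-jump process and the Dickman process are coupled by thinning. Since q is completely
   monotone with q(0+, s) = 1, we have 0 <= q <= 1, so the Levy measure of X^eps / eps, which has density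
   q((eps r)^p, s) / r on 0 < r <= 1, is dominated by the Levy measure with density 1 / r, which is that
   of Y. Realise Y from a Poisson point process of marks (time, s, r, u) with u uniform on (0, 1), and
   X^eps / eps by keeping the points with u < q((eps r)^p, s). As eps decreases to 0 all points survive,
   so the coupled paths converge locally uniformly, hence in the Skorokhod topology, by dominated
   convergence for series; no tightness argument is needed.

   Passing from the given processes to the coupled ones only needs that E f(X) depends on the
   distribution of the increments along the grids k/n. Cadlag paths are J1-limits of their
   discretisations, and the increments are identified by their joint characteristic functions. The
   characteristic function of MD(sigma) comes from the fixed-point equation, which is an ordinary
   differential equation along rays. *)
theory Submission
  imports Defs
begin


section \<open>Skorokhod convergence and discretised paths\<close>

text \<open>Continuity of a functional for the Skorokhod topology is used only along convergent
  sequences. This also settles measurability: no sigma-algebra on the path space is introduced;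
  \<open>f\<close> of a path is a limit of functionals of countably many grid values, each
  continuous on a countable product.

  Levy's uniqueness theorem is one-dimensional, while grid increments form an infinite family of
  reals. Coordinates are therefore brought in one at a time, under a nonnegative weight that carries
  the phases of the others.

  The intensity \<open>dr / r\<close> is infinite near 0, so one Poisson count cannot list its
  points. It is cut into dyadic shells: by scale invariance all have the same mass, while jumps in
  shell \<open>k\<close> are at most \<open>2^-k\<close>. One rate serves all shells, jump sizes are
  summable almost surely, and the exceptional event does not depend on the thinning, so that the
  coupled paths converge at every outcome.

  The equation for the Dickman characteristic function is singular at 0. It is solved from \<delta>
  > 0 to 1, and \<delta> goes to 0 last, where continuity and the value 1 at 0 select the
  solution.\<close>

lemma skorokhod_continuous_imp_sequential:
  fixes f :: "(real \<Rightarrow> 'a::metric_space) \<Rightarrow> real"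
  assumes f: "continuous_map skorokhod_topology euclideanreal f"
    and xs: "\<And>n. xs n \<in> skorokhod_space" and x: "x \<in> skorokhod_space"
    and conv: "skorokhod_converges xs x"
  shows "(\<lambda>n. f (xs n)) \<longlonglongrightarrow> f x"
proof (rule topological_tendstoI)
  fix S :: "real set" assume "open S" "f x \<in> S"
  have "openin skorokhod_topology {y \<in> topspace skorokhod_topology. f y \<in> S}"
    using f \<open>open S\<close> unfolding continuous_map_def by auto
  then have "skorokhod_open {y \<in> skorokhod_space. f y \<in> S}"
    by (simp add: openin_skorokhod_topology topspace_skorokhod_topology)
  then have "eventually (\<lambda>n. xs n \<in> {y \<in> skorokhod_space. f y \<in> S}) sequentially"
    unfolding skorokhod_open_def using conv xs x \<open>f x \<in> S\<close> by (auto simp: image_subset_iff)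
  then show "eventually (\<lambda>n. f (xs n) \<in> S) sequentially"
    by (rule eventually_mono) auto
qed

lemma locally_uniform_imp_skorokhod_converges:
  assumes "\<And>T. T \<ge> 0 \<Longrightarrow> uniform_limit {0..T} xs x sequentially"
  shows "skorokhod_converges xs x"
  unfolding skorokhod_converges_def
proof (intro exI[of _ "\<lambda>n t. t"] conjI allI impI)
  show "time_change (\<lambda>t. t)"
    by (auto simp: time_change_def strict_mono_on_def filterlim_ident)
qed (use assms in \<open>auto simp: uniform_limit_iff\<close>)

text \<open>Indexed by cell number rather than by a path: composed with a path functional it becomes
  a function on sequences, so that laws on a countable product suffice.\<close>

definition step_path :: "nat \<Rightarrow> (nat \<Rightarrow> 'a) \<Rightarrow> real \<Rightarrow> 'a" where
  "step_path n x = restrict (\<lambda>t. x (nat \<lfloor>real n * t\<rfloor>)) {0..}"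

text \<open>The property is local. For objects assembled from infinitely many cells or time blocks
  it suffices to look at \<open>[0, T)\<close>, where only finitely many of them are active.\<close>

lemma cadlag_locally:
  fixes x :: "real \<Rightarrow> 'a::topological_space"
  assumes "\<And>T :: nat. \<exists>y. cadlag y \<and> (\<forall>t\<in>{0..<real T}. x t = y t)"
  shows "cadlag x"
  unfolding cadlag_def
proof (intro conjI allI impI)
  fix t :: real
  obtain T :: nat where T: "t < T" using reals_Archimedean2 by blast
  obtain y where y: "cadlag y" "\<And>s. s \<in> {0..<real T} \<Longrightarrow> x s = y s" using assms by blast
  {
    assume t: "t \<ge> 0"
    have "(y \<longlongrightarrow> y t) (at_right t)" using y t by (simp add: cadlag_def)
    moreover have "\<forall>\<^sub>F s in at_right t. y s = x s"
      using t T by (auto simp: eventually_at_right_field y intro!: exI[of _ "real T"])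
    ultimately show "(x \<longlongrightarrow> x t) (at_right t)"
      using y(2)[of t] t T by (auto intro: Lim_transform_eventually)
  }
  assume t: "t > 0"
  then obtain l where "(y \<longlongrightarrow> l) (at_left t)" using y by (auto simp: cadlag_def)
  moreover have "\<forall>\<^sub>F s in at_left t. y s = x s"
    using t T by (auto simp: eventually_at_left_field y intro!: exI[of _ 0])
  ultimately show "\<exists>l. (x \<longlongrightarrow> l) (at_left t)" by (blast intro: Lim_transform_eventually)
qed

lemma cadlag_restrict: "cadlag x \<Longrightarrow> cadlag (restrict x {0..})"
  by (rule cadlag_locally) auto

lemma cadlag_const: "cadlag (\<lambda>_. c)"
  by (auto simp: cadlag_def)

lemma cadlag_if:
  assumes f: "cadlag f" and g: "cadlag g"
  shows "cadlag (\<lambda>t. if a \<le> t then f t else g t)" (is "cadlag ?x")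
  unfolding cadlag_def
proof (intro conjI allI impI)
  fix t :: real
  show "(?x \<longlongrightarrow> ?x t) (at_right t)" if t: "t \<ge> 0"
  proof (cases "a \<le> t")
    case True
    then have "\<forall>\<^sub>F s in at_right t. f s = ?x s"
      by (auto simp: eventually_at_right_field intro!: exI[of _ "t + 1"])
    then show ?thesis using f t True by (auto simp: cadlag_def intro: Lim_transform_eventually)
  next
    case False
    then have "\<forall>\<^sub>F s in at_right t. g s = ?x s"
      by (auto simp: eventually_at_right_field intro!: exI[of _ a])
    then show ?thesis using g t False by (auto simp: cadlag_def intro: Lim_transform_eventually)
  qed
  assume t: "t > 0"
  show "\<exists>l. (?x \<longlongrightarrow> l) (at_left t)"
  proof (cases "a < t")
    case True
    then have "\<forall>\<^sub>F s in at_left t. f s = ?x s"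
      by (auto simp: eventually_at_left_field intro!: exI[of _ a])
    then show ?thesis using f t unfolding cadlag_def by (blast intro: Lim_transform_eventually)
  next
    case False
    then have "\<forall>\<^sub>F s in at_left t. g s = ?x s"
      by (auto simp: eventually_at_left_field intro!: exI[of _ "t - 1"])
    then show ?thesis using g t unfolding cadlag_def by (blast intro: Lim_transform_eventually)
  qed
qed

text \<open>Truncating the index at \<open>K\<close> leaves finitely many steps, added one by one
  with \<open>cadlag_if\<close>. Before time \<open>T\<close> the index is at most
  \<open>n * T\<close>, so truncation there changes nothing.\<close>

lemma step_path_in_skorokhod_space:
  fixes x :: "nat \<Rightarrow> 'a::metric_space"
  assumes n: "n > 0"
  shows "step_path n x \<in> skorokhod_space"
proof -
  have y: "\<exists>y. cadlag y \<and> (\<forall>t\<ge>0. y t = x (min K (nat \<lfloor>real n * t\<rfloor>)))" for K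
  proof (induction K)
    case 0
    show ?case using cadlag_const[of "x 0"] by auto
  next
    case (Suc K)
    then obtain y where y: "cadlag y" "\<And>t. t \<ge> 0 \<Longrightarrow> y t = x (min K (nat \<lfloor>real n * t\<rfloor>))" by blast
    have "real (Suc K) / n \<le> t \<longleftrightarrow> Suc K \<le> nat \<lfloor>real n * t\<rfloor>" for t
      using n by (simp add: pos_divide_le_eq Suc_le_eq zless_nat_eq_int_zless less_floor_iff mult.commute add.commute)
    then have "(if real (Suc K) / n \<le> t then x (Suc K) else y t) = x (min (Suc K) (nat \<lfloor>real n * t\<rfloor>))" if "t \<ge> 0" for t
      using y(2)[OF that] by (auto simp: min_def not_less_eq_eq intro!: arg_cong[of _ _ x])
    then show ?case using cadlag_if[OF cadlag_const y(1)] by blast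
  qed
  have "cadlag (\<lambda>t. x (nat \<lfloor>real n * t\<rfloor>))"
  proof (rule cadlag_locally)
    fix T :: nat
    obtain y where "cadlag y" and y: "\<And>t. t \<ge> 0 \<Longrightarrow> y t = x (min (n * T) (nat \<lfloor>real n * t\<rfloor>))"
      using y by blast
    moreover have "nat \<lfloor>real n * t\<rfloor> \<le> n * T" if "t \<in> {0..<real T}" for t
    proof -
      have "real n * t \<le> real (n * T)" using that by (simp add: mult_left_mono)
      then show ?thesis by (simp add: nat_le_iff floor_le_iff)
    qed
    ultimately show "\<exists>y. cadlag y \<and> (\<forall>t\<in>{0..<real T}. x (nat \<lfloor>real n * t\<rfloor>) = y t)"
      by (intro exI[of _ y]) (simp add: min_absorb2)
  qed
  then show ?thesis by (simp add: skorokhod_space_def step_path_def cadlag_restrict)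
qed

text \<open>Up to time \<open>T\<close> only finitely many indices occur, so coordinatewise
  convergence is already uniform there.\<close>

lemma step_path_continuous:
  fixes xs :: "nat \<Rightarrow> nat \<Rightarrow> 'a::metric_space"
  assumes "\<And>k. (\<lambda>m. xs m k) \<longlonglongrightarrow> x k"
  shows "skorokhod_converges (\<lambda>m. step_path n (xs m)) (step_path n x)"
proof (rule locally_uniform_imp_skorokhod_converges)
  fix T :: real assume "T \<ge> 0"
  show "uniform_limit {0..T} (\<lambda>m. step_path n (xs m)) (step_path n x) sequentially"
  proof (rule uniform_limitI)
    fix e :: real assume "e > 0"
    have "\<forall>\<^sub>F m in sequentially. \<forall>k\<in>{..nat \<lfloor>n * T\<rfloor>}. dist (xs m k) (x k) < e"
      using assms \<open>e > 0\<close> by (intro eventually_ball_finite) (auto dest: tendstoD)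
    then show "\<forall>\<^sub>F m in sequentially. \<forall>t\<in>{0..T}. dist (step_path n (xs m) t) (step_path n x t) < e"
    proof (rule eventually_mono, intro ballI)
      fix m t assume *: "\<forall>k\<in>{..nat \<lfloor>n * T\<rfloor>}. dist (xs m k) (x k) < e" and t: "t \<in> {0..T}"
      have "nat \<lfloor>n * t\<rfloor> \<le> nat \<lfloor>n * T\<rfloor>"
        using t by (intro nat_mono floor_mono mult_left_mono) auto
      then show "dist (step_path n (xs m) t) (step_path n x t) < e"
        using * t by (simp add: step_path_def)
    qed
  qed
qed

text \<open>A piece of a time change under which the path discretised at mesh \<open>1 / n\<close>
  follows \<open>y\<close> up to \<open>e\<close>. The end values depend on the endpoint and
  \<open>n\<close> alone, so pieces over adjacent intervals fit together; the bound excludes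
  \<open>b\<close>, so that a jump of \<open>y\<close> there is left to the next piece.\<close>

definition grid_matched :: "(real \<Rightarrow> 'a::metric_space) \<Rightarrow> real \<Rightarrow> nat \<Rightarrow> real \<Rightarrow> real \<Rightarrow> (real \<Rightarrow> real) \<Rightarrow> bool" where
  "grid_matched y e n a b l \<longleftrightarrow>
     continuous_on {a..b} l \<and> strict_mono_on {a..b} l \<and>
     l a = \<lceil>n * a\<rceil> / n \<and> l b = \<lceil>n * b\<rceil> / n \<and>
     (\<forall>t\<in>{a..b}. \<bar>l t - t\<bar> \<le> 1 / n) \<and>
     (\<forall>t\<in>{a..<b}. dist (y (\<lfloor>n * l t\<rfloor> / n)) (y t) \<le> e)"

lemma grid_ceiling_bounds:
  assumes "n > (0::nat)"
  shows "a \<le> \<lceil>n * a\<rceil> / n" "\<lceil>n * a\<rceil> / n \<le> a + 1 / n"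
proof -
  show "a \<le> \<lceil>n * a\<rceil> / n"
    using assms by (simp add: pos_le_divide_eq mult.commute le_of_int_ceiling)
  have "of_int \<lceil>n * a\<rceil> \<le> n * a + 1" by linarith
  then show "\<lceil>n * a\<rceil> / n \<le> a + 1 / n"
    using assms by (simp add: field_simps)
qed

lemma grid_matched_singleton:
  "n > 0 \<Longrightarrow> \<exists>l. grid_matched y e n a a l"
  using grid_ceiling_bounds[of n a]
  by (intro exI[of _ "\<lambda>_. \<lceil>n * a\<rceil> / n"])
     (auto simp: grid_matched_def strict_mono_on_def abs_le_iff)

lemma grid_matched_trans:
  assumes ab: "grid_matched y e n a b l1" and bc: "grid_matched y e n b c l2" and "a \<le> b" "b \<le> c"
  shows "\<exists>l. grid_matched y e n a c l"
proof -
  define l where "l = (\<lambda>t. if t \<le> b then l1 t else l2 t)"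
  have eq: "l1 b = l2 b" using ab bc by (simp add: grid_matched_def)
  have "continuous_on ({a..b} \<union> {b..c}) l"
    unfolding l_def using ab bc eq
    by (intro continuous_on_cases) (auto simp: grid_matched_def)
  moreover have "{a..b} \<union> {b..c} = {a..c}" using assms by auto
  moreover have "strict_mono_on {a..c} l"
  proof (rule strict_mono_onI)
    fix r s assume rs: "r \<in> {a..c}" "s \<in> {a..c}" "r < s"
    have m1: "strict_mono_on {a..b} l1" and m2: "strict_mono_on {b..c} l2"
      using ab bc by (auto simp: grid_matched_def)
    have 1: "l1 r \<le> l1 b" if "r \<le> b"
      using strict_mono_onD[OF m1, of r b] that rs assms by (cases "r = b") auto
    have 2: "l2 b < l2 s" if "b < s"
      using strict_mono_onD[OF m2, of b s] that rs assms by auto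
    consider "s \<le> b" | "r \<le> b" "b < s" | "b < r" using rs by linarith
    then show "l r < l s"
      using strict_mono_onD[OF m1, of r s] strict_mono_onD[OF m2, of r s] rs 1 2 eq
      by cases (auto simp: l_def)
  qed
  moreover have "l a = \<lceil>n * a\<rceil> / n" "l c = \<lceil>n * c\<rceil> / n"
    using ab bc assms(3,4) by (auto simp: l_def grid_matched_def)
  moreover have "\<bar>l t - t\<bar> \<le> 1 / n" if "t \<in> {a..c}" for t
    using ab bc that by (auto simp: l_def grid_matched_def)
  moreover have "dist (y (\<lfloor>n * l t\<rfloor> / n)) (y t) \<le> e" if "t \<in> {a..<c}" for t
  \<comment> \<open>At \<open>t = b\<close> the value of \<open>l\<close> comes from
    \<open>l1\<close> but the bound from \<open>l2\<close>; \<open>eq\<close> makes the two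
    agree.\<close>
  proof (cases "t < b")
    case False
    then have "l t = l2 t" using eq by (auto simp: l_def)
    then show ?thesis using bc that False by (simp add: grid_matched_def)
  qed (use ab that in \<open>auto simp: l_def grid_matched_def\<close>)
  ultimately show ?thesis
    unfolding grid_matched_def by metis
qed

text \<open>The time change maps \<open>[a, b)\<close> affinely onto \<open>[\<lceil>na\<rceil>/n, \<lceil>nb\<rceil>/n)\<close>, and all grid points of the
  latter interval lie in \<open>[a, b)\<close>; so a small oscillation on \<open>[a, b)\<close> suffices.\<close>

lemma grid_matched_small_oscillation:
  fixes y :: "real \<Rightarrow> 'a::metric_space" and a b :: real
  assumes osc: "\<And>s t. s \<in> {a..<b} \<Longrightarrow> t \<in> {a..<b} \<Longrightarrow> dist (y s) (y t) \<le> e" and "a < b"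
  shows "\<exists>n0. \<forall>n\<ge>n0. \<exists>l. grid_matched y e n a b l"
\<comment> \<open>Beyond this threshold the mesh \<open>1 / n\<close> is shorter than
  \<open>b - a\<close>, which keeps the two rounded endpoints apart.\<close>
proof (intro exI[of _ "Suc (nat \<lceil>1 / (b - a)\<rceil>)"] allI impI)
  fix n :: nat assume n: "n \<ge> Suc (nat \<lceil>1 / (b - a)\<rceil>)"
  then have n0: "n > 0" by simp
  have "1 / (b - a) < n" using n by linarith
  then have big: "1 < n * (b - a)" using \<open>a < b\<close> by (simp add: pos_divide_less_eq)
  define a' b' where "a' = \<lceil>n * a\<rceil> / n" and "b' = \<lceil>n * b\<rceil> / n"
  note a' = grid_ceiling_bounds[OF n0, of a, folded a'_def]
  note b' = grid_ceiling_bounds[OF n0, of b, folded b'_def]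
  have "1 / n < b - a" using big n0 by (simp add: pos_divide_less_eq mult.commute)
  then have a'b': "a' < b'" using a' b' by linarith
  define l where "l = (\<lambda>t. a' + (b' - a') / (b - a) * (t - a))"
  have pos: "0 < (b' - a') / (b - a)" using a'b' \<open>a < b\<close> by simp
  have l_mono: "l s < l t" if "s < t" for s t
    unfolding l_def using mult_strict_left_mono[OF _ pos, of "s - a" "t - a"] that by linarith
  have la: "l a = a'" and lb: "l b = b'" using \<open>a < b\<close> by (auto simp: l_def)
  have near: "\<bar>l t - t\<bar> \<le> 1 / n" if "t \<in> {a..b}" for t
  proof -
    \<comment> \<open>In the coordinate \<open>u\<close> the displacement \<open>l t - t\<close> is
      a convex combination of the two endpoint displacements, both of which lie in
      \<open>[0, 1 / n]\<close>.\<close>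
    define u where "u = (t - a) / (b - a)"
    have u: "0 \<le> u" "u \<le> 1" using that \<open>a < b\<close> by (auto simp: u_def)
    have t: "t = a + u * (b - a)" using \<open>a < b\<close> by (simp add: u_def)
    have "l t = a' + u * (b' - a')" by (simp add: l_def u_def field_simps)
    then have "l t - t = (1 - u) * (a' - a) + u * (b' - b)"
      by (subst t) (simp add: algebra_simps)
    moreover have "(1 - u) * (a' - a) + u * (b' - b) \<le> (1 - u) * (1 / n) + u * (1 / n)"
      using a' b' u by (intro add_mono mult_left_mono) auto
    moreover have "0 \<le> (1 - u) * (a' - a) + u * (b' - b)"
      using a' b' u by (intro add_nonneg_nonneg mult_nonneg_nonneg) auto
    moreover have "(1 - u) * (1 / n) + u * (1 / n) = 1 / n"
      by (simp flip: add_divide_distrib)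
    ultimately show ?thesis unfolding abs_le_iff by linarith
  qed
  have d: "dist (y (\<lfloor>n * l t\<rfloor> / n)) (y t) \<le> e" if t: "t \<in> {a..<b}" for t
  proof (rule osc[OF _ t])
    have "a' \<le> l t" "l t < b'"
      using l_mono[of a t] l_mono[of t b] t la lb by (cases "t = a"; force)+
    then have "\<lceil>n * a\<rceil> \<le> n * l t" "n * l t < \<lceil>n * b\<rceil>"
      using n0 by (auto simp: a'_def b'_def pos_divide_le_eq pos_less_divide_eq mult.commute)
    then have "\<lceil>n * a\<rceil> \<le> \<lfloor>n * l t\<rfloor>" "\<lfloor>n * l t\<rfloor> < \<lceil>n * b\<rceil>"
      by (auto simp: le_floor_iff floor_less_iff)
    then have "n * a \<le> \<lfloor>n * l t\<rfloor>" "\<lfloor>n * l t\<rfloor> < n * b"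
      by (simp_all only: ceiling_le_iff less_ceiling_iff)
    then show "\<lfloor>n * l t\<rfloor> / n \<in> {a..<b}"
      using n0 by (auto simp: pos_divide_less_eq pos_le_divide_eq mult.commute)
  qed
  have "grid_matched y e n a b l"
    unfolding grid_matched_def
    using near d la lb l_mono \<open>a < b\<close>
    by (auto simp: a'_def b'_def strict_mono_on_def l_def intro!: continuous_intros)
  then show "\<exists>l. grid_matched y e n a b l" by (rule exI[of "grid_matched y e n a b" l])
qed

lemma small_oscillation_of_limit:
  fixes y :: "real \<Rightarrow> 'a::metric_space"
  assumes "(y \<longlongrightarrow> c) (at x within S)" "e > 0"
  shows "\<exists>d>0. \<forall>s t. s \<in> S - {x} \<longrightarrow> t \<in> S - {x} \<longrightarrow> \<bar>s - x\<bar> < d \<longrightarrow> \<bar>t - x\<bar> < d \<longrightarrow> dist (y s) (y t) \<le> e"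
proof -
  obtain d where d: "d > 0" "\<And>s. s \<in> S \<Longrightarrow> 0 < dist s x \<Longrightarrow> dist s x < d \<Longrightarrow> dist (y s) c < e / 2"
    using tendstoD[OF assms(1), of "e / 2"] assms(2) unfolding eventually_at by auto
  show ?thesis
  proof (intro exI[of _ d] conjI allI impI)
    fix s t assume "s \<in> S - {x}" "t \<in> S - {x}" "\<bar>s - x\<bar> < d" "\<bar>t - x\<bar> < d"
    then have "dist (y s) c < e / 2" "dist (y t) c < e / 2"
      using d(2)[of s] d(2)[of t] by (auto simp: dist_real_def)
    then show "dist (y s) (y t) \<le> e"
      by (metis dist_triangle_half_l order_less_imp_le)
  qed (rule d)
qed

text \<open>Bisection replaces the choice of a partition: matched intervals can be glued, and around
  every \<open>x\<close> the oscillation of \<open>y\<close> is small just left of \<open>x\<close>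
  and on a right neighbourhood that includes \<open>x\<close>. A jump at \<open>x\<close> thus falls
  on the border of two pieces.\<close>

lemma cadlag_grid_matched:
  fixes y :: "real \<Rightarrow> 'a::metric_space"
  assumes y: "cadlag y" and "e > 0" "0 \<le> T"
  shows "\<exists>n0. \<forall>n\<ge>n0. \<exists>l. grid_matched (\<lambda>t. y (max 0 t)) e n 0 T l"
proof -
  \<comment> \<open>The path is frozen at \<open>y 0\<close> for negative times, because bisection
    asks about neighbourhoods of all real points.\<close>
  define z where "z = (\<lambda>t. y (max 0 t))"
  have right: "(z \<longlongrightarrow> z x) (at_right x)" for x
  proof (cases "x \<ge> 0")
    case True
    have "(y \<longlongrightarrow> y x) (at_right x)" using y True by (simp add: cadlag_def)
    moreover have "\<forall>\<^sub>F t in at_right x. y t = z t"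
      using True by (auto simp: z_def eventually_at_right_field intro!: exI[of _ "x + 1"])
    ultimately have "(z \<longlongrightarrow> y x) (at_right x)" by (rule Lim_transform_eventually)
    then show ?thesis using True by (simp add: z_def)
  next
    case False
    then show ?thesis
      by (intro tendsto_eventually) (auto simp: z_def eventually_at_right_field intro!: exI[of _ 0])
  qed
  have left: "\<exists>c. (z \<longlongrightarrow> c) (at_left x)" for x
  proof (cases "x > 0")
    case True
    then obtain c where "(y \<longlongrightarrow> c) (at_left x)" using y by (auto simp: cadlag_def)
    moreover have "\<forall>\<^sub>F t in at_left x. y t = z t"
      using True by (auto simp: z_def eventually_at_left_field intro!: exI[of _ 0])
    ultimately show ?thesis by (blast intro: Lim_transform_eventually)
  next
    case False
    then have "(z \<longlongrightarrow> y 0) (at_left x)"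
      by (intro tendsto_eventually) (auto simp: z_def eventually_at_left_field intro!: exI[of _ "x - 1"])
    then show ?thesis ..
  qed
  define P where "P = (\<lambda>a b. \<exists>n0. \<forall>n\<ge>n0. \<exists>l. grid_matched z e n a b l)"
  have refl: "P a a" for a
    unfolding P_def by (rule exI[of _ 1]) (auto intro: grid_matched_singleton)
  have trans: "P a c" if ab: "P a b" and bc: "P b c" and le: "a \<le> b" "b \<le> c" for a b c
  proof -
    obtain n1 where "\<forall>n\<ge>n1. \<exists>l. grid_matched z e n a b l"
      using ab unfolding P_def by blast
    moreover obtain n2 where "\<forall>n\<ge>n2. \<exists>l. grid_matched z e n b c l"
      using bc unfolding P_def by blast
    ultimately show ?thesis
      unfolding P_def using grid_matched_trans[OF _ _ le]
      by (intro exI[of _ "max n1 n2"]) fastforce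
  qed
  have "P 0 T"
  proof (rule Bolzano[OF \<open>0 \<le> T\<close>])
    fix x
    obtain c where c: "(z \<longlongrightarrow> c) (at_left x)" using left by blast
    obtain d1 where d1: "d1 > 0" "\<And>s t. s < x \<Longrightarrow> t < x \<Longrightarrow> \<bar>s - x\<bar> < d1 \<Longrightarrow> \<bar>t - x\<bar> < d1 \<Longrightarrow> dist (z s) (z t) \<le> e"
      using small_oscillation_of_limit[OF c \<open>e > 0\<close>] by auto
    obtain d2 where d2: "d2 > 0" "\<And>s. s > x \<Longrightarrow> \<bar>s - x\<bar> < d2 \<Longrightarrow> dist (z s) (z x) < e / 2"
      using tendstoD[OF right, of "e / 2" x] \<open>e > 0\<close>
      unfolding eventually_at by (auto simp: dist_real_def)
    have d2': "dist (z s) (z t) \<le> e" if "s \<ge> x" "t \<ge> x" "\<bar>s - x\<bar> < d2" "\<bar>t - x\<bar> < d2" for s t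
    proof -
      have "dist (z s) (z x) < e / 2" "dist (z t) (z x) < e / 2"
        using d2(2)[of s] d2(2)[of t] that \<open>e > 0\<close> by (cases "s = x"; cases "t = x"; auto)+
      then show ?thesis by (metis dist_triangle_half_l order_less_imp_le)
    qed
    show "\<exists>d>0. \<forall>a b. a \<le> x \<and> x \<le> b \<and> b - a < d \<longrightarrow> P a b"
    proof (intro exI[of _ "min d1 d2"] conjI allI impI)
      fix a b assume ab: "a \<le> x \<and> x \<le> b \<and> b - a < min d1 d2"
      have "P a x"
      proof (cases "a = x")
        case False
        then show ?thesis
          unfolding P_def using ab
          by (intro grid_matched_small_oscillation d1(2)) auto
      qed (simp add: refl)
      moreover have "P x b"
      proof (cases "b = x")
        case False
        then show ?thesis
          unfolding P_def using ab
          by (intro grid_matched_small_oscillation d2') auto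
      qed (simp add: refl)
      ultimately show "P a b" using trans ab by blast
    qed (use d1 d2 in auto)
  qed (use trans in blast)
  then show ?thesis by (simp add: P_def z_def)
qed

text \<open>For each \<open>n\<close>, take a witness for the largest \<open>m \<le> n\<close> that
  has one. A fixed \<open>m\<close> has witnesses eventually; it is then dominated by that maximum,
  and \<open>anti\<close> brings the witness down to \<open>m\<close>.\<close>

lemma diagonal_choice:
  fixes P :: "nat \<Rightarrow> nat \<Rightarrow> 'b \<Rightarrow> bool"
  assumes ex: "\<And>m. \<exists>n0. \<forall>n\<ge>n0. \<exists>x. P m n x"
    and anti: "\<And>m m' n x. m \<le> m' \<Longrightarrow> P m' n x \<Longrightarrow> P m n x"
  shows "\<exists>f. \<forall>m. \<exists>n0. \<forall>n\<ge>n0. P m n (f n)"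
proof -
  define K where "K = (\<lambda>n. {m. m \<le> n \<and> (\<exists>x. P m n x)})"
  define f where "f = (\<lambda>n. SOME x. P (Max (K n)) n x)"
  show ?thesis
  proof (intro exI[of _ f] allI)
    fix m
    obtain n0 where n0: "\<And>n. n \<ge> n0 \<Longrightarrow> \<exists>x. P m n x" using ex by blast
    have "P m n (f n)" if "n \<ge> max n0 m" for n
    proof -
      have fin: "finite (K n)" by (simp add: K_def)
      have m: "m \<in> K n" using n0 that by (simp add: K_def)
      have "Max (K n) \<in> K n" using fin m by (intro Max_in) auto
      moreover have "\<exists>x. P m n x" if "m \<in> K n" for m using that by (simp add: K_def)
      ultimately have "P (Max (K n)) n (f n)"
        unfolding f_def by (blast intro: someI_ex)
      then show ?thesis using anti Max_ge[OF fin m] by blast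
    qed
    then show "\<exists>n0. \<forall>n\<ge>n0. P m n (f n)" by blast
  qed
qed

text \<open>A jump off the grid shows up in the discretised path only at the next grid point, so
  uniform convergence fails in general and the time has to be deformed. One sequence of time changes
  must serve all horizons and accuracies, hence the diagonal choice.\<close>

lemma step_path_discretisation_converges:
  fixes y :: "real \<Rightarrow> 'a::metric_space"
  assumes y: "cadlag y"
  shows "skorokhod_converges (\<lambda>n. step_path (Suc n) (\<lambda>k. y (k / Suc n))) y"
proof -
  define z where "z = (\<lambda>t. y (max 0 t))"
  \<comment> \<open>Horizon and accuracy are tied to the single index \<open>m\<close>, which makes
    the predicate antitone in \<open>m\<close>.\<close>
  define P where "P = (\<lambda>m n (l :: real \<Rightarrow> real). time_change l \<and> (\<forall>t\<ge>0. \<bar>l t - t\<bar> \<le> 1 / Suc n) \<and>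
      (\<forall>t\<in>{0..<real m}. dist (y (\<lfloor>Suc n * l t\<rfloor> / Suc n)) (y t) \<le> 1 / Suc m))"
  have "\<exists>l. \<forall>m. \<exists>n0. \<forall>n\<ge>n0. P m n (l n)"
  proof (rule diagonal_choice)
    fix m
    obtain n0 where n0: "\<And>n. n \<ge> n0 \<Longrightarrow> \<exists>l. grid_matched z (1 / Suc m) n 0 m l"
      using cadlag_grid_matched[OF y, of "1 / Suc m" m] unfolding z_def by auto
    show "\<exists>n0. \<forall>n\<ge>n0. \<exists>l. P m n l"
    proof (intro exI[of _ n0] allI impI)
      fix n assume "n \<ge> n0"
      then obtain l where l: "grid_matched z (1 / Suc m) (Suc n) 0 m l"
        using n0[of "Suc n"] by auto
      have l0: "l 0 = 0" using l by (simp add: grid_matched_def)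
      \<comment> \<open>The horizon \<open>m\<close> is an integer, hence a grid point; so
        \<open>l m = m\<close>, and the identity continues \<open>l\<close> beyond it.\<close>
      have "\<lceil>real (Suc n) * real m\<rceil> = int (Suc n * m)"
        by (metis ceiling_of_nat of_nat_mult)
      moreover have "l m = \<lceil>real (Suc n) * real m\<rceil> / Suc n"
        using l unfolding grid_matched_def by blast
      ultimately have lm: "l m = m" by (simp only: of_int_of_nat_eq of_nat_mult) simp
      define k where "k = (\<lambda>t. if t \<le> real m then l t else t)"
      have "continuous_on ({0..real m} \<union> {real m..}) k"
        unfolding k_def using l lm
        by (intro continuous_on_cases) (auto simp: grid_matched_def)
      moreover have "{0..real m} \<union> {real m..} = {0..}" by auto
      ultimately have c: "continuous_on {0..} k" by simp
      have mono: "strict_mono_on {0..real m} l" using l by (simp add: grid_matched_def)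
      have "strict_mono_on {0..} k"
      proof (rule strict_mono_onI)
        fix r s :: real assume rs: "r \<in> {0..}" "s \<in> {0..}" "r < s"
        have 1: "l r \<le> m" if "r \<le> m"
          using strict_mono_onD[OF mono, of r m] that rs lm by (cases "r = m") auto
        consider "s \<le> m" | "r \<le> m" "m < s" | "m < r" using rs by linarith
        then show "k r < k s"
          using strict_mono_onD[OF mono, of r s] rs 1 by cases (auto simp: k_def)
      qed
      moreover have "filterlim k at_top at_top"
        using filterlim_ident
        by (rule filterlim_cong[THEN iffD1, OF refl refl, rotated])
           (auto simp: k_def eventually_at_top_dense intro!: exI[of _ "real m"])
      ultimately have "time_change k"
        using c l0 by (auto simp: time_change_def k_def)
      moreover have "\<bar>k t - t\<bar> \<le> 1 / Suc n" if "t \<ge> 0" for t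
        using l that by (auto simp: k_def grid_matched_def)
      moreover have "dist (y (\<lfloor>Suc n * k t\<rfloor> / Suc n)) (y t) \<le> 1 / Suc m" if t: "t \<in> {0..<real m}" for t
      proof -
        have "0 \<le> l t"
          using strict_mono_onD[OF mono, of 0 t] t l0 by (cases "t = 0") auto
        moreover have "dist (z (\<lfloor>Suc n * l t\<rfloor> / Suc n)) (z t) \<le> 1 / Suc m"
          using l t unfolding grid_matched_def by blast
        ultimately show ?thesis using t by (simp add: z_def k_def max_def)
      qed
      ultimately have "P m n k" by (simp add: P_def)
      then show "\<exists>l. P m n l" by (rule exI[of "P m n" k])
    qed
  next
    fix m m' n :: nat and l assume "m \<le> m'" "P m' n l"
    moreover have "1 / real (Suc m') \<le> 1 / real (Suc m)"
      using \<open>m \<le> m'\<close> by (simp add: frac_le)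
    ultimately show "P m n l"
      unfolding P_def by (smt (verit) atLeastLessThan_iff of_nat_mono)
  qed
  then obtain l0 where l0: "\<And>m. \<exists>n0. \<forall>n\<ge>n0. P m n (l0 n)" by blast
  \<comment> \<open>Convergence asks for a time change at every \<open>n\<close>. Where the diagonal
    choice has not yet taken hold, the identity is used; it satisfies \<open>P 0\<close> because
    \<open>{0..<0}\<close> is empty.\<close>
  define l where "l = (\<lambda>n. if P 0 n (l0 n) then l0 n else (\<lambda>t. t))"
  have id: "time_change (\<lambda>t. t)"
    by (auto simp: time_change_def strict_mono_on_def filterlim_ident)
  have P0: "P 0 n (\<lambda>t. t)" for n using id by (simp add: P_def)
  have Pl0: "P 0 n (l n)" for n using P0 by (simp add: l_def)
  have Pl: "\<exists>n0. \<forall>n\<ge>n0. P m n (l n)" for m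
  proof -
    obtain n1 n2 where "\<And>n. n \<ge> n1 \<Longrightarrow> P 0 n (l0 n)" "\<And>n. n \<ge> n2 \<Longrightarrow> P m n (l0 n)"
      using l0 by metis
    then show ?thesis by (intro exI[of _ "max n1 n2"]) (auto simp: l_def)
  qed
  show ?thesis
    unfolding skorokhod_converges_def
  proof (intro exI[of _ l] conjI allI impI)
    show tc: "time_change (l n)" for n using Pl0[of n] by (simp add: P_def)
    show "uniform_limit {0..} l (\<lambda>t. t) sequentially"
    proof (rule uniform_limitI)
      fix e :: real assume "e > 0"
      then have "\<forall>\<^sub>F n in sequentially. 1 / Suc n < e"
        using LIMSEQ_inverse_real_of_nat by (auto simp: divide_inverse dest!: order_tendstoD)
      then show "\<forall>\<^sub>F n in sequentially. \<forall>t\<in>{0..}. dist (l n t) t < e"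
      proof (rule eventually_mono, intro ballI)
        fix n t assume "1 / real (Suc n) < e" "t \<in> {0::real..}"
        then show "dist (l n t) t < e" 
          using Pl0[of n] unfolding P_def dist_real_def by fastforce
      qed
    qed
    fix T :: real assume "T \<ge> 0"
    show "uniform_limit {0..T} (\<lambda>n t. step_path (Suc n) (\<lambda>k. y (k / Suc n)) (l n t)) y sequentially"
    proof (rule uniform_limitI)
      fix e :: real assume "e > 0"
      \<comment> \<open>Large enough for the horizon to exceed \<open>T\<close> and for
        \<open>1 / Suc m\<close> to fall below \<open>e\<close>.\<close>
      define m where "m = nat \<lceil>1 / e\<rceil> + nat \<lceil>T\<rceil> + 1"
      have "T < m" using \<open>T \<ge> 0\<close> unfolding m_def by linarith
      have "1 / e < Suc m" unfolding m_def by linarith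
      then have me: "1 / Suc m < e" using \<open>e > 0\<close> by (simp add: field_simps)
      obtain n0 where n0: "\<And>n. n \<ge> n0 \<Longrightarrow> P m n (l n)" using Pl by blast
      show "\<forall>\<^sub>F n in sequentially. \<forall>t\<in>{0..T}. dist (step_path (Suc n) (\<lambda>k. y (k / Suc n)) (l n t)) (y t) < e"
        unfolding eventually_sequentially
      proof (intro exI[of _ n0] allI impI ballI)
        fix n t assume n: "n0 \<le> n" and t: "t \<in> {0..T}"
        have mono: "strict_mono_on {0..} (l n)" "l n 0 = 0" using tc[of n] by (auto simp: time_change_def)
        have nn: "0 \<le> l n t"
          using strict_mono_onD[OF mono(1), of 0 t] t mono(2) by (cases "t = 0") auto
        have "dist (y (\<lfloor>Suc n * l n t\<rfloor> / Suc n)) (y t) \<le> 1 / Suc m"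
          using n0[OF n] t \<open>T < m\<close> by (auto simp: P_def)
        moreover have "step_path (Suc n) (\<lambda>k. y (k / Suc n)) (l n t) = y (\<lfloor>Suc n * l n t\<rfloor> / Suc n)"
        proof -
          have "0 \<le> \<lfloor>real (Suc n) * l n t\<rfloor>" using nn by (simp add: zero_le_mult_iff)
          then show ?thesis using nn by (simp add: step_path_def)
        qed
        ultimately show "dist (step_path (Suc n) (\<lambda>k. y (k / Suc n)) (l n t)) (y t) < e"
          using me by simp
      qed
    qed
  qed
qed


section \<open>Joint characteristic functions determine the law\<close>

abbreviation borel_seq :: "('i \<Rightarrow> real) measure" where
  "borel_seq \<equiv> PiM UNIV (\<lambda>_. borel)"

text \<open>The value at \<open>t = 0\<close> is the total mass, so both measures are normalised by
  the same constant and Levy's theorem for probability laws applies. Measures of other mass arise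
  below from weights.\<close>

lemma finite_measure_eqI_char:
  fixes M N :: "real measure"
  assumes M: "finite_measure M" "sets M = sets borel" and N: "finite_measure N" "sets N = sets borel"
    and char: "\<And>t. (\<integral>x. iexp (t * x) \<partial>M) = (\<integral>x. iexp (t * x) \<partial>N)"
  shows "M = N"
proof -
  interpret M: finite_measure M by fact
  interpret N: finite_measure N by fact
  have sp: "space M = UNIV" "space N = UNIV" using sets_eq_imp_space_eq[OF M(2)] sets_eq_imp_space_eq[OF N(2)] by simp_all
  define m where "m = measure M UNIV"
  have mN: "m = measure N UNIV"
    using char[of 0] by (simp add: m_def sp)
  show ?thesis
  proof (cases "m = 0")
    case True
    have z: "emeasure M (space M) = 0" "emeasure N (space N) = 0"
      unfolding M.emeasure_eq_measure N.emeasure_eq_measure using True mN by (auto simp: m_def sp)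
    have "emeasure M A = 0" "emeasure N A = 0" for A
      using emeasure_space[of M A] emeasure_space[of N A] unfolding z by simp_all
    then show ?thesis using M N by (intro measure_eqI) auto
  next
    case False
    then have m: "m > 0" by (simp add: m_def zero_less_measure_iff)
    have real_distribution: "real_distribution (density L (\<lambda>_. ennreal (1 / m)))"
      if "finite_measure L" "sets L = sets borel" "m = measure L UNIV" for L :: "real measure"
    proof -
      interpret L: finite_measure L by fact
      have spL: "space L = UNIV" using sets_eq_imp_space_eq[OF that(2)] by simp
      have "emeasure (density L (\<lambda>_. ennreal (1 / m))) UNIV = 1"
        using m that(2) that(3)[symmetric]
        by (simp add: emeasure_density_const L.emeasure_eq_measure ennreal_mult'[symmetric])
      then show ?thesis
        using that(2) spL by (auto simp: real_distribution_def real_distribution_axioms_def intro!: prob_spaceI)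
    qed
    have "char (density M (\<lambda>_. ennreal (1 / m))) = char (density N (\<lambda>_. ennreal (1 / m)))"
      using m char M N by (auto simp: char_def integral_density fun_eq_iff)
    then have eq: "density M (\<lambda>_. ennreal (1 / m)) = density N (\<lambda>_. ennreal (1 / m))"
      using real_distribution[OF M] real_distribution[OF N] mN by (intro Levy_uniqueness) (auto simp: m_def)
    have "emeasure M A = emeasure N A" if "A \<in> sets M" for A
    proof -
      have "emeasure L A = ennreal m * emeasure (density L (\<lambda>_. ennreal (1 / m))) A"
        if "A \<in> sets L" for L :: "real measure"
      proof -
        have "ennreal m * ennreal (1 / m) = 1" using m by (simp add: ennreal_mult'[symmetric])
        then show ?thesis using that by (simp add: emeasure_density_const mult.assoc[symmetric])
      qed
      note this[of M] this[of N]
      then show ?thesis using that eq M(2) N(2) by simp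
    qed
    then show ?thesis using M N by (intro measure_eqI) auto
  qed
qed

text \<open>Uniqueness is applied to the images under \<open>X\<close> and \<open>X'\<close> of the
  measures with densities \<open>v\<close> and \<open>v'\<close>; this is where weights have to be
  nonnegative.\<close>

lemma weighted_char_determines:
  fixes v X :: "'m \<Rightarrow> real" and v' X' :: "'n \<Rightarrow> real"
  assumes "prob_space M" "prob_space N"
    and [measurable]: "v \<in> borel_measurable M" "X \<in> borel_measurable M"
      "v' \<in> borel_measurable N" "X' \<in> borel_measurable N"
    and v: "\<And>x. 0 \<le> v x" "\<And>x. v x \<le> c" and v': "\<And>x. 0 \<le> v' x" "\<And>x. v' x \<le> c"
    and eq: "\<And>t. (\<integral>x. v x *\<^sub>R iexp (t * X x) \<partial>M) = (\<integral>x. v' x *\<^sub>R iexp (t * X' x) \<partial>N)"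
    and [measurable]: "A \<in> sets borel"
  shows "(\<integral>x. v x * indicator A (X x) \<partial>M) = (\<integral>x. v' x * indicator A (X' x) \<partial>N)"
proof -
  define D where "D = distr (density M v) borel X"
  define D' where "D' = distr (density N v') borel X'"
  have fin: "finite_measure (distr (density L w) borel Z)"
    if "prob_space L" and [measurable]: "w \<in> borel_measurable L" "Z \<in> borel_measurable L"
      and w: "\<And>x. 0 \<le> w x" "\<And>x. w x \<le> c"
    for L :: "'z measure" and w Z :: "'z \<Rightarrow> real"
  proof -
    interpret L: prob_space L by fact
    have "(\<integral>\<^sup>+x. ennreal (w x) \<partial>L) \<le> (\<integral>\<^sup>+x. ennreal c \<partial>L)"
      by (intro nn_integral_mono ennreal_leI w)
    also have "\<dots> < \<infinity>" by (simp add: L.emeasure_space_1)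
    finally have "finite_measure (density L w)"
      by (intro finite_measureI) (auto simp: emeasure_density cong: nn_integral_cong_simp)
    then show ?thesis by (intro finite_measure.finite_measure_distr) auto
  qed
  have "D = D'"
  proof (rule finite_measure_eqI_char)
    show "finite_measure D" "finite_measure D'" unfolding D_def D'_def
      using assms by (intro fin; simp)+
    show "(\<integral>x. iexp (t * x) \<partial>D) = (\<integral>x. iexp (t * x) \<partial>D')" for t
      unfolding D_def D'_def using eq[of t] v v' by (simp add: integral_distr integral_density)
  qed (auto simp: D_def D'_def)
  have "(\<integral>x. v x * indicator A (X x) \<partial>M) = (\<integral>x. indicat_real A x \<partial>D)"
    unfolding D_def using v by (subst integral_distr) (auto simp: integral_density)
  also have "\<dots> = (\<integral>x. v' x * indicator A (X' x) \<partial>N)"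
    unfolding \<open>D = D'\<close> D'_def using v' by (subst integral_distr) (auto simp: integral_density)
  finally show ?thesis .
qed

text \<open>The tilted weights \<open>w (1 + cos (h + a))\<close> are nonnegative, so that the one-dimensional uniqueness
  theorem applies to one coordinate while the phase \<open>h\<close> carries the other ones along.\<close>

lemma tilted_weight_bounds:
  fixes v k :: real
  assumes "0 \<le> v" "v \<le> 1"
  shows "0 \<le> v * (1 + cos k)" "v * (1 + cos k) \<le> 2"
proof -
  have "0 \<le> 1 + cos k" "1 + cos k \<le> 2" using cos_ge_minus_one[of k] cos_le_one[of k] by linarith+
  then show "0 \<le> v * (1 + cos k)" "v * (1 + cos k) \<le> 2"
    using mult_mono[of v 1 "1 + cos k" 2] assms by auto
qed

text \<open>The cosine is the half sum of two conjugate exponentials, so a tilted characteristic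
  function combines untilted ones in which the phase \<open>h\<close> enters 0, 1 or -1
  times.\<close>

lemma (in prob_space) integral_tilted_iexp:
  fixes w y h :: "'a \<Rightarrow> real"
  assumes [measurable]: "w \<in> borel_measurable M" "y \<in> borel_measurable M" "h \<in> borel_measurable M"
    and w: "\<And>x. 0 \<le> w x" "\<And>x. w x \<le> 1"
  shows "(\<integral>x. (w x * (1 + cos (h x + a))) *\<^sub>R iexp (y x) \<partial>M) = (\<integral>x. w x *\<^sub>R iexp (y x) \<partial>M) +
    (cis a / 2 * (\<integral>x. w x *\<^sub>R iexp (y x + h x) \<partial>M) + cis (- a) / 2 * (\<integral>x. w x *\<^sub>R iexp (y x - h x) \<partial>M))"
proof -
  have int: "integrable M (\<lambda>x. c * (w x *\<^sub>R iexp (k x)))" if [measurable]: "k \<in> borel_measurable M" for k c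
    using w by (intro integrable_mult_right integrable_const_bound[where B = 1]) (auto simp: norm_mult)
  have "(v * (1 + cos (k + a))) *\<^sub>R iexp t =
      v *\<^sub>R iexp t + (cis a / 2 * (v *\<^sub>R iexp (t + k)) + cis (- a) / 2 * (v *\<^sub>R iexp (t - k)))" for v k t
  proof -
    have "complex_of_real (cos x) = (cis x + cis (- x)) / 2" for x by (simp add: complex_eq_iff)
    from this[of "k + a"] have "complex_of_real (1 + cos (k + a)) * cis t = cis t + (cis a / 2 * cis (t + k) + cis (- a) / 2 * cis (t - k))"
      by (simp add: cis_mult distrib_right add_divide_distrib algebra_simps)
    then have "complex_of_real v * (complex_of_real (1 + cos (k + a)) * cis t) =
        complex_of_real v * (cis t + (cis a / 2 * cis (t + k) + cis (- a) / 2 * cis (t - k)))" by (rule arg_cong)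
    then show ?thesis
      unfolding scaleR_conv_of_real of_real_mult cis_conv_exp[symmetric]
      by (simp only: distrib_left mult_ac)
  qed
  moreover have "integrable M (\<lambda>x. w x *\<^sub>R iexp (y x))" using int[of y 1] by simp
  ultimately show ?thesis
    by (simp only: Bochner_Integration.integral_add int Bochner_Integration.integrable_add
        borel_measurable_add borel_measurable_diff assms integral_mult_right_zero)
qed

text \<open>The shifts 0, \<open>- pi / 2\<close> and \<open>pi\<close> produce the weights
  \<open>1 + cos h\<close>, \<open>1 + sin h\<close> and \<open>1 - cos h\<close>. The coefficients
  solve for \<open>cos h + \<i> * sin h\<close>: the constants cancel.\<close>

lemma (in prob_space) integral_iexp_from_tilts:
  fixes u h :: "'a \<Rightarrow> real"
  assumes [measurable]: "u \<in> borel_measurable M" "h \<in> borel_measurable M"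
    and u: "\<And>x. 0 \<le> u x" "\<And>x. u x \<le> 1"
  defines "I \<equiv> \<lambda>a. complex_of_real (\<integral>x. u x * (1 + cos (h x + a)) \<partial>M)"
  shows "(\<integral>x. u x *\<^sub>R iexp (h x) \<partial>M) = (1 - \<i>) / 2 * I 0 + (\<i> * I (- pi / 2) + - ((1 + \<i>) / 2) * I pi)"
proof -
  have int: "integrable M (\<lambda>x. c * complex_of_real (u x * (1 + cos (h x + a))))" for a c
    by (intro integrable_mult_right integrable_of_real integrable_const_bound[where B = 2])
       (use tilted_weight_bounds[OF u] in \<open>auto simp: abs_le_iff intro: order_trans[of _ 0]\<close>)
  have "v *\<^sub>R iexp k = (1 - \<i>) / 2 * complex_of_real (v * (1 + cos (k + 0))) +
      (\<i> * complex_of_real (v * (1 + cos (k + - pi / 2))) + - ((1 + \<i>) / 2) * complex_of_real (v * (1 + cos (k + pi))))" for v k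
    by (simp add: complex_eq_iff Re_exp Im_exp cos_add cos_diff algebra_simps)
  then show ?thesis
    unfolding I_def
    by (simp only: Bochner_Integration.integral_add int Bochner_Integration.integrable_add
        integral_mult_right_zero integral_complex_of_real)
qed

text \<open>Induction on \<open>B\<close> turns frequencies into indicators one coordinate at a
  time. The exponential factor with arbitrary \<open>c\<close> is kept in the statement because the
  next coordinate needs its whole characteristic function.\<close>

lemma joint_char_determines_weighted_rectangles:
  fixes f :: "'i \<Rightarrow> 'm \<Rightarrow> real" and g :: "'i \<Rightarrow> 'n \<Rightarrow> real"
  assumes M: "prob_space M" and N: "prob_space N" and "finite J"
    and f[measurable]: "\<And>j. f j \<in> borel_measurable M" and g[measurable]: "\<And>j. g j \<in> borel_measurable N"
    and char: "\<And>c. (\<integral>x. iexp (\<Sum>j\<in>J. c j * f j x) \<partial>M) = (\<integral>x. iexp (\<Sum>j\<in>J. c j * g j x) \<partial>N)"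
    and A[measurable]: "\<And>j. A j \<in> sets borel"
    and "B \<subseteq> J"
  shows "(\<integral>x. (\<Prod>j\<in>B. indicator (A j) (f j x)) *\<^sub>R iexp (\<Sum>j\<in>J. c j * f j x) \<partial>M) =
         (\<integral>x. (\<Prod>j\<in>B. indicator (A j) (g j x)) *\<^sub>R iexp (\<Sum>j\<in>J. c j * g j x) \<partial>N)"
proof -
  have "finite B" using \<open>B \<subseteq> J\<close> \<open>finite J\<close> finite_subset by blast
  then show ?thesis using \<open>B \<subseteq> J\<close>
  proof (induction B arbitrary: c)
    case empty
    then show ?case using char by simp
  next
    case (insert b B)
    interpret M: prob_space M by fact
    interpret N: prob_space N by fact
    define w w' where "w = (\<lambda>x. \<Prod>j\<in>B. indicat_real (A j) (f j x))"
      and "w' = (\<lambda>x. \<Prod>j\<in>B. indicat_real (A j) (g j x))"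
    define h h' where "h = (\<lambda>x. \<Sum>j\<in>J. c j * f j x)" and "h' = (\<lambda>x. \<Sum>j\<in>J. c j * g j x)"
    have meas[measurable]: "w \<in> borel_measurable M" "w' \<in> borel_measurable N"
        "h \<in> borel_measurable M" "h' \<in> borel_measurable N"
      by (auto simp: w_def w'_def h_def h'_def)
    have w: "0 \<le> w x" "w x \<le> 1" and w': "0 \<le> w' y" "w' y \<le> 1" for x y
      by (auto simp: w_def w'_def intro!: prod_nonneg prod_le_1)
    \<comment> \<open>Scaling all frequencies by \<open>s\<close> and adding \<open>t\<close> at
      \<open>b\<close> is again a choice of frequencies, so the induction hypothesis covers every
      multiple of the phase that the tilts produce.\<close>
    have IH: "(\<integral>x. w x *\<^sub>R iexp (t * f b x + s * h x) \<partial>M) = (\<integral>x. w' x *\<^sub>R iexp (t * g b x + s * h' x) \<partial>N)" for s t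
    proof -
      have sum: "(\<Sum>j\<in>J. ((if j = b then t else 0) + s * c j) * k j) = t * k b + s * (\<Sum>j\<in>J. c j * k j)"
        for k :: "'i \<Rightarrow> real"
        using insert.prems \<open>finite J\<close>
        by (simp add: distrib_right sum.distrib if_distrib[of "\<lambda>x. x * _"] sum_distrib_left mult.assoc cong: if_cong)
      show ?thesis
        using insert.IH[of "\<lambda>j. (if j = b then t else 0) + s * c j"] insert.prems
        unfolding sum w_def w'_def h_def h'_def by auto
    qed
    \<comment> \<open>For each shift \<open>a\<close> the tilted weight is nonnegative, so
      one-dimensional uniqueness in coordinate \<open>b\<close> inserts the indicator of
      \<open>A b\<close>.\<close>
    have tilt: "(\<integral>x. (w x * (1 + cos (h x + a))) * indicator (A b) (f b x) \<partial>M) =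
        (\<integral>x. (w' x * (1 + cos (h' x + a))) * indicator (A b) (g b x) \<partial>N)" for a
    proof (rule weighted_char_determines[OF M N, where c = 2])
      fix t
      have m: "(\<lambda>x. t * f b x) \<in> borel_measurable M" "(\<lambda>x. t * g b x) \<in> borel_measurable N" by auto
      show "(\<integral>x. (w x * (1 + cos (h x + a))) *\<^sub>R iexp (t * f b x) \<partial>M) = (\<integral>x. (w' x * (1 + cos (h' x + a))) *\<^sub>R iexp (t * g b x) \<partial>N)"
        unfolding M.integral_tilted_iexp[OF meas(1) m(1) meas(3) w] N.integral_tilted_iexp[OF meas(2) m(2) meas(4) w']
        using IH[of t 0] IH[of t 1] IH[of t "-1"] by simp
    qed (use tilted_weight_bounds w w' in auto)
    then have tilt': "(\<integral>x. (w x * indicator (A b) (f b x)) * (1 + cos (h x + a)) \<partial>M) =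
        (\<integral>x. (w' x * indicator (A b) (g b x)) * (1 + cos (h' x + a)) \<partial>N)" for a
      by (simp only: mult_ac)
    \<comment> \<open>The indicator is now part of the weight; recombining three shifts turns the
      cosine tilts back into the complex phase.\<close>
    have "(\<integral>x. (w x * indicator (A b) (f b x)) *\<^sub>R iexp (h x) \<partial>M) = (\<integral>x. (w' x * indicator (A b) (g b x)) *\<^sub>R iexp (h' x) \<partial>N)"
    proof -
      have "(\<lambda>x. w x * indicat_real (A b) (f b x)) \<in> borel_measurable M"
        "(\<lambda>x. w' x * indicat_real (A b) (g b x)) \<in> borel_measurable N" by measurable
      moreover have "0 \<le> w x * indicat_real (A b) (f b x)" "w x * indicat_real (A b) (f b x) \<le> 1"
        "0 \<le> w' y * indicat_real (A b) (g b y)" "w' y * indicat_real (A b) (g b y) \<le> 1" for x y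
        using w[of x] w'[of y] by (auto split: split_indicator)
      ultimately show ?thesis
        by (simp only: M.integral_iexp_from_tilts N.integral_iexp_from_tilts meas tilt')
    qed
    then show ?case
      using insert.hyps by (simp add: w_def w'_def h_def h'_def mult.commute)
  qed
qed

text \<open>With \<open>B = J\<close> and zero frequencies the weighted integrals are probabilities
  of finite-dimensional rectangles, and these generate the product sigma-algebra.\<close>

lemma joint_char_determines_law:
  fixes f :: "'i \<Rightarrow> 'm \<Rightarrow> real" and g :: "'i \<Rightarrow> 'n \<Rightarrow> real"
  assumes M: "prob_space M" and N: "prob_space N"
    and f[measurable]: "\<And>j. f j \<in> borel_measurable M" and g[measurable]: "\<And>j. g j \<in> borel_measurable N"
    and char: "\<And>J c. finite J \<Longrightarrow> (\<integral>x. iexp (\<Sum>j\<in>J. c j * f j x) \<partial>M) = (\<integral>x. iexp (\<Sum>j\<in>J. c j * g j x) \<partial>N)"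
  shows "distr M borel_seq (\<lambda>x j. f j x) = distr N borel_seq (\<lambda>x j. g j x)"
proof -
  interpret M: prob_space M by fact
  interpret N: prob_space N by fact
  have mf[measurable]: "(\<lambda>x j. f j x) \<in> measurable M borel_seq"
    and mg[measurable]: "(\<lambda>x j. g j x) \<in> measurable N borel_seq"
    by (auto intro!: measurable_PiM_single')
  have rect: "measure L ((\<lambda>x j. k j x) -` prod_emb UNIV (\<lambda>_. borel) J (Pi\<^sub>E J A) \<inter> space L)
      = Re (\<integral>x. (\<Prod>j\<in>J. indicator (A j) (k j x)) *\<^sub>R iexp (\<Sum>j\<in>J. 0 * k j x) \<partial>L)"
    if "prob_space L" and [measurable]: "\<And>j. k j \<in> borel_measurable L" "\<And>j. A j \<in> sets borel" and "finite J"
    for L :: "'z measure" and k :: "'i \<Rightarrow> 'z \<Rightarrow> real" and J A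
  proof -
    interpret L: prob_space L by fact
    let ?S = "{x\<in>space L. \<forall>j\<in>J. k j x \<in> A j}"
    have S: "?S \<in> sets L" using \<open>finite J\<close> by measurable
    have "(\<lambda>x j. k j x) -` prod_emb UNIV (\<lambda>_. borel) J (Pi\<^sub>E J A) \<inter> space L = ?S"
      by (auto simp: prod_emb_def)
    moreover have "(\<Prod>j\<in>J. indicat_real (A j) (k j x)) *\<^sub>R iexp (\<Sum>j\<in>J. 0 * k j x) = complex_of_real (indicat_real ?S x)"
      if "x \<in> space L" for x
      using that \<open>finite J\<close> by (auto simp: indicator_def scaleR_conv_of_real prod_zero_iff)
    ultimately show ?thesis
      using S by (simp cong: Bochner_Integration.integral_cong)
  qed
  show ?thesis
  proof (rule measure_eqI_PiM_infinite)
    show "finite_measure (distr M borel_seq (\<lambda>x j. f j x))"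
      by (intro prob_space.finite_measure M.prob_space_distr mf)
    fix A :: "'i \<Rightarrow> real set" and J assume J: "finite J" and A: "\<And>i. i \<in> J \<Longrightarrow> A i \<in> sets borel"
    \<comment> \<open>\<open>A\<close> is Borel only on \<open>J\<close>, whereas the rectangle
      lemma quantifies over all indices.\<close>
    define A' where "A' = (\<lambda>j. if j \<in> J then A j else UNIV)"
    have [measurable]: "A' j \<in> sets borel" for j using A by (auto simp: A'_def)
    have AA': "Pi\<^sub>E J A = Pi\<^sub>E J A'" by (auto simp: A'_def intro!: PiE_cong)
    have [measurable]: "prod_emb UNIV (\<lambda>_. borel) J (Pi\<^sub>E J A') \<in> sets (PiM UNIV (\<lambda>_. borel :: real measure))"
      using J by (intro sets_PiM_I) auto
    have "measure M ((\<lambda>x j. f j x) -` prod_emb UNIV (\<lambda>_. borel) J (Pi\<^sub>E J A') \<inter> space M)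
        = measure N ((\<lambda>x j. g j x) -` prod_emb UNIV (\<lambda>_. borel) J (Pi\<^sub>E J A') \<inter> space N)"
      unfolding rect[OF M f \<open>\<And>j. A' j \<in> sets borel\<close> J] rect[OF N g \<open>\<And>j. A' j \<in> sets borel\<close> J]
        joint_char_determines_weighted_rectangles[OF M N J f g char[OF J] \<open>\<And>j. A' j \<in> sets borel\<close> order_refl] ..
    then show "emeasure (distr M borel_seq (\<lambda>x j. f j x)) (prod_emb UNIV (\<lambda>_. borel) J (Pi\<^sub>E J A)) =
       emeasure (distr N borel_seq (\<lambda>x j. g j x)) (prod_emb UNIV (\<lambda>_. borel) J (Pi\<^sub>E J A))"
      unfolding AA' by (simp add: emeasure_distr M.emeasure_eq_measure N.emeasure_eq_measure)
  qed simp_all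
qed


section \<open>Path functionals and increments along grids\<close>

text \<open>What path functionals require of a process. The given processes, their rescalings and
  the coupled jump processes all satisfy it; for the latter, independence of increments enters only
  through \<open>grid_exponent\<close>.\<close>

definition cadlag_process :: "'w measure \<Rightarrow> (real \<Rightarrow> 'w \<Rightarrow> 'a::euclidean_space) \<Rightarrow> bool" where
  "cadlag_process M X \<longleftrightarrow>
     prob_space M \<and> (\<forall>t\<ge>0. X t \<in> borel_measurable M) \<and> (AE \<omega> in M. X 0 \<omega> = 0) \<and>
     (\<forall>\<omega>\<in>space M. cadlag (\<lambda>t. X t \<omega>))"

text \<open>Split into real coordinates indexed by cell and axis, the format of
  \<open>joint_char_determines_law\<close>.\<close>

definition grid_increments :: "nat \<Rightarrow> (real \<Rightarrow> 'w \<Rightarrow> real ^ 'd) \<Rightarrow> 'w \<Rightarrow> nat \<times> 'd \<Rightarrow> real" where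
  "grid_increments n X \<omega> = (\<lambda>(k, i). (X (real (Suc k) / n) \<omega> - X (real k / n) \<omega>) $ i)"

definition partial_sums :: "(nat \<times> 'd \<Rightarrow> real) \<Rightarrow> nat \<Rightarrow> real ^ 'd" where
  "partial_sums x k = (\<chi> i. \<Sum>l<k. x (l, i))"

lemma partial_sums_grid_increments:
  assumes "X 0 \<omega> = 0"
  shows "partial_sums (grid_increments n X \<omega>) k = X (real k / n) \<omega>"
proof -
  have "(\<Sum>l<k. (X (real (Suc l) / n) \<omega> - X (real l / n) \<omega>) $ i) = (X (real k / n) \<omega> - X 0 \<omega>) $ i" for i
    by (induction k) auto
  then show ?thesis using assms
    by (simp add: partial_sums_def grid_increments_def vec_eq_iff)
qed

lemma sample_path_in_skorokhod_space:
  "cadlag_process M X \<Longrightarrow> \<omega> \<in> space M \<Longrightarrow> sample_path X \<omega> \<in> skorokhod_space"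
  by (simp add: cadlag_process_def skorokhod_space_def sample_path_def cadlag_restrict)

text \<open>Coordinatewise convergence gives Skorokhod convergence of step paths, so the composite
  is sequentially continuous on a countable product, whose Borel sets form the product
  sigma-algebra.\<close>

lemma step_functional_measurable:
  fixes f :: "(real \<Rightarrow> real ^ 'd) \<Rightarrow> real" and V :: "(nat \<times> 'd \<Rightarrow> real) \<Rightarrow> nat \<Rightarrow> real ^ 'd"
  assumes f: "continuous_map skorokhod_topology euclideanreal f" and "n > 0"
    and V: "\<And>k. continuous_on UNIV (\<lambda>x. V x k)"
  shows "(\<lambda>x. f (step_path n (V x))) \<in> borel_measurable borel_seq"
proof -
  have "continuous_on UNIV (\<lambda>x. f (step_path n (V x)))"
    unfolding continuous_on_sequentially
  proof (intro allI ballI impI)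
    fix x :: "nat \<Rightarrow> nat \<times> 'd \<Rightarrow> real" and a
    assume "a \<in> UNIV" and x: "(\<forall>n. x n \<in> UNIV) \<and> x \<longlonglongrightarrow> a"
    have "(\<lambda>m. V (x m) k) \<longlonglongrightarrow> V a k" for k
      using continuous_on_tendsto_compose[OF V, of x a] x by simp
    then show "((\<lambda>x. f (step_path n (V x))) \<circ> x) \<longlonglongrightarrow> f (step_path n (V a))"
      unfolding o_def
      by (intro skorokhod_continuous_imp_sequential[OF f] step_path_continuous
          step_path_in_skorokhod_space \<open>n > 0\<close>)
  qed
  then have "(\<lambda>x. f (step_path n (V x))) \<in> borel_measurable borel"
    by (rule borel_measurable_continuous_onI)
  then show ?thesis
    by (subst measurable_cong_sets[OF sets_PiM_equal_borel refl])
qed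

lemma continuous_on_partial_sums: "continuous_on UNIV (\<lambda>x :: nat \<times> 'd::finite \<Rightarrow> real. partial_sums x k)"
  unfolding partial_sums_def
  by (intro continuous_intros continuous_on_product_coordinates)

lemma borel_measurable_vec_nth_comp:
  fixes Z :: "'w \<Rightarrow> real ^ 'd"
  assumes "Z \<in> borel_measurable M"
  shows "(\<lambda>\<omega>. Z \<omega> $ i) \<in> borel_measurable M"
  by (rule measurable_compose[OF assms borel_measurable_continuous_onI]) (intro continuous_intros)

lemma grid_increments_measurable:
  fixes X :: "real \<Rightarrow> 'w \<Rightarrow> real ^ 'd"
  assumes "cadlag_process M X"
  shows "(\<lambda>\<omega>. grid_increments n X \<omega> j) \<in> borel_measurable M"
    and "grid_increments n X \<in> measurable M borel_seq"
proof -
  have [measurable]: "X t \<in> borel_measurable M" if "t \<ge> 0" for t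
    using assms that by (simp add: cadlag_process_def)
  show *: "(\<lambda>\<omega>. grid_increments n X \<omega> j) \<in> borel_measurable M" for j
    by (cases j) (simp only: grid_increments_def case_prod_conv, intro borel_measurable_vec_nth_comp, simp)
  show "grid_increments n X \<in> measurable M borel_seq"
    by (rule measurable_PiM_single') (use * in auto)
qed

abbreviation path_expectation ::
    "((real \<Rightarrow> 'a) \<Rightarrow> real) \<Rightarrow> 'w measure \<Rightarrow> (real \<Rightarrow> 'w \<Rightarrow> 'a) \<Rightarrow> real" where
  "path_expectation f M X \<equiv> \<integral>\<omega>. f (sample_path X \<omega>) \<partial>M"

text \<open>Every path is the limit of its discretisations, so \<open>f\<close> of the path is a
  pointwise limit of measurable functions, and bounded convergence carries this over to
  expectations.\<close>

lemma functional_of_process: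
  fixes f :: "(real \<Rightarrow> real ^ 'd) \<Rightarrow> real" and X :: "real \<Rightarrow> 'w \<Rightarrow> real ^ 'd"
  assumes f: "continuous_map skorokhod_topology euclideanreal f"
    and bdd: "\<And>x. x \<in> skorokhod_space \<Longrightarrow> \<bar>f x\<bar> \<le> C"
    and X: "cadlag_process M X"
  shows "(\<lambda>\<omega>. f (sample_path X \<omega>)) \<in> borel_measurable M"
    and "(\<lambda>n. \<integral>\<omega>. f (step_path (Suc n) (partial_sums (grid_increments (Suc n) X \<omega>))) \<partial>M)
           \<longlonglongrightarrow> path_expectation f M X"
proof -
  let ?G = "\<lambda>n \<omega>. f (step_path (Suc n) (partial_sums (grid_increments (Suc n) X \<omega>)))"
  interpret prob_space M using X by (simp add: cadlag_process_def)
  have [measurable]: "X t \<in> borel_measurable M" if "t \<ge> 0" for t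
    using X that by (simp add: cadlag_process_def)
  define V where "V = (\<lambda>(x :: nat \<times> 'd \<Rightarrow> real) k. (\<chi> i. x (k, i)) :: real ^ 'd)"
  have V: "continuous_on UNIV (\<lambda>x. V x k)" for k
    unfolding V_def by (intro continuous_intros continuous_on_product_coordinates)
  \<comment> \<open>\<open>D\<close> uses the grid values themselves and so converges at every
    outcome. Sums of increments recover these values only where \<open>X 0\<close> vanishes, that
    is, almost everywhere.\<close>
  define D where "D = (\<lambda>n \<omega>. f (step_path (Suc n) (\<lambda>k. X (real k / Suc n) \<omega>)))"
  have lim: "(\<lambda>n. D n \<omega>) \<longlonglongrightarrow> f (sample_path X \<omega>)" if "\<omega> \<in> space M" for \<omega>
    unfolding D_def
  proof (rule skorokhod_continuous_imp_sequential[OF f])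
    show "sample_path X \<omega> \<in> skorokhod_space"
      using sample_path_in_skorokhod_space[OF X that] .
    then have "cadlag (sample_path X \<omega>)" by (simp add: skorokhod_space_def)
    from step_path_discretisation_converges[OF this]
    show "skorokhod_converges (\<lambda>n. step_path (Suc n) (\<lambda>k. X (real k / real (Suc n)) \<omega>)) (sample_path X \<omega>)"
      by (simp add: sample_path_def)
  qed (simp add: step_path_in_skorokhod_space)
  have [measurable]: "D n \<in> borel_measurable M" for n
  proof -
    have "(\<lambda>\<omega> (k, i). X (real k / Suc n) \<omega> $ i) \<in> measurable M borel_seq"
      by (rule measurable_PiM_single') (auto simp: split_beta intro!: borel_measurable_vec_nth_comp)
    from measurable_compose[OF this step_functional_measurable[OF f _ V, of "Suc n"]]
    show ?thesis by (simp add: D_def V_def vec_lambda_eta)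
  qed
  show meas[measurable]: "(\<lambda>\<omega>. f (sample_path X \<omega>)) \<in> borel_measurable M"
    by (rule borel_measurable_LIMSEQ_real[OF lim]) measurable
  have bound: "\<bar>D n \<omega>\<bar> \<le> C" for n \<omega>
    unfolding D_def by (intro bdd step_path_in_skorokhod_space) simp
  have "(\<lambda>n. \<integral>\<omega>. D n \<omega> \<partial>M) \<longlonglongrightarrow> path_expectation f M X"
    by (rule integral_dominated_convergence[where w = "\<lambda>_. C"])
       (use lim in \<open>auto intro: bdd step_path_in_skorokhod_space simp: bound\<close>)
  moreover have "(\<integral>\<omega>. D n \<omega> \<partial>M) = (\<integral>\<omega>. ?G n \<omega> \<partial>M)" for n
  proof (rule integral_cong_AE)
    show "(\<lambda>\<omega>. ?G n \<omega>) \<in> borel_measurable M"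
      by (rule measurable_compose[OF grid_increments_measurable(2)[OF X]
            step_functional_measurable[OF f _ continuous_on_partial_sums]]) simp
    have "AE \<omega> in M. X 0 \<omega> = 0" using X by (simp add: cadlag_process_def)
    then show "AE \<omega> in M. D n \<omega> = ?G n \<omega>"
    proof eventually_elim
      case (elim \<omega>)
      then show ?case
        by (simp add: D_def partial_sums_grid_increments[of X \<omega> "Suc n", OF elim, abs_def] del: of_nat_Suc)
    qed
  qed measurable
  ultimately show "(\<lambda>n. \<integral>\<omega>. ?G n \<omega> \<partial>M)
           \<longlonglongrightarrow> path_expectation f M X" by simp
qed

text \<open>One joint characteristic function expresses that the increments over cells of length
  \<open>1 / n\<close> are independent with common characteristic function
  \<open>exp (\<psi> z / n)\<close>. Recording the exponent \<psi> instead of its exponential fixes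
  the branch of the \<open>n\<close>-th root.\<close>

definition grid_exponent :: "'w measure \<Rightarrow> (real \<Rightarrow> 'w \<Rightarrow> 'a::euclidean_space) \<Rightarrow> ('a \<Rightarrow> complex) \<Rightarrow> bool" where
  "grid_exponent M X \<psi> \<longleftrightarrow>
     (\<forall>n>0. \<forall>K z. (\<integral>\<omega>. iexp (\<Sum>l<K. z l \<bullet> (X (real (Suc l) / real n) \<omega> - X (real l / real n) \<omega>)) \<partial>M) =
        (\<Prod>l<K. exp (\<psi> (z l) / of_nat n)))"

lemma grid_exponent_determines_increments:
  fixes X :: "real \<Rightarrow> 'w \<Rightarrow> real ^ 'd" and Y :: "real \<Rightarrow> 'v \<Rightarrow> real ^ 'd"
  assumes X: "cadlag_process M X" "grid_exponent M X \<psi>"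
    and Y: "cadlag_process N Y" "grid_exponent N Y \<psi>" and n: "n > 0"
  shows "distr M borel_seq (grid_increments n X) = distr N borel_seq (grid_increments n Y)"
proof -
  have char: "(\<integral>\<omega>. iexp (\<Sum>j\<in>J. c j * grid_increments n Z \<omega> j) \<partial>L) =
      (\<Prod>l<Suc (Max (fst ` J)). exp (\<psi> (\<chi> i. if (l, i) \<in> J then c (l, i) else 0) / of_nat n))"
    if Z: "grid_exponent L Z \<psi>" and J: "finite J"
    for L :: "'z measure" and Z :: "real \<Rightarrow> 'z \<Rightarrow> real ^ 'd" and J c
  proof -
    \<comment> \<open>A finite set of (cell, axis) pairs is padded with zero frequencies to full
      vectors over an initial segment of cells.\<close>
    define K where "K = Suc (Max (fst ` J))"
    define z where "z = (\<lambda>l. (\<chi> i. if (l, i) \<in> J then c (l, i) else 0) :: real ^ 'd)"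
    have JK: "J \<subseteq> {..<K} \<times> UNIV"
      using J by (force simp: K_def less_Suc_eq_le intro!: Max_ge)
    have eq: "(\<Sum>j\<in>J. c j * grid_increments n Z \<omega> j) =
        (\<Sum>l<K. z l \<bullet> (Z (real (Suc l) / real n) \<omega> - Z (real l / real n) \<omega>))" for \<omega>
    proof -
      have "(\<Sum>j\<in>J. c j * grid_increments n Z \<omega> j) =
          (\<Sum>j\<in>{..<K} \<times> UNIV. if j \<in> J then c j * grid_increments n Z \<omega> j else 0)"
        using JK by (simp add: sum.If_cases Int_absorb1)
      also have "\<dots> = (\<Sum>l<K. \<Sum>i\<in>UNIV. if (l, i) \<in> J then c (l, i) * grid_increments n Z \<omega> (l, i) else 0)"
        by (simp add: sum.cartesian_product split_beta cong: if_cong)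
      also have "\<dots> = (\<Sum>l<K. z l \<bullet> (Z (real (Suc l) / real n) \<omega> - Z (real l / real n) \<omega>))"
        by (intro sum.cong refl) (auto simp: z_def inner_vec_def grid_increments_def intro!: sum.cong)
      finally show ?thesis .
    qed
    have "(\<integral>\<omega>. iexp (\<Sum>j\<in>J. c j * grid_increments n Z \<omega> j) \<partial>L) = (\<Prod>l<K. exp (\<psi> (z l) / of_nat n))"
      unfolding eq using Z n by (simp only: grid_exponent_def)
    then show ?thesis unfolding K_def z_def .
  qed
  have "distr M borel_seq (\<lambda>\<omega> j. grid_increments n X \<omega> j) = distr N borel_seq (\<lambda>\<omega> j. grid_increments n Y \<omega> j)"
  proof (rule joint_char_determines_law)
    show "prob_space M" "prob_space N" using X Y by (auto simp: cadlag_process_def)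
    show "(\<integral>\<omega>. iexp (\<Sum>j\<in>J. c j * grid_increments n X \<omega> j) \<partial>M) = (\<integral>\<omega>. iexp (\<Sum>j\<in>J. c j * grid_increments n Y \<omega> j) \<partial>N)"
      if "finite J" for J c
      using char[OF X(2) that] char[OF Y(2) that] by simp
  qed (auto intro: grid_increments_measurable X Y)
  then show ?thesis by simp
qed

text \<open>Both expectations are limits of one and the same sequence, since the discretised
  expectations depend only on the law of the grid increments.\<close>

lemma functional_expectation_eq:
  fixes f :: "(real \<Rightarrow> real ^ 'd) \<Rightarrow> real" and X :: "real \<Rightarrow> 'w \<Rightarrow> real ^ 'd" and Y :: "real \<Rightarrow> 'v \<Rightarrow> real ^ 'd"
  assumes f: "continuous_map skorokhod_topology euclideanreal f"
    and bdd: "\<And>x. x \<in> skorokhod_space \<Longrightarrow> \<bar>f x\<bar> \<le> C"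
    and X: "cadlag_process M X" "grid_exponent M X \<psi>"
    and Y: "cadlag_process N Y" "grid_exponent N Y \<psi>"
  shows "path_expectation f M X = path_expectation f N Y"
proof -
  let ?G = "\<lambda>n x. f (step_path (Suc n) (partial_sums x))"
  have G: "?G n \<in> borel_measurable borel_seq" for n
    by (rule step_functional_measurable[OF f _ continuous_on_partial_sums]) simp
  have "(\<integral>\<omega>. ?G n (grid_increments (Suc n) X \<omega>) \<partial>M) = (\<integral>\<omega>. ?G n (grid_increments (Suc n) Y \<omega>) \<partial>N)" for n
    using grid_exponent_determines_increments[OF X Y, of "Suc n"]
      integral_distr[OF grid_increments_measurable(2)[OF X(1)] G, of "Suc n" n]
      integral_distr[OF grid_increments_measurable(2)[OF Y(1)] G, of "Suc n" n] by simp
  with functional_of_process(2)[OF f bdd X(1)] functional_of_process(2)[OF f bdd Y(1)]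
  show ?thesis by (simp add: LIMSEQ_unique)
qed


section \<open>Increments of Levy processes\<close>

lemma continuous_on_char_fun:
  fixes Z :: "'w \<Rightarrow> 'a::euclidean_space"
  assumes "prob_space M" and [measurable]: "Z \<in> borel_measurable M"
  shows "continuous_on UNIV (\<lambda>z. \<integral>\<omega>. iexp (z \<bullet> Z \<omega>) \<partial>M)"
  unfolding continuous_on_sequentially
proof (intro allI ballI impI)
  interpret prob_space M by fact
  fix x :: "nat \<Rightarrow> 'a" and a assume "(\<forall>n. x n \<in> UNIV) \<and> x \<longlonglongrightarrow> a"
  then have x: "x \<longlonglongrightarrow> a" by simp
  show "((\<lambda>z. \<integral>\<omega>. iexp (z \<bullet> Z \<omega>) \<partial>M) \<circ> x) \<longlonglongrightarrow> (\<integral>\<omega>. iexp (a \<bullet> Z \<omega>) \<partial>M)"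
    unfolding o_def
    by (rule integral_dominated_convergence[where w = "\<lambda>_. 1"]) (auto intro!: tendsto_intros x)
qed

text \<open>The \<open>n\<close>-th root of the characteristic function is unambiguous: two continuous roots differ
  by a continuous function with values in the \<open>n\<close>-th roots of unity.\<close>

lemma continuous_nth_root_of_exp_unique:
  fixes \<phi> \<psi> :: "'a::real_normed_vector \<Rightarrow> complex"
  assumes \<phi>: "continuous_on UNIV \<phi>" "\<phi> 0 = 1" and \<psi>: "continuous_on UNIV \<psi>" "\<psi> 0 = 0"
    and "n > 0" and root: "\<And>z. \<phi> z ^ n = exp (\<psi> z)"
  shows "\<phi> z = exp (\<psi> z / of_nat n)"
proof -
  define g where "g = (\<lambda>z. \<phi> z * exp (- \<psi> z / of_nat n))"
  have pow: "exp (w / of_nat n) ^ n = exp w" for w :: complex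
    using \<open>n > 0\<close> by (simp add: exp_of_nat_mult[symmetric])
  have "g z ^ n = 1" for z
    unfolding g_def power_mult_distrib root pow by (simp add: exp_minus)
  then have "g ` UNIV \<subseteq> {w. w ^ n = 1}" by auto
  moreover have "finite {w :: complex. w ^ n = 1}"
    using \<open>n > 0\<close> by (intro finite_roots_unity) auto
  ultimately have "finite (g ` UNIV)" by (rule finite_subset)
  moreover have "continuous_on UNIV g"
    unfolding g_def using \<open>n > 0\<close> by (intro continuous_intros \<phi> \<psi>) auto
  ultimately have "g constant_on UNIV"
    by (intro continuous_finite_range_constant) auto
  then have "g z = g 0" unfolding constant_on_def by auto
  then have "\<phi> z * exp (- \<psi> z / of_nat n) = 1" by (simp add: g_def \<phi> \<psi>)
  then show ?thesis by (simp add: exp_minus field_simps)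
qed

lemma levy_process_cadlag_process:
  assumes "levy_process M X"
  shows "cadlag_process M X"
proof -
  interpret levy_process M X by fact
  show ?thesis
    unfolding cadlag_process_def
    using prob_space_axioms measurable_at starts_at_0 cadlag_paths by auto
qed

text \<open>Stationarity gives all cells one characteristic function \<phi>, and independence makes
  joint ones products. The first \<open>n\<close> cells add up to \<open>X 1\<close>, so
  \<open>\<phi> z ^ n = exp (\<psi> z)\<close>; continuity then picks the root.\<close>

lemma levy_process_grid_exponent:
  fixes X :: "real \<Rightarrow> 'w \<Rightarrow> 'a::euclidean_space"
  assumes "levy_process M X"
    and cf: "\<And>z. (\<integral>\<omega>. iexp (z \<bullet> X 1 \<omega>) \<partial>M) = exp (\<psi> z)"
    and \<psi>: "continuous_on UNIV \<psi>" "\<psi> 0 = 0"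
  shows "grid_exponent M X \<psi>"
  unfolding grid_exponent_def
proof (intro allI impI)
  interpret levy_process M X by fact
  have [measurable]: "X t \<in> borel_measurable M" if "t \<ge> 0" for t
    using measurable_at that .
  fix n K :: nat and z :: "nat \<Rightarrow> 'a" assume n: "n > 0"
  define \<Delta> where "\<Delta> = (\<lambda>l \<omega>. X (real (Suc l) / n) \<omega> - X (real l / n) \<omega>)"
  define \<phi> where "\<phi> = (\<lambda>z. \<integral>\<omega>. iexp (z \<bullet> X (1 / n) \<omega>) \<partial>M)"
  have \<Delta>[measurable]: "\<Delta> l \<in> borel_measurable M" for l
    unfolding \<Delta>_def by measurable
  have indep: "indep_vars (\<lambda>_. borel) \<Delta> {..<m}" for m
    using independent_increments[of "\<lambda>k. real k / n" m] n
    by (auto simp: \<Delta>_def strict_mono_def divide_strict_right_mono)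
  have law: "(\<integral>\<omega>. iexp (z \<bullet> \<Delta> l \<omega>) \<partial>M) = \<phi> z" for z l
  proof -
    have "distr M borel (\<Delta> l) = distr M borel (X (1 / n))"
      using stationary_increments[of "real l / n" "1 / n"]
      by (simp add: \<Delta>_def add_divide_distrib add.commute)
    then have "(\<integral>x. iexp (z \<bullet> x) \<partial>distr M borel (\<Delta> l)) = (\<integral>x. iexp (z \<bullet> x) \<partial>distr M borel (X (1 / n)))"
      by simp
    then show ?thesis by (simp add: integral_distr \<phi>_def)
  qed
  have prod: "(\<integral>\<omega>. iexp (\<Sum>l<m. z l \<bullet> \<Delta> l \<omega>) \<partial>M) = (\<Prod>l<m. \<phi> (z l))" for m z
  proof -
    have "indep_vars (\<lambda>_. borel) (\<lambda>l \<omega>. iexp (z l \<bullet> \<Delta> l \<omega>)) {..<m}"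
      by (rule indep_vars_compose2[OF indep]) measurable
    then have "(\<integral>\<omega>. (\<Prod>l<m. iexp (z l \<bullet> \<Delta> l \<omega>)) \<partial>M) = (\<Prod>l<m. \<integral>\<omega>. iexp (z l \<bullet> \<Delta> l \<omega>) \<partial>M)"
      by (intro indep_vars_lebesgue_integral) (auto intro!: integrable_const_bound[where B = 1])
    then show ?thesis
      by (simp add: law exp_sum[symmetric] sum_distrib_left)
  qed
  have "\<phi> z ^ n = exp (\<psi> z)" for z
  proof -
    \<comment> \<open>The sum telescopes to \<open>X 1 - X 0\<close>, and the subtracted term
      vanishes only almost everywhere.\<close>
    have tele: "(\<Sum>l<m. z \<bullet> \<Delta> l \<omega>) = z \<bullet> (X (real m / n) \<omega> - X 0 \<omega>)" for \<omega> m
      by (induction m) (auto simp: \<Delta>_def inner_diff_right)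
    have "\<phi> z ^ n = (\<integral>\<omega>. iexp (\<Sum>l<n. z \<bullet> \<Delta> l \<omega>) \<partial>M)"
      unfolding prod by simp
    also have "\<dots> = (\<integral>\<omega>. iexp (z \<bullet> X 1 \<omega>) \<partial>M)"
    proof (rule integral_cong_AE)
      show "AE \<omega> in M. iexp (\<Sum>l<n. z \<bullet> \<Delta> l \<omega>) = iexp (z \<bullet> X 1 \<omega>)"
        using starts_at_0 by eventually_elim (use n in \<open>simp add: tele\<close>)
    qed measurable
    finally show ?thesis by (simp add: cf)
  qed
  then have "\<phi> z = exp (\<psi> z / of_nat n)" for z
    using \<psi> n by (intro continuous_nth_root_of_exp_unique)
      (auto simp: \<phi>_def prob_space intro!: continuous_on_char_fun prob_space_axioms)
  then show "(\<integral>\<omega>. iexp (\<Sum>l<K. z l \<bullet> (X (real (Suc l) / n) \<omega> - X (real l / n) \<omega>)) \<partial>M) = (\<Prod>l<K. exp (\<psi> (z l) / of_nat n))"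
    using prod[of z K] by (simp add: \<Delta>_def)
qed

lemma cadlag_process_scaleR:
  fixes X :: "real \<Rightarrow> 'w \<Rightarrow> 'a::euclidean_space"
  assumes "cadlag_process M X"
  shows "cadlag_process M (\<lambda>t \<omega>. c *\<^sub>R X t \<omega>)"
proof -
  have "cadlag (\<lambda>t. c *\<^sub>R x t)" if "cadlag x" for x :: "real \<Rightarrow> 'a"
    unfolding cadlag_def
  proof (intro conjI allI impI)
    fix t :: real
    show "((\<lambda>t. c *\<^sub>R x t) \<longlongrightarrow> c *\<^sub>R x t) (at_right t)" if "0 \<le> t"
      using \<open>cadlag x\<close> that by (auto simp: cadlag_def intro!: tendsto_intros)
    assume "0 < t"
    then obtain l where "(x \<longlongrightarrow> l) (at_left t)" using \<open>cadlag x\<close> by (auto simp: cadlag_def)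
    then have "((\<lambda>t. c *\<^sub>R x t) \<longlongrightarrow> c *\<^sub>R l) (at_left t)" by (intro tendsto_intros)
    then show "\<exists>l. ((\<lambda>t. c *\<^sub>R x t) \<longlongrightarrow> l) (at_left t)" ..
  qed
  then show ?thesis using assms by (auto simp: cadlag_process_def)
qed

lemma grid_exponent_scaleR:
  fixes X :: "real \<Rightarrow> 'w \<Rightarrow> 'a::euclidean_space"
  assumes "grid_exponent M X \<psi>"
  shows "grid_exponent M (\<lambda>t \<omega>. c *\<^sub>R X t \<omega>) (\<lambda>z. \<psi> (c *\<^sub>R z))"
proof -
  have eq: "z \<bullet> (c *\<^sub>R x - c *\<^sub>R y) = (c *\<^sub>R z) \<bullet> (x - y)" for x y z :: 'a
    by (simp add: inner_diff_right right_diff_distrib)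
  show ?thesis
    unfolding grid_exponent_def
  proof (intro allI impI)
    fix n K :: nat and z :: "nat \<Rightarrow> 'a" assume "n > 0"
    then show "(\<integral>\<omega>. iexp (\<Sum>l<K. z l \<bullet> (c *\<^sub>R X (real (Suc l) / real n) \<omega> - c *\<^sub>R X (real l / real n) \<omega>)) \<partial>M) =
        (\<Prod>l<K. exp (\<psi> (c *\<^sub>R z l) / of_nat n))"
      unfolding eq by (rule assms[unfolded grid_exponent_def, rule_format, where z = "\<lambda>l. c *\<^sub>R z l"])
  qed
qed


section \<open>Compound Poisson blocks\<close>

text \<open>Only the coordinates in \<open>J\<close> matter, so the infinite product is first
  projected onto a finite one.\<close>

lemma integral_PiM_prod:
  fixes f :: "'i \<Rightarrow> 'e \<Rightarrow> complex"
  assumes M: "\<And>i. prob_space (M i)" and "finite J"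
    and f[measurable]: "\<And>i. f i \<in> borel_measurable (M i)" and bound: "\<And>i x. norm (f i x) \<le> B"
  shows "(\<integral>x. (\<Prod>i\<in>J. f i (x i)) \<partial>PiM UNIV M) = (\<Prod>i\<in>J. \<integral>x. f i x \<partial>M i)"
proof -
  interpret product_prob_space M UNIV by (intro product_prob_spaceI M)
  interpret F: finite_product_prob_space M J by standard fact
  have [measurable]: "(\<lambda>x. \<Prod>i\<in>J. f i (x i)) \<in> borel_measurable (PiM J M)" by measurable
  have [measurable]: "(\<lambda>x. restrict x J) \<in> measurable (PiM UNIV M) (PiM J M)"
    by (rule measurable_restrict_subset) simp
  have "(\<integral>x. (\<Prod>i\<in>J. f i (x i)) \<partial>PiM UNIV M) = (\<integral>x. (\<Prod>i\<in>J. f i (restrict x J i)) \<partial>PiM UNIV M)"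
    by (intro Bochner_Integration.integral_cong refl prod.cong) auto
  also have "\<dots> = (\<integral>x. (\<Prod>i\<in>J. f i (x i)) \<partial>distr (PiM UNIV M) (PiM J M) (\<lambda>x. restrict x J))"
    by (subst integral_distr) auto
  also have "\<dots> = (\<integral>x. (\<Prod>i\<in>J. f i (x i)) \<partial>PiM J M)"
    using \<open>finite J\<close> by (subst distr_PiM_restrict_finite) auto
  also have "\<dots> = (\<Prod>i\<in>J. \<integral>x. f i x \<partial>M i)"
  proof (rule product_integral_prod[OF \<open>finite J\<close>])
    fix i
    show "integrable (M i) (f i)"
      using prob_space.finite_measure[OF M]
      by (rule finite_measure.integrable_const_bound[where B = B]) (auto simp: bound)
  qed
  finally show ?thesis .
qed

lemma poisson_pmf_generating_function:
  fixes z :: complex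
  assumes r: "r > 0" and z: "norm z \<le> 1"
  shows "(\<integral>n. z ^ n \<partial>measure_pmf (poisson_pmf r)) = exp (r * (z - 1))"
proof -
  have pow: "norm (z ^ n) \<le> 1" for n using z by (simp add: norm_power power_le_one)
  have eq: "pmf (poisson_pmf r) n *\<^sub>R z ^ n = exp (- r) *\<^sub>R (((r *\<^sub>R z) ^ n) /\<^sub>R fact n)" for n
    using r by (simp add: power_mult_distrib scaleR_conv_of_real field_simps)
  have "(\<lambda>n. exp (- r) *\<^sub>R (((r *\<^sub>R z) ^ n) /\<^sub>R fact n)) sums (exp (- r) *\<^sub>R exp (r *\<^sub>R z))"
    by (intro sums_scaleR_right exp_converges)
  then have sums: "(\<lambda>n. pmf (poisson_pmf r) n *\<^sub>R z ^ n) sums (exp (- r) *\<^sub>R exp (r *\<^sub>R z))"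
    unfolding eq .
  have int: "integrable (count_space UNIV) (\<lambda>n. pmf (poisson_pmf r) n *\<^sub>R z ^ n)"
  proof (rule Bochner_Integration.integrable_bound)
    show "integrable (count_space UNIV) (pmf (poisson_pmf r))" by (rule integrable_pmf)
    show "AE n in count_space UNIV. norm (pmf (poisson_pmf r) n *\<^sub>R z ^ n) \<le> norm (pmf (poisson_pmf r) n)"
      by (intro always_eventually allI) (simp add: pow mult_left_le del: pmf_poisson)
  qed simp
  have "(\<integral>n. z ^ n \<partial>measure_pmf (poisson_pmf r)) = (\<integral>n. pmf (poisson_pmf r) n *\<^sub>R z ^ n \<partial>count_space UNIV)"
    unfolding measure_pmf_eq_density by (rule integral_density) auto
  also have "\<dots> = exp (- r) *\<^sub>R exp (r *\<^sub>R z)"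
    using sums_integral_count_space_nat[OF int] sums sums_unique2 by blast
  also have "\<dots> = exp (r * (z - 1))"
    by (simp add: scaleR_conv_of_real algebra_simps exp_diff exp_minus exp_of_real[symmetric] field_simps)
  finally show ?thesis .
qed

text \<open>Multiplying the weight at \<open>Suc n\<close> by \<open>Suc n\<close> gives
  \<open>r\<close> times the weight at \<open>n\<close>, so the series is again exponential.\<close>

lemma poisson_pmf_finite_mean:
  assumes r: "r > 0"
  shows "(\<integral>\<^sup>+n. ennreal (real n) \<partial>measure_pmf (poisson_pmf r)) < \<infinity>"
proof -
  have "summable (\<lambda>n. r * exp (- r) * (inverse (fact n) * r ^ n))"
    by (intro summable_mult summable_exp)
  also have "(\<lambda>n. r * exp (- r) * (inverse (fact n) * r ^ n)) = (\<lambda>n. pmf (poisson_pmf r) (Suc n) * real (Suc n))"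
  proof
    fix n
    have "inverse (fact n :: real) = real (Suc n) / fact (Suc n)"
      by (simp only: fact_Suc) (simp add: inverse_eq_divide del: of_nat_Suc)
    then show "r * exp (- r) * (inverse (fact n) * r ^ n) = pmf (poisson_pmf r) (Suc n) * real (Suc n)"
      using r by simp
  qed
  finally have s: "summable (\<lambda>n. pmf (poisson_pmf r) n * real n)"
    using summable_Suc_iff[of "\<lambda>n. pmf (poisson_pmf r) n * real n"] by blast
  have "(\<integral>\<^sup>+n. ennreal (real n) \<partial>measure_pmf (poisson_pmf r)) = (\<Sum>n. ennreal (pmf (poisson_pmf r) n * real n))"
    by (subst nn_integral_measure_pmf) (simp add: nn_integral_count_space_nat ennreal_mult' del: pmf_poisson)
  also have "\<dots> < \<infinity>"
  proof -
    have "(\<Sum>n. ennreal (pmf (poisson_pmf r) n * real n)) \<noteq> top"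
      by (rule ennreal_suminf_neq_top[OF s]) (intro mult_nonneg_nonneg pmf_nonneg of_nat_0_le_iff)
    then show ?thesis by (simp only: infinity_ennreal_def top.not_eq_extremum)
  qed
  finally show ?thesis .
qed

section \<open>Compound Poisson sums over marks with uniform times\<close>

abbreviation unif_time :: "real measure" where
  "unif_time \<equiv> uniform_measure lborel {0<..1}"

definition timed_mark_law :: "'e measure \<Rightarrow> (real \<times> 'e) measure" where
  "timed_mark_law D = unif_time \<Otimes>\<^sub>M D"

abbreviation marks_law :: "'e measure \<Rightarrow> (nat \<Rightarrow> real \<times> 'e) measure" where
  "marks_law D \<equiv> PiM UNIV (\<lambda>_. timed_mark_law D)"

definition block_law :: "real \<Rightarrow> 'e measure \<Rightarrow> (nat \<times> (nat \<Rightarrow> real \<times> 'e)) measure" where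
  "block_law r D = measure_pmf (poisson_pmf r) \<Otimes>\<^sub>M marks_law D"

lemma prob_space_uniform_01: "prob_space (unif_time)"
  by (intro prob_space_uniform_measure) auto

lemma prob_space_timed_mark_law:
  assumes "prob_space D"
  shows "prob_space (timed_mark_law D)"
proof -
  interpret D: prob_space D by fact
  interpret U: prob_space unif_time by (rule prob_space_uniform_01)
  interpret pair_prob_space unif_time D ..
  show ?thesis unfolding timed_mark_law_def by (rule prob_space_axioms)
qed

lemma prob_space_block_law:
  assumes "prob_space D"
  shows "prob_space (block_law r D)"
proof -
  interpret Q: prob_space "marks_law D"
    by (intro prob_space_PiM prob_space_timed_mark_law assms)
  interpret pair_prob_space "measure_pmf (poisson_pmf r)" "marks_law D" ..
  show ?thesis unfolding block_law_def by (rule prob_space_axioms)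
qed

definition block_sum :: "(real \<times> 'e \<Rightarrow> 'b::real_normed_vector) \<Rightarrow> nat \<times> (nat \<Rightarrow> real \<times> 'e) \<Rightarrow> 'b" where
  "block_sum g b = (\<Sum>m<fst b. g (snd b m))"

lemma borel_measurable_block_sum:
  fixes g :: "real \<times> 'e \<Rightarrow> 'b::{real_normed_vector, second_countable_topology}"
  assumes [measurable]: "g \<in> borel_measurable (timed_mark_law D)"
  shows "block_sum g \<in> borel_measurable (block_law r D)"
proof -
  have "(\<lambda>b. \<Sum>m<n. g (snd b m)) \<in> borel_measurable (measure_pmf (poisson_pmf r) \<Otimes>\<^sub>M marks_law D)" for n
    by measurable
  then have "(\<lambda>b. (\<lambda>n b. \<Sum>m<n. g (snd b m)) (fst b) b) \<in> borel_measurable (measure_pmf (poisson_pmf r) \<Otimes>\<^sub>M marks_law D)"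
    by (rule measurable_compose_countable) simp
  then show ?thesis by (simp add: block_law_def block_sum_def[abs_def])
qed

text \<open>Given the count \<open>n\<close>, independence of the marks yields \<open>w ^ n\<close>;
  averaging over the count evaluates the Poisson generating function at \<open>w\<close>, which lies
  in the unit disc.\<close>

lemma block_sum_char:
  fixes g :: "real \<times> 'e \<Rightarrow> real"
  assumes r: "r > 0" and D: "prob_space D" and g[measurable]: "g \<in> borel_measurable (timed_mark_law D)"
  shows "(\<integral>b. iexp (block_sum g b) \<partial>block_law r D) = exp (r * (\<integral>p. (iexp (g p) - 1) \<partial>timed_mark_law D))"
proof -
  interpret T: prob_space "timed_mark_law D" by (rule prob_space_timed_mark_law[OF D])
  interpret Q: prob_space "marks_law D"
    by (intro prob_space_PiM prob_space_timed_mark_law D)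
  interpret PP: pair_prob_space "measure_pmf (poisson_pmf r)" "marks_law D" ..
  define w where "w = (\<integral>p. iexp (g p) \<partial>timed_mark_law D)"
  have meas: "(\<lambda>b. iexp (block_sum g b)) \<in> borel_measurable (measure_pmf (poisson_pmf r) \<Otimes>\<^sub>M marks_law D)"
    using borel_measurable_block_sum[OF g, of r] unfolding block_law_def by measurable
  have "(\<integral>b. iexp (block_sum g b) \<partial>block_law r D) =
      (\<integral>n. (\<integral>x. iexp (block_sum g (n, x)) \<partial>marks_law D) \<partial>measure_pmf (poisson_pmf r))"
    unfolding block_law_def
  proof (rule PP.integral_fst'[of "\<lambda>b. iexp (block_sum g b)", symmetric])
    show "integrable (measure_pmf (poisson_pmf r) \<Otimes>\<^sub>M marks_law D) (\<lambda>b. iexp (block_sum g b))"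
      using meas by (rule PP.integrable_const_bound[where B = 1, rotated]) simp
  qed
  also have "(\<lambda>n. \<integral>x. iexp (block_sum g (n, x)) \<partial>marks_law D) = (\<lambda>n. w ^ n)"
  proof
    fix n :: nat
    have "(\<integral>x. iexp (block_sum g (n, x)) \<partial>marks_law D) = (\<integral>x. (\<Prod>m<n. iexp (g (x m))) \<partial>marks_law D)"
      by (simp add: block_sum_def exp_sum[symmetric] sum_distrib_left)
    also have "\<dots> = w ^ n"
      using integral_PiM_prod[where M = "\<lambda>_::nat. timed_mark_law D" and f = "\<lambda>_ p. iexp (g p)" and J = "{..<n}" and B = 1,
          OF T.prob_space_axioms] by (simp add: w_def)
    finally show "(\<integral>x. iexp (block_sum g (n, x)) \<partial>marks_law D) = w ^ n" .
  qed
  also have "(\<integral>n. w ^ n \<partial>measure_pmf (poisson_pmf r)) = exp (r * (w - 1))"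
  proof (rule poisson_pmf_generating_function[OF r])
    have "norm w \<le> (\<integral>p. norm (iexp (g p)) \<partial>timed_mark_law D)" unfolding w_def by (rule integral_norm_bound)
    also have "\<dots> = 1" by (simp add: T.prob_space)
    finally show "norm w \<le> 1" .
  qed
  finally have main: "(\<integral>b. iexp (block_sum g b) \<partial>block_law r D) = exp (r * (w - 1))" .
  have "w - 1 = (\<integral>p. (iexp (g p) - 1) \<partial>timed_mark_law D)"
  proof -
    have "integrable (timed_mark_law D) (\<lambda>p. iexp (g p))"
      by (rule T.integrable_const_bound[where B = 1]) auto
    then have "(\<integral>p. (iexp (g p) - 1) \<partial>timed_mark_law D) = w - (\<integral>p. 1 \<partial>timed_mark_law D)"
      unfolding w_def by (rule Bochner_Integration.integral_diff) (rule T.integrable_const)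
    then show ?thesis by (simp add: T.prob_space)
  qed
  then show ?thesis using main by (simp only:)
qed

text \<open>The M-test is uniform in \<open>t\<close>, so one-sided limits pass through the series.
  The left limits inherit the bounds \<open>c k\<close>, which makes their own series
  converge.\<close>

lemma cadlag_suminf:
  fixes F :: "nat \<Rightarrow> real \<Rightarrow> 'a::banach"
  assumes F: "\<And>k. cadlag (F k)" and bound: "\<And>k t. norm (F k t) \<le> c k" and c: "summable c"
  shows "cadlag (\<lambda>t. \<Sum>k. F k t)"
  unfolding cadlag_def
proof (intro conjI allI impI)
  have unif: "uniform_limit A (\<lambda>n t. \<Sum>k<n. F k t) (\<lambda>t. \<Sum>k. F k t) sequentially" for A
    by (rule Weierstrass_m_test[OF bound c])
  fix t :: real
  show "((\<lambda>t. \<Sum>k. F k t) \<longlongrightarrow> (\<Sum>k. F k t)) (at_right t)" if "t \<ge> 0"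
  proof (rule swap_uniform_limit[OF _ _ unif])
    show "\<forall>\<^sub>F n in sequentially. ((\<lambda>t. \<Sum>k<n. F k t) \<longlongrightarrow> (\<Sum>k<n. F k t)) (at_right t)"
      using F that by (intro always_eventually allI tendsto_sum) (auto simp: cadlag_def)
    show "(\<lambda>n. \<Sum>k<n. F k t) \<longlonglongrightarrow> (\<Sum>k. F k t)"
      by (intro summable_LIMSEQ summable_comparison_test[OF _ c] exI[of _ 0]) (use bound in auto)
  qed simp
  assume "t > 0"
  then have "\<exists>l. (F k \<longlongrightarrow> l) (at_left t)" for k using F by (auto simp: cadlag_def)
  then obtain l where l: "\<And>k. (F k \<longlongrightarrow> l k) (at_left t)" by metis
  have lb: "norm (l k) \<le> c k" for k
    by (rule tendsto_upperbound[OF tendsto_norm[OF l]]) (auto simp: bound)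
  have "((\<lambda>t. \<Sum>k. F k t) \<longlongrightarrow> (\<Sum>k. l k)) (at_left t)"
  proof (rule swap_uniform_limit[OF _ _ unif])
    show "\<forall>\<^sub>F n in sequentially. ((\<lambda>t. \<Sum>k<n. F k t) \<longlongrightarrow> (\<Sum>k<n. l k)) (at_left t)"
      using l by (intro always_eventually allI tendsto_sum)
    show "(\<lambda>n. \<Sum>k<n. l k) \<longlonglongrightarrow> (\<Sum>k. l k)"
      by (intro summable_LIMSEQ summable_comparison_test[OF _ c] exI[of _ 0]) (use lb in auto)
  qed simp
  then show "\<exists>l. ((\<lambda>t. \<Sum>k. F k t) \<longlongrightarrow> l) (at_left t)" ..
qed

lemma cadlag_sum:
  fixes F :: "'i \<Rightarrow> real \<Rightarrow> 'a::real_normed_vector"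
  assumes "\<And>i. i \<in> I \<Longrightarrow> cadlag (F i)"
  shows "cadlag (\<lambda>t. \<Sum>i\<in>I. F i t)"
  unfolding cadlag_def
proof (intro conjI allI impI)
  fix t :: real
  show "((\<lambda>t. \<Sum>i\<in>I. F i t) \<longlongrightarrow> (\<Sum>i\<in>I. F i t)) (at_right t)" if "t \<ge> 0"
    using assms that by (intro tendsto_sum) (auto simp: cadlag_def)
  assume "t > 0"
  then have "\<forall>i\<in>I. \<exists>l. (F i \<longlongrightarrow> l) (at_left t)" using assms by (auto simp: cadlag_def)
  then obtain l where "\<And>i. i \<in> I \<Longrightarrow> (F i \<longlongrightarrow> l i) (at_left t)" by metis
  then have "((\<lambda>t. \<Sum>i\<in>I. F i t) \<longlongrightarrow> (\<Sum>i\<in>I. l i)) (at_left t)" by (rule tendsto_sum)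
  then show "\<exists>l. ((\<lambda>t. \<Sum>i\<in>I. F i t) \<longlongrightarrow> l) (at_left t)" ..
qed


section \<open>Processes driven by a Poisson point process\<close>

text \<open>Block \<open>(j, k)\<close> holds the points with time in \<open>(j, j + 1]\<close> and mark in the \<open>k\<close>-th part of the
  mark space: a Poisson number of them, and an i.i.d. sequence from which that many are taken. Jumps
  in part \<open>k\<close> have size at most \<open>2\<^sup>-\<^sup>k\<close>, so on \<open>good\<close> outcomes the jumps of a time block are
  summable, uniformly in the jump functions.\<close>

locale poisson_blocks =
  fixes rate :: real and D :: "nat \<Rightarrow> 'e measure"
  assumes rate_pos: "rate > 0" and prob_D: "\<And>k. prob_space (D k)"
begin

definition \<Omega> :: "(nat \<times> nat \<Rightarrow> nat \<times> (nat \<Rightarrow> real \<times> 'e)) measure" where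
  "\<Omega> = PiM UNIV (\<lambda>i. block_law rate (D (snd i)))"

definition good :: "(nat \<times> nat \<Rightarrow> nat \<times> (nat \<Rightarrow> real \<times> 'e)) \<Rightarrow> bool" where
  "good \<omega> \<longleftrightarrow> (\<forall>j. (\<Sum>k. ennreal (real (fst (\<omega> (j, k))) * (1 / 2) ^ k)) < \<infinity>)"

text \<open>The test \<open>0 < fst p\<close> concerns an event of probability zero, but it ensures
  at every outcome that block \<open>j\<close> contributes nothing up to time
  \<open>j\<close>.\<close>

definition jump_by :: "(nat \<Rightarrow> 'e \<Rightarrow> 'b::real_normed_vector) \<Rightarrow> nat \<Rightarrow> nat \<Rightarrow> real \<Rightarrow> real \<times> 'e \<Rightarrow> 'b" where
  "jump_by F j k t p = (if 0 < fst p \<and> real j + fst p \<le> t then F k (snd p) else 0)"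

text \<open>Only blocks \<open>j < \<lceil>t\<rceil>\<close> can have jumped by time
  \<open>t\<close>. The default 0 off \<open>good\<close> keeps every path cadlag, and
  \<open>good\<close> does not involve \<open>F\<close>, so different jump functions share
  it.\<close>

definition jump_process :: "(nat \<Rightarrow> 'e \<Rightarrow> 'b::real_normed_vector) \<Rightarrow> real \<Rightarrow> (nat \<times> nat \<Rightarrow> nat \<times> (nat \<Rightarrow> real \<times> 'e)) \<Rightarrow> 'b" where
  "jump_process F t \<omega> =
     (if good \<omega> then \<Sum>j<nat \<lceil>t\<rceil>. \<Sum>k. block_sum (jump_by F j k t) (\<omega> (j, k)) else 0)"

sublocale prob_space \<Omega>
  unfolding \<Omega>_def by (intro prob_space_PiM prob_space_block_law prob_D)

lemma block_measurable: "(\<lambda>\<omega>. \<omega> (j, k)) \<in> measurable \<Omega> (block_law rate (D k))"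
  unfolding \<Omega>_def using measurable_component_singleton[of "(j, k)" UNIV "\<lambda>i. block_law rate (D (snd i))"] by simp

lemma distr_block: "distr \<Omega> (block_law rate (D k)) (\<lambda>\<omega>. \<omega> (j, k)) = block_law rate (D k)"
  unfolding \<Omega>_def
  using distr_PiM_component[of UNIV "\<lambda>i. block_law rate (D (snd i))" "(j, k)"]
  by (simp add: prob_space_block_law prob_D)

lemma count_measurable[measurable]: "(\<lambda>\<omega>. real (fst (\<omega> (j, k)))) \<in> borel_measurable \<Omega>"
proof -
  have "(\<lambda>b. real (fst b)) \<in> borel_measurable (block_law rate (D k))"
    unfolding block_law_def by (rule measurable_compose[OF measurable_fst]) simp
  then show ?thesis by (rule measurable_compose[OF block_measurable])
qed

lemma good_measurable[measurable]: "Measurable.pred \<Omega> good"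
  unfolding good_def[abs_def] by measurable

lemma good_imp_summable:
  assumes "good \<omega>"
  shows "summable (\<lambda>k. real (fst (\<omega> (j, k))) * (1 / 2) ^ k)"
  using assms unfolding good_def
  by (intro summable_suminf_not_top) (auto simp: less_top)

text \<open>All blocks have the same mean count, so the expected value of the series is this mean
  times a geometric series, and a nonnegative variable of finite expectation is almost surely
  finite.\<close>

lemma AE_good: "AE \<omega> in \<Omega>. good \<omega>"
proof -
  let ?S = "\<lambda>j \<omega>. \<Sum>k. ennreal (real (fst (\<omega> (j, k))) * (1 / 2) ^ k)"
  have "AE \<omega> in \<Omega>. ?S j \<omega> \<noteq> \<infinity>" for j
  proof (rule nn_integral_PInf_AE)
    define m where "m = (\<integral>\<^sup>+n. ennreal (real n) \<partial>measure_pmf (poisson_pmf rate))"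
    have mean: "(\<integral>\<^sup>+\<omega>. ennreal (real (fst (\<omega> (j, k)))) \<partial>\<Omega>) = m" for k
    proof -
      interpret Q: prob_space "marks_law (D k)"
        by (intro prob_space_PiM prob_space_timed_mark_law prob_D)
      have meas: "(\<lambda>b. ennreal (real (fst b))) \<in> borel_measurable (block_law rate (D k))"
        unfolding block_law_def by (rule measurable_compose[OF measurable_fst]) simp
      have "(\<integral>\<^sup>+\<omega>. ennreal (real (fst (\<omega> (j, k)))) \<partial>\<Omega>) = (\<integral>\<^sup>+b. ennreal (real (fst b)) \<partial>block_law rate (D k))"
        using nn_integral_distr[OF block_measurable[of j k], of "\<lambda>b. ennreal (real (fst b))"] meas
        by (simp add: distr_block)
      also have "\<dots> = (\<integral>\<^sup>+n. (\<integral>\<^sup>+x. ennreal (real n) \<partial>marks_law (D k)) \<partial>measure_pmf (poisson_pmf rate))"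
        using Q.nn_integral_fst[of "\<lambda>b. ennreal (real (fst b))" "measure_pmf (poisson_pmf rate)"] meas
        by (simp add: block_law_def)
      finally show ?thesis by (simp add: m_def Q.emeasure_space_1)
    qed
    have "(\<integral>\<^sup>+\<omega>. ?S j \<omega> \<partial>\<Omega>) = (\<Sum>k. \<integral>\<^sup>+\<omega>. ennreal (real (fst (\<omega> (j, k))) * (1 / 2) ^ k) \<partial>\<Omega>)"
      by (rule nn_integral_suminf) measurable
    also have "\<dots> = (\<Sum>k. m * ennreal ((1 / 2) ^ k))"
      by (simp add: ennreal_mult nn_integral_multc mean)
    also have "\<dots> = m * (\<Sum>k. ennreal ((1 / 2) ^ k))" by simp
    also have "\<dots> \<noteq> \<infinity>"
    proof -
      have "(\<Sum>k. ennreal ((1 / 2) ^ k)) \<noteq> top"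
        by (rule ennreal_suminf_neq_top) (auto intro: summable_geometric)
      then show ?thesis
        using poisson_pmf_finite_mean[OF rate_pos] unfolding m_def[symmetric]
        by (auto simp: ennreal_mult_eq_top_iff)
    qed
    finally show "(\<integral>\<^sup>+\<omega>. ?S j \<omega> \<partial>\<Omega>) \<noteq> \<infinity>" .
  qed measurable
  then have "AE \<omega> in \<Omega>. \<forall>j. ?S j \<omega> \<noteq> \<infinity>"
    by (simp add: AE_all_countable)
  then show ?thesis
    by eventually_elim (auto simp: good_def less_top)
qed

end

locale poisson_jumps = poisson_blocks rate D
  for rate :: real and D :: "nat \<Rightarrow> 'e measure" +
  fixes F :: "nat \<Rightarrow> 'e \<Rightarrow> 'a::euclidean_space"
  assumes F_measurable: "\<And>k. F k \<in> borel_measurable (D k)"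
    and F_bound: "\<And>k e. norm (F k e) \<le> (1 / 2) ^ k"
begin

lemma jump_by_bound: "norm (jump_by F j k t p) \<le> (1 / 2) ^ k"
  using F_bound by (simp add: jump_by_def)

lemma block_sum_bound: "norm (block_sum (jump_by F j k t) b) \<le> real (fst b) * (1 / 2) ^ k"
  unfolding block_sum_def
  by (rule order_trans[OF norm_sum]) (use sum_bounded_above[of "{..<fst b}", OF jump_by_bound] in auto)

lemma jump_by_measurable[measurable]: "jump_by F j k t \<in> borel_measurable (timed_mark_law (D k))"
proof -
  note F_measurable[of k, measurable]
  have [measurable_cong]: "sets (unif_time) = sets borel" by simp
  show ?thesis unfolding jump_by_def[abs_def] timed_mark_law_def by measurable
qed

lemma block_measurable_sum[measurable]: "(\<lambda>\<omega>. block_sum (jump_by F j k t) (\<omega> (j, k))) \<in> borel_measurable \<Omega>"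
  by (rule measurable_compose[OF block_measurable borel_measurable_block_sum]) measurable

lemma jump_process_measurable[measurable]: "jump_process F t \<in> borel_measurable \<Omega>"
  unfolding jump_process_def[abs_def] by measurable

lemma jump_process_summable:
  assumes "good \<omega>"
  shows "summable (\<lambda>k. block_sum (jump_by F j k t) (\<omega> (j, k)))"
  by (rule summable_comparison_test[OF _ good_imp_summable[OF assms, of j]])
     (use block_sum_bound in auto)

text \<open>A common number of blocks for all times up to \<open>T\<close> allows values at
  different times, or of different processes, to be subtracted term by term.\<close>

lemma jump_process_eq:
  assumes "good \<omega>" "t \<le> real T"
  shows "jump_process F t \<omega> = (\<Sum>j<T. \<Sum>k. block_sum (jump_by F j k t) (\<omega> (j, k)))"
proof -
  have "(\<Sum>j<nat \<lceil>t\<rceil>. \<Sum>k. block_sum (jump_by F j k t) (\<omega> (j, k))) = (\<Sum>j<T. \<Sum>k. block_sum (jump_by F j k t) (\<omega> (j, k)))"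
  proof (rule sum.mono_neutral_left)
    show "{..<nat \<lceil>t\<rceil>} \<subseteq> {..<T}" using assms(2) by (auto simp: nat_less_iff less_ceiling_iff)
    show "\<forall>j\<in>{..<T} - {..<nat \<lceil>t\<rceil>}. (\<Sum>k. block_sum (jump_by F j k t) (\<omega> (j, k))) = 0"
    proof
      fix j assume "j \<in> {..<T} - {..<nat \<lceil>t\<rceil>}"
      then have "t \<le> j" by (simp add: not_less nat_le_iff ceiling_le_iff)
      then have "jump_by F j k t p = 0" for k p by (auto simp: jump_by_def)
      then show "(\<Sum>k. block_sum (jump_by F j k t) (\<omega> (j, k))) = 0" by (simp add: block_sum_def)
    qed
  qed simp
  then show ?thesis using assms by (simp add: jump_process_def)
qed

lemma jump_process_cadlag: "cadlag (\<lambda>t. jump_process F t \<omega>)"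
proof (cases "good \<omega>")
  case False
  then show ?thesis by (auto simp: jump_process_def cadlag_def)
next
  case True
  show ?thesis
  proof (rule cadlag_locally, intro exI conjI ballI)
    fix T :: nat
    let ?y = "\<lambda>t. \<Sum>j<T. \<Sum>k. block_sum (jump_by F j k t) (\<omega> (j, k))"
    have "cadlag (\<lambda>t. jump_by F j k t p)" for j k p
      using cadlag_if[OF cadlag_const[of "F k (snd p)"] cadlag_const[of 0], of "real j + fst p"]
      by (cases "0 < fst p") (auto simp: jump_by_def cadlag_def)
    then show "cadlag ?y"
      unfolding block_sum_def
      by (intro cadlag_sum cadlag_suminf[OF _ _ good_imp_summable[OF True]])
         (use block_sum_bound in \<open>auto simp: block_sum_def\<close>)
    show "jump_process F t \<omega> = ?y t" if "t \<in> {0..<real T}" for t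
      using that by (intro jump_process_eq True) simp
  qed
qed

lemma jump_process_cadlag_process: "cadlag_process \<Omega> (jump_process F)"
  unfolding cadlag_process_def
  using jump_process_cadlag by (auto simp: prob_space_axioms jump_process_def)

end

text \<open>Integers are grid points, so a cell never straddles two unit blocks: it lies wholly in
  block \<open>l div n\<close>.\<close>

lemma grid_cell_in_unit_block:
  fixes n l j :: nat
  assumes n: "n > 0"
  shows "measure (unif_time) {\<tau>. real l / n < real j + \<tau> \<and> real j + \<tau> \<le> real (Suc l) / n} =
    (if j = l div n then 1 / n else 0)"
proof -
  let ?S = "{\<tau>. real l / n < real j + \<tau> \<and> real j + \<tau> \<le> real (Suc l) / n}"
  have "measure (unif_time) ?S = measure lborel ({0<..1} \<inter> ?S)"
    by (subst measure_uniform_measure) auto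
  also have "\<dots> = (if j = l div n then 1 / n else 0)"
  proof (cases "j = l div n")
    case True
    have "j * n \<le> l" "Suc l \<le> Suc j * n"
      using n by (auto simp: True Suc_le_eq dividend_less_div_times)
    then have "real j * n \<le> l" "real (Suc l) \<le> (real j + 1) * n"
      by (metis of_nat_le_iff of_nat_mult) (metis \<open>Suc l \<le> Suc j * n\<close> of_nat_Suc of_nat_le_iff of_nat_mult add.commute)
    then have "real j \<le> real l / n" "real (Suc l) / n \<le> real j + 1"
      using n by (simp_all add: pos_le_divide_eq pos_divide_le_eq del: of_nat_Suc)
    then have "{0<..1} \<inter> ?S = {real l / n - real j <.. real (Suc l) / n - real j}"
      by (auto simp del: of_nat_Suc)
    moreover have "real l / n - real j \<le> real (Suc l) / n - real j"
      using n by (simp add: divide_right_mono)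
    ultimately show ?thesis using True n by (simp add: diff_divide_distrib[symmetric])
  next
    case False
    have "{0<..1} \<inter> ?S = {}"
    proof (rule ccontr)
      assume "{0<..1} \<inter> ?S \<noteq> {}"
      then obtain \<tau> where \<tau>: "0 < \<tau>" "\<tau> \<le> 1" "real l / n < real j + \<tau>" "real j + \<tau> \<le> real (Suc l) / n" by auto
      then have "real l / n < real (Suc j)" "real j < real (Suc l) / n" by simp_all
      then have "real l < real (Suc j * n)" "real (j * n) < real (Suc l)"
        using n by (simp_all add: pos_divide_less_eq pos_less_divide_eq algebra_simps)
      then have "l < Suc j * n" "j * n < Suc l" by (simp_all only: of_nat_less_iff)
      then have "l div n = j" using n by (intro div_nat_eqI) (auto simp: mult.commute)
      with False show False by simp
    qed
    then show ?thesis using False by simp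
  qed
  finally show ?thesis .
qed

text \<open>When the sets are disjoint, at most one summand survives, so even a nonlinear
  \<open>h\<close> fixing 0 passes through the sum. Used for \<open>h x = iexp x - 1\<close> and the
  grid cells.\<close>

lemma at_most_one_sum:
  fixes x :: "nat \<Rightarrow> 'a::real_vector" and h :: "'a \<Rightarrow> 'b::real_vector"
  assumes "\<And>l m. l \<in> L \<Longrightarrow> m \<in> L \<Longrightarrow> s \<in> S l \<Longrightarrow> s \<in> S m \<Longrightarrow> l = m" and "finite L" "h 0 = 0"
  shows "h (\<Sum>l\<in>L. indicator (S l) s *\<^sub>R x l) = (\<Sum>l\<in>L. indicator (S l) s *\<^sub>R h (x l))"
proof (cases "\<exists>l\<in>L. s \<in> S l")
  case True
  then obtain m where m: "m \<in> L" "s \<in> S m" by blast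
  have ind: "indicator (S l) s = (if l = m then 1 else 0 :: real)" if "l \<in> L" for l
    using assms(1)[OF that m(1) _ m(2)] m(2) by (cases "l = m") (auto simp: indicator_def)
  have "(\<Sum>l\<in>L. indicator (S l) s *\<^sub>R x l) = (\<Sum>l\<in>L. if l = m then x l else 0)"
    by (intro sum.cong refl) (simp add: ind)
  moreover have "(\<Sum>l\<in>L. indicator (S l) s *\<^sub>R h (x l)) = (\<Sum>l\<in>L. if l = m then h (x l) else 0)"
    by (intro sum.cong refl) (simp add: ind)
  ultimately show ?thesis using m \<open>finite L\<close> by simp
next
  case False
  then show ?thesis using assms(3) by simp
qed

context poisson_jumps
begin

definition mark_exponent :: "nat \<Rightarrow> 'a \<Rightarrow> complex" where
  "mark_exponent k z = (\<integral>e. (iexp (z \<bullet> F k e) - 1) \<partial>D k)"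

text \<open>A point jumps in at most one cell, so the exponential of the weighted increments splits
  into a sum over cells. In each term time and mark are independent; the time contributes the length
  of the cell inside the block.\<close>

lemma timed_mark_exponent:
  fixes z :: "nat \<Rightarrow> 'a" and j k n K :: nat
  assumes n: "n > 0"
  defines "g \<equiv> \<lambda>p. \<Sum>l<K. z l \<bullet> (jump_by F j k (real (Suc l) / real n) p - jump_by F j k (real l / real n) p)"
  shows "(\<integral>p. (iexp (g p) - 1) \<partial>timed_mark_law (D k)) =
    (\<Sum>l<K. (if j = l div n then 1 / of_nat n else 0) * mark_exponent k (z l))"
proof -
  interpret U: prob_space unif_time by (rule prob_space_uniform_01)
  interpret Dk: prob_space "D k" by (rule prob_D)
  interpret UD: pair_prob_space unif_time "D k" ..
  note F_measurable[of k, measurable]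
  have [measurable_cong]: "sets (unif_time) = sets borel" by simp
  define S where "S = (\<lambda>l. {\<tau>. real l / n < real j + \<tau> \<and> real j + \<tau> \<le> real (Suc l) / n})"
  have S[measurable]: "S l \<in> sets borel" for l unfolding S_def by measurable
  define w where "w = (\<lambda>l e. iexp (z l \<bullet> F k e) - 1)"
  have [measurable]: "w l \<in> borel_measurable (D k)" for l unfolding w_def by measurable
  have wb: "norm (w l e) \<le> 2" for l e
    unfolding w_def by (rule order_trans[OF norm_triangle_ineq4]) simp
  have term_int: "integrable (timed_mark_law (D k)) (\<lambda>p. indicator (S l) (fst p) *\<^sub>R w l (snd p))" for l
    unfolding timed_mark_law_def
  proof (rule UD.integrable_const_bound[where B = 2])
    show "AE p in unif_time \<Otimes>\<^sub>M D k. norm (indicat_real (S l) (fst p) *\<^sub>R w l (snd p)) \<le> 2"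
      using wb by (intro always_eventually allI) (auto split: split_indicator)
  qed measurable
  have term_eq: "(\<integral>p. indicator (S l) (fst p) *\<^sub>R w l (snd p) \<partial>timed_mark_law (D k)) =
      (if j = l div n then 1 / of_nat n else 0) * mark_exponent k (z l)" for l
  proof -
    have "(\<integral>p. indicator (S l) (fst p) *\<^sub>R w l (snd p) \<partial>timed_mark_law (D k)) =
        (\<integral>\<tau>. (\<integral>e. indicator (S l) \<tau> *\<^sub>R w l e \<partial>D k) \<partial>unif_time)"
      using UD.integral_fst'[OF term_int[of l, unfolded timed_mark_law_def]] by (simp add: timed_mark_law_def)
    also have "\<dots> = (\<integral>\<tau>. indicator (S l) \<tau> *\<^sub>R mark_exponent k (z l) \<partial>unif_time)"
      by (simp add: mark_exponent_def w_def)
    also have "\<dots> = measure (unif_time) (S l) *\<^sub>R mark_exponent k (z l)"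
    proof -
      have "integrable (unif_time) (indicat_real (S l))"
        by (rule U.integrable_const_bound[where B = 1]) auto
      then have "(\<integral>\<tau>. indicator (S l) \<tau> *\<^sub>R mark_exponent k (z l) \<partial>unif_time) =
          (\<integral>\<tau>. indicator (S l) \<tau> \<partial>unif_time) *\<^sub>R mark_exponent k (z l)"
        by (intro integral_scaleR_left)
      moreover have "(\<integral>\<tau>. indicator (S l) \<tau> \<partial>unif_time) = measure (unif_time) (S l)"
        by simp
      ultimately show ?thesis by (simp only:)
    qed
    also have "measure (unif_time) (S l) = (if j = l div n then 1 / n else 0)"
      unfolding S_def by (rule grid_cell_in_unit_block[OF n])
    finally show ?thesis by (simp add: scaleR_conv_of_real)
  qed
  \<comment> \<open>For times at or below 0 the jump is suppressed although the point may lie in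
    some \<open>S l\<close>, so the splitting holds only for positive times.\<close>
  have AE_pos: "AE p in timed_mark_law (D k). 0 < fst p"
  proof -
    have "AE \<tau> in unif_time. 0 < \<tau>"
      by (rule AE_uniform_measureI) auto
    then show ?thesis
      unfolding timed_mark_law_def
    proof (intro UD.AE_pair_measure)
      show "{p \<in> space (unif_time \<Otimes>\<^sub>M D k). 0 < fst p} \<in> sets (unif_time \<Otimes>\<^sub>M D k)"
        by measurable
    qed simp
  qed
  have "iexp (g p) - 1 = (\<Sum>l<K. indicator (S l) (fst p) *\<^sub>R w l (snd p))" if "0 < fst p" for p
  proof -
    have jump: "jump_by F j k (real (Suc l) / real n) p - jump_by F j k (real l / real n) p = indicator (S l) (fst p) *\<^sub>R F k (snd p)" for l
    proof -
      have "real l / n \<le> real (Suc l) / n" by (simp add: divide_right_mono)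
      then show ?thesis
        using that by (auto simp: jump_by_def S_def indicator_def simp del: of_nat_Suc)
    qed
    have "iexp (g p) - 1 = iexp (\<Sum>l<K. indicator (S l) (fst p) *\<^sub>R (z l \<bullet> F k (snd p))) - 1"
      unfolding g_def jump by simp
    also have "\<dots> = (\<Sum>l<K. indicator (S l) (fst p) *\<^sub>R w l (snd p))"
      unfolding w_def
    proof (rule at_most_one_sum[where h = "\<lambda>x :: real. iexp x - 1"])
      fix l m assume lm: "fst p \<in> S l" "fst p \<in> S m"
      then have "real l / n < real (Suc m) / n" "real m / n < real (Suc l) / n"
        unfolding S_def mem_Collect_eq by linarith+
      then have "real l < real (Suc m)" "real m < real (Suc l)" using n by (simp_all add: divide_less_cancel del: of_nat_Suc)
      then show "l = m" by simp
    qed auto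
    finally show ?thesis .
  qed
  then have "AE p in timed_mark_law (D k). iexp (g p) - 1 = (\<Sum>l<K. indicator (S l) (fst p) *\<^sub>R w l (snd p))"
    using AE_pos by (auto elim: eventually_mono)
  then have "(\<integral>p. (iexp (g p) - 1) \<partial>timed_mark_law (D k)) = (\<integral>p. (\<Sum>l<K. indicator (S l) (fst p) *\<^sub>R w l (snd p)) \<partial>timed_mark_law (D k))"
  proof (rule integral_cong_AE[rotated 2])
    show "(\<lambda>p. iexp (g p) - 1) \<in> borel_measurable (timed_mark_law (D k))"
      unfolding g_def by measurable
    show "(\<lambda>p. \<Sum>l<K. indicator (S l) (fst p) *\<^sub>R w l (snd p)) \<in> borel_measurable (timed_mark_law (D k))"
      by (intro borel_measurable_sum borel_measurable_integrable term_int)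
  qed
  also have "\<dots> = (\<Sum>l<K. \<integral>p. indicator (S l) (fst p) *\<^sub>R w l (snd p) \<partial>timed_mark_law (D k))"
    by (rule Bochner_Integration.integral_sum) (rule term_int)
  finally show ?thesis by (simp add: term_eq)
qed

text \<open>Cutting the mark classes at \<kappa> leaves finitely many independent blocks whose
  exponents add up. Letting \<kappa> grow uses bounded convergence on the left and the assumed
  series on the right.\<close>

lemma jump_process_grid_exponent:
  assumes \<psi>: "\<And>z. (\<lambda>k. rate * mark_exponent k z) sums \<psi> z"
  shows "grid_exponent \<Omega> (jump_process F) \<psi>"
  unfolding grid_exponent_def
proof (intro allI impI)
  fix n K :: nat and z :: "nat \<Rightarrow> 'a" assume n: "n > 0"
  let ?t = "\<lambda>l. real l / real n"
  let ?c = "\<lambda>j k l. (if j = l div n then 1 / of_nat n else 0) * (rate * mark_exponent k (z l))"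
  define g where "g = (\<lambda>j k p. \<Sum>l<K. z l \<bullet> (jump_by F j k (?t (Suc l)) p - jump_by F j k (?t l) p))"
  have g[measurable]: "g j k \<in> borel_measurable (timed_mark_law (D k))" for j k
    unfolding g_def by measurable
  \<comment> \<open>\<open>K\<close> doubles as the number of time blocks: since
    \<open>n \<ge> 1\<close>, the first \<open>K\<close> cells end no later than time
    \<open>K\<close>.\<close>
  define B where "B = (\<lambda>\<kappa> \<omega>. \<Sum>j<K. \<Sum>k<\<kappa>. block_sum (g j k) (\<omega> (j, k)))"
  have [measurable]: "(\<lambda>\<omega>. block_sum (g j k) (\<omega> (j, k))) \<in> borel_measurable \<Omega>" for j k
    by (rule measurable_compose[OF block_measurable borel_measurable_block_sum]) measurable
  have [measurable]: "B \<kappa> \<in> borel_measurable \<Omega>" for \<kappa> unfolding B_def by measurable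
  let ?R = "\<lambda>\<omega>. \<Sum>l<K. z l \<bullet> (jump_process F (?t (Suc l)) \<omega> - jump_process F (?t l) \<omega>)"
  have lim: "(\<lambda>\<kappa>. B \<kappa> \<omega>) \<longlonglongrightarrow> ?R \<omega>" if \<omega>: "good \<omega>" for \<omega>
  proof -
    let ?b = "\<lambda>j k t. block_sum (jump_by F j k t) (\<omega> (j, k))"
    define A where "A = (\<lambda>\<kappa> t. \<Sum>j<K. \<Sum>k<\<kappa>. ?b j k t)"
    have A: "(\<lambda>\<kappa>. A \<kappa> t) \<longlonglongrightarrow> jump_process F t \<omega>" if "t \<le> real K" for t
      unfolding jump_process_eq[OF \<omega> that] A_def
      by (intro tendsto_sum summable_LIMSEQ jump_process_summable \<omega>)
    have bs: "block_sum (g j k) b = (\<Sum>l<K. z l \<bullet> (block_sum (jump_by F j k (?t (Suc l))) b - block_sum (jump_by F j k (?t l)) b))" for j k b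
      unfolding block_sum_def g_def
      by (subst sum.swap) (simp add: inner_sum_right inner_diff_right sum_subtractf)
    have "B \<kappa> \<omega> = (\<Sum>l<K. z l \<bullet> (A \<kappa> (?t (Suc l)) - A \<kappa> (?t l)))" for \<kappa>
    proof -
      have "B \<kappa> \<omega> = (\<Sum>j<K. \<Sum>l<K. \<Sum>k<\<kappa>. z l \<bullet> (?b j k (?t (Suc l)) - ?b j k (?t l)))"
        unfolding B_def bs by (intro sum.cong refl sum.swap)
      also have "\<dots> = (\<Sum>l<K. \<Sum>j<K. \<Sum>k<\<kappa>. z l \<bullet> (?b j k (?t (Suc l)) - ?b j k (?t l)))"
        by (rule sum.swap)
      finally show ?thesis
        unfolding A_def by (simp add: inner_sum_right inner_diff_right sum_subtractf)
    qed
    moreover have "?t (Suc l) \<le> real K" "?t l \<le> real K" if "l < K" for l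
    proof -
      have "real (Suc l) \<le> real K * 1" using that by (simp add: Suc_le_eq del: of_nat_Suc)
      also have "\<dots> \<le> real K * real n" using n by (intro mult_left_mono) auto
      finally have "real (Suc l) \<le> real K * real n" .
      then show "?t (Suc l) \<le> real K" "?t l \<le> real K"
        using n by (simp_all add: pos_divide_le_eq)
    qed
    ultimately show ?thesis
      using A by (auto intro!: tendsto_sum tendsto_inner tendsto_diff)
  qed
  have cf: "(\<integral>\<omega>. iexp (B \<kappa> \<omega>) \<partial>\<Omega>) = exp (\<Sum>l<K. (\<Sum>k<\<kappa>. rate * mark_exponent k (z l)) / of_nat n)" for \<kappa>
  proof -
    define f where "f = (\<lambda>i b. iexp (block_sum (g (fst i) (snd i)) b))"
    have "(\<integral>\<omega>. iexp (B \<kappa> \<omega>) \<partial>\<Omega>) = (\<integral>\<omega>. (\<Prod>i\<in>{..<K} \<times> {..<\<kappa>}. f i (\<omega> i)) \<partial>PiM UNIV (\<lambda>i. block_law rate (D (snd i))))"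
      unfolding B_def f_def \<Omega>_def
      by (simp add: exp_sum[symmetric] sum_distrib_left sum.cartesian_product split_beta)
    also have "\<dots> = (\<Prod>i\<in>{..<K} \<times> {..<\<kappa>}. \<integral>b. f i b \<partial>block_law rate (D (snd i)))"
    proof (rule integral_PiM_prod[where B = 1])
      show "f i \<in> borel_measurable (block_law rate (D (snd i)))" for i
        using borel_measurable_block_sum[OF g[of "fst i" "snd i"], of rate] unfolding f_def by measurable
    qed (auto simp: f_def prob_space_block_law prob_D)
    also have "\<dots> = (\<Prod>i\<in>{..<K} \<times> {..<\<kappa>}. exp (rate * (\<Sum>l<K. (if fst i = l div n then 1 / of_nat n else 0) * mark_exponent (snd i) (z l))))"
    proof (rule prod.cong[OF refl])
      fix i
      show "(\<integral>b. f i b \<partial>block_law rate (D (snd i))) = exp (rate * (\<Sum>l<K. (if fst i = l div n then 1 / of_nat n else 0) * mark_exponent (snd i) (z l)))"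
        unfolding f_def block_sum_char[OF rate_pos prob_D g]
        unfolding g_def timed_mark_exponent[OF n] ..
    qed
    also have "\<dots> = exp (\<Sum>j<K. \<Sum>k<\<kappa>. rate * (\<Sum>l<K. (if j = l div n then 1 / of_nat n else 0) * mark_exponent k (z l)))"
      unfolding sum.cartesian_product split_beta by (rule exp_sum[symmetric]) simp
    also have "\<dots> = exp (\<Sum>j<K. \<Sum>k<\<kappa>. \<Sum>l<K. ?c j k l)"
      by (simp only: sum_distrib_left mult.left_commute)
    also have "(\<Sum>j<K. \<Sum>k<\<kappa>. \<Sum>l<K. ?c j k l) =
        (\<Sum>l<K. \<Sum>j<K. \<Sum>k<\<kappa>. ?c j k l)"
      by (rule trans[OF sum.cong[OF refl sum.swap] sum.swap])
    also have "\<dots> = (\<Sum>l<K. (\<Sum>k<\<kappa>. rate * mark_exponent k (z l)) / of_nat n)"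
    \<comment> \<open>Cell \<open>l\<close> meets the single block \<open>l div n \<le> l\<close>,
      which is among the first \<open>K\<close>.\<close>
    proof (intro sum.cong refl)
      fix l assume "l \<in> {..<K}"
      then have "l div n < K" using div_le_dividend[of l n] by (simp del: div_le_dividend)
      have "(\<Sum>j<K. \<Sum>k<\<kappa>. ?c j k l) =
          (\<Sum>j<K. if j = l div n then (\<Sum>k<\<kappa>. rate * mark_exponent k (z l)) / of_nat n else 0)"
        by (intro sum.cong refl) (simp add: sum_divide_distrib)
      also have "\<dots> = (\<Sum>k<\<kappa>. rate * mark_exponent k (z l)) / of_nat n"
        using \<open>l div n < K\<close> by simp
      finally show "(\<Sum>j<K. \<Sum>k<\<kappa>. ?c j k l) = (\<Sum>k<\<kappa>. rate * mark_exponent k (z l)) / of_nat n" .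
    qed
    finally show ?thesis .
  qed
  have "(\<lambda>\<kappa>. \<integral>\<omega>. iexp (B \<kappa> \<omega>) \<partial>\<Omega>) \<longlonglongrightarrow> (\<integral>\<omega>. iexp (?R \<omega>) \<partial>\<Omega>)"
  proof (rule integral_dominated_convergence[where w = "\<lambda>_. 1"])
    show "AE \<omega> in \<Omega>. (\<lambda>\<kappa>. iexp (B \<kappa> \<omega>)) \<longlonglongrightarrow> iexp (?R \<omega>)"
      using AE_good by eventually_elim (intro tendsto_exp tendsto_mult tendsto_const tendsto_of_real lim)
  qed auto
  moreover have "(\<lambda>\<kappa>. \<integral>\<omega>. iexp (B \<kappa> \<omega>) \<partial>\<Omega>) \<longlonglongrightarrow> exp (\<Sum>l<K. \<psi> (z l) / of_nat n)"
    unfolding cf using \<psi>[unfolded sums_def] n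
    by (intro tendsto_exp tendsto_sum tendsto_divide tendsto_const) auto
  ultimately have "(\<integral>\<omega>. iexp (?R \<omega>) \<partial>\<Omega>) = exp (\<Sum>l<K. \<psi> (z l) / of_nat n)"
    by (rule LIMSEQ_unique)
  then show "(\<integral>\<omega>. iexp (?R \<omega>) \<partial>\<Omega>) = (\<Prod>l<K. exp (\<psi> (z l) / of_nat n))"
    by (simp add: exp_sum)
qed

end

context poisson_blocks
begin

text \<open>The coupled processes jump at the same times and differ only in jump values, so a bound
  free of \<open>t\<close> controls their distance. Tannery's theorem sends it to 0, dominated by
  twice the series that defines \<open>good\<close>. Off \<open>good\<close> both sides are
  0.\<close>

lemma jump_process_converges_locally_uniformly:
  fixes F :: "nat \<Rightarrow> nat \<Rightarrow> 'e \<Rightarrow> 'a::euclidean_space" and G :: "nat \<Rightarrow> 'e \<Rightarrow> 'a"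
  assumes F: "\<And>n. poisson_jumps rate D (F n)" and G: "poisson_jumps rate D G"
    and lim: "\<And>k e. (\<lambda>n. F n k e) \<longlonglongrightarrow> G k e"
  shows "uniform_limit {0..T} (\<lambda>n t. jump_process (F n) t \<omega>) (\<lambda>t. jump_process G t \<omega>) sequentially"
proof (cases "good \<omega>")
  case False
  then show ?thesis by (simp add: jump_process_def uniform_limit_iff)
next
  case True
  interpret G: poisson_jumps rate D G by (rule G)
  obtain N :: nat where N: "T \<le> real N" using real_arch_simple by blast
  \<comment> \<open>Absolute differences summed over all points of the block, whether or not their
    time has come; this removes the dependence on \<open>t\<close>.\<close>
  define d where "d = (\<lambda>n j k. \<Sum>m<fst (\<omega> (j, k)). norm (F n k (snd (snd (\<omega> (j, k)) m)) - G k (snd (snd (\<omega> (j, k)) m))))"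
  have F_bound: "norm (F n k e) \<le> (1 / 2) ^ k" for n k e
    using poisson_jumps.F_bound[OF F] .
  have diff_bound: "norm (F n k e - G k e) \<le> 2 * (1 / 2) ^ k" for n k e
    using norm_triangle_ineq4[of "F n k e" "G k e"] F_bound[of n k e] G.F_bound[of k e] by linarith
  have d_bound: "d n j k \<le> 2 * (real (fst (\<omega> (j, k))) * (1 / 2) ^ k)" for n j k
    using sum_bounded_above[of "{..<fst (\<omega> (j, k))}", OF diff_bound] by (simp add: d_def mult_ac)
  have d_nonneg: "0 \<le> d n j k" for n j k by (simp add: d_def sum_nonneg)
  have sM: "summable (\<lambda>k. 2 * (real (fst (\<omega> (j, k))) * (1 / 2) ^ k))" for j
    by (intro summable_mult good_imp_summable True)
  have d_summable: "summable (\<lambda>k. d n j k)" for n j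
    by (rule summable_comparison_test[OF _ sM[of j]]) (use d_bound d_nonneg in auto)
  have "(\<lambda>n. \<Sum>k. d n j k) \<longlonglongrightarrow> (\<Sum>k. 0)" for j
  proof -
    have "(\<lambda>n. d n j k) \<longlonglongrightarrow> 0" for k
      unfolding d_def by (intro tendsto_null_sum tendsto_norm_zero LIM_zero lim)
    moreover have "\<forall>\<^sub>F (k, n) in at_top \<times>\<^sub>F sequentially. norm (d n j k) \<le> 2 * (real (fst (\<omega> (j, k))) * (1 / 2) ^ k)"
      using d_bound d_nonneg by (intro always_eventually) auto
    ultimately show ?thesis
      using tannerys_theorem[of "\<lambda>k n. d n j k" "\<lambda>_. 0" sequentially, OF _ _ sM] by auto
  qed
  then have "(\<lambda>n. \<Sum>j<N. \<Sum>k. d n j k) \<longlonglongrightarrow> (\<Sum>j<N. \<Sum>k. 0)"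
    by (intro tendsto_sum)
  then have small: "(\<lambda>n. \<Sum>j<N. \<Sum>k. d n j k) \<longlonglongrightarrow> 0" by simp
  have dist: "dist (jump_process (F n) t \<omega>) (jump_process G t \<omega>) \<le> (\<Sum>j<N. \<Sum>k. d n j k)" if "t \<in> {0..T}" for n t
  proof -
    have t: "t \<le> real N" using that N by auto
    interpret F: poisson_jumps rate D "F n" by (rule F)
    let ?b = "\<lambda>H j k. block_sum (jump_by H j k t) (\<omega> (j, k))"
    have term_le: "norm (?b (F n) j k - ?b G j k) \<le> d n j k" for j k
      unfolding block_sum_def d_def sum_subtractf[symmetric]
      by (rule order_trans[OF norm_sum], rule sum_mono) (simp add: jump_by_def)
    have s: "summable (\<lambda>k. norm (?b (F n) j k - ?b G j k))" for j
      by (rule summable_comparison_test[OF _ d_summable[of n j]]) (use term_le in auto)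
    have "jump_process (F n) t \<omega> - jump_process G t \<omega> = (\<Sum>j<N. \<Sum>k. ?b (F n) j k - ?b G j k)"
      unfolding F.jump_process_eq[OF True t] G.jump_process_eq[OF True t] sum_subtractf[symmetric]
      by (intro sum.cong refl suminf_diff F.jump_process_summable G.jump_process_summable True)
    also have "norm \<dots> \<le> (\<Sum>j<N. norm (\<Sum>k. ?b (F n) j k - ?b G j k))" by (rule norm_sum)
    also have "\<dots> \<le> (\<Sum>j<N. \<Sum>k. d n j k)"
    proof (rule sum_mono)
      fix j
      have "norm (\<Sum>k. ?b (F n) j k - ?b G j k) \<le> (\<Sum>k. norm (?b (F n) j k - ?b G j k))"
        by (rule summable_norm[OF s])
      also have "\<dots> \<le> (\<Sum>k. d n j k)" by (rule suminf_le[OF term_le s d_summable])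
      finally show "norm (\<Sum>k. ?b (F n) j k - ?b G j k) \<le> (\<Sum>k. d n j k)" .
    qed
    finally show ?thesis by (simp add: dist_norm)
  qed
  show ?thesis
  proof (rule uniform_limitI)
    fix e :: real assume "e > 0"
    then have "\<forall>\<^sub>F n in sequentially. (\<Sum>j<N. \<Sum>k. d n j k) < e"
      using small by (auto dest: order_tendstoD)
    then show "\<forall>\<^sub>F n in sequentially. \<forall>t\<in>{0..T}. dist (jump_process (F n) t \<omega>) (jump_process G t \<omega>) < e"
      by (rule eventually_mono) (blast intro: le_less_trans dist)
  qed
qed

lemma jump_process_expectation_converges:
  fixes F :: "nat \<Rightarrow> nat \<Rightarrow> 'e \<Rightarrow> real ^ 'd" and G :: "nat \<Rightarrow> 'e \<Rightarrow> real ^ 'd"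
  assumes F: "\<And>n. poisson_jumps rate D (F n)" and G: "poisson_jumps rate D G"
    and lim: "\<And>k e. (\<lambda>n. F n k e) \<longlonglongrightarrow> G k e"
    and f: "continuous_map skorokhod_topology euclideanreal f"
    and bdd: "\<And>x. x \<in> skorokhod_space \<Longrightarrow> \<bar>f x\<bar> \<le> C"
  shows "(\<lambda>n. path_expectation f \<Omega> (jump_process (F n))) \<longlonglongrightarrow> path_expectation f \<Omega> (jump_process G)"
proof (rule integral_dominated_convergence[where w = "\<lambda>_. C"])
  have cF: "cadlag_process \<Omega> (jump_process (F n))" for n
    using F by (rule poisson_jumps.jump_process_cadlag_process)
  have cG: "cadlag_process \<Omega> (jump_process G)"
    using G by (rule poisson_jumps.jump_process_cadlag_process)
  show "(\<lambda>\<omega>. f (sample_path (jump_process G) \<omega>)) \<in> borel_measurable \<Omega>"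
    by (rule functional_of_process(1)[OF f bdd cG])
  show "(\<lambda>\<omega>. f (sample_path (jump_process (F n)) \<omega>)) \<in> borel_measurable \<Omega>" for n
    by (rule functional_of_process(1)[OF f bdd cF])
  show "AE \<omega> in \<Omega>. (\<lambda>n. f (sample_path (jump_process (F n)) \<omega>)) \<longlonglongrightarrow> f (sample_path (jump_process G) \<omega>)"
  proof (rule AE_I2)
    fix \<omega> assume \<omega>: "\<omega> \<in> space \<Omega>"
    have "skorokhod_converges (\<lambda>n. sample_path (jump_process (F n)) \<omega>) (sample_path (jump_process G) \<omega>)"
    proof (rule locally_uniform_imp_skorokhod_converges)
      fix T :: real
      show "uniform_limit {0..T} (\<lambda>n. sample_path (jump_process (F n)) \<omega>) (sample_path (jump_process G) \<omega>) sequentially"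
        using jump_process_converges_locally_uniformly[OF F G lim, where T = T and \<omega> = \<omega>]
        by (simp add: uniform_limit_iff sample_path_def)
    qed
    then show "(\<lambda>n. f (sample_path (jump_process (F n)) \<omega>)) \<longlonglongrightarrow> f (sample_path (jump_process G) \<omega>)"
      using \<omega> by (intro skorokhod_continuous_imp_sequential[OF f] sample_path_in_skorokhod_space[OF cF]
          sample_path_in_skorokhod_space[OF cG])
  qed
  show "AE \<omega> in \<Omega>. norm (f (sample_path (jump_process (F n)) \<omega>)) \<le> C" for n
    by (rule AE_I2) (auto intro: bdd sample_path_in_skorokhod_space[OF cF])
qed simp

end


section \<open>Thinned Dickman jumps\<close>

lemma norm_iexp_diff_le: "norm (iexp x - iexp y) \<le> \<bar>x - y\<bar>" for x y :: real
proof -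
  have "norm (iexp x - iexp y) = norm (iexp y * (iexp (x - y) - 1))"
    by (simp add: right_diff_distrib exp_add[symmetric] algebra_simps)
  also have "\<dots> = norm (iexp (x - y) - 1)" by (simp add: norm_mult)
  also have "\<dots> \<le> \<bar>x - y\<bar>" using iexp_approx1[of "x - y" 0] by simp
  finally show ?thesis .
qed

locale sphere_marks =
  fixes \<sigma> :: "'a::euclidean_space measure"
  assumes finite_sphere: "finite_sphere_measure \<sigma>" and mass_pos: "0 < measure \<sigma> (space \<sigma>)"
begin

definition \<theta> :: real where "\<theta> = measure \<sigma> (space \<sigma>)"

definition base :: "('a \<times> real \<times> real) measure" where
  "base = \<sigma> \<Otimes>\<^sub>M (lborel \<Otimes>\<^sub>M lborel)"

definition weight :: "'a \<times> real \<times> real \<Rightarrow> real" where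
  "weight = (\<lambda>(s, r, u). indicator {0<..1} r * indicator {0<..<1} u / r)"

text \<open>A mark \<open>(s, r, u)\<close> is a jump \<open>r s\<close> of the Dickman process together with a uniform
  variable \<open>u\<close> that decides whether the jump survives the thinning.\<close>

definition intensity :: "('a \<times> real \<times> real) measure" where
  "intensity = density base (\<lambda>e. ennreal (weight e))"

definition annulus :: "nat \<Rightarrow> ('a \<times> real \<times> real) set" where
  "annulus k = {e \<in> space base. (1 / 2) ^ Suc k < fst (snd e) \<and> fst (snd e) \<le> (1 / 2) ^ k}"

definition mark_law :: "nat \<Rightarrow> ('a \<times> real \<times> real) measure" where
  "mark_law k = uniform_measure intensity (annulus k)"

text \<open>The guards on \<open>s\<close> and \<open>r\<close> bound the jump by the radius at
  every mark, not just almost every one; the bounds in \<open>poisson_jumps\<close> are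
  pointwise.\<close>

definition thinned :: "('a \<Rightarrow> real \<Rightarrow> real) \<Rightarrow> 'a \<times> real \<times> real \<Rightarrow> 'a" where
  "thinned h = (\<lambda>(s, r, u). if norm s = 1 \<and> 0 < r \<and> r \<le> 1 \<and> u < h s r then r *\<^sub>R s else 0)"

abbreviation radius :: "'a \<times> real \<times> real \<Rightarrow> real" where
  "radius e \<equiv> fst (snd e) * indicator {0<..1} (fst (snd e))"

definition thinned_on :: "('a \<Rightarrow> real \<Rightarrow> real) \<Rightarrow> nat \<Rightarrow> 'a \<times> real \<times> real \<Rightarrow> 'a" where
  "thinned_on h k e = (if (1 / 2) ^ Suc k < fst (snd e) \<and> fst (snd e) \<le> (1 / 2) ^ k then thinned h e else 0)"

abbreviation measurable_thinning :: "('a \<Rightarrow> real \<Rightarrow> real) \<Rightarrow> bool" where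
  "measurable_thinning h \<equiv> (\<lambda>(s, r). h s r) \<in> borel_measurable (\<sigma> \<Otimes>\<^sub>M lborel)"

text \<open>The Levy exponent of the process with jumps \<open>thinned h\<close>. The integrand
  vanishes at rejected marks.\<close>

definition jump_exponent :: "('a \<Rightarrow> real \<Rightarrow> real) \<Rightarrow> 'a \<Rightarrow> complex" where
  "jump_exponent h z = (\<integral>e. (iexp (z \<bullet> thinned h e) - 1) \<partial>intensity)"

sublocale S: finite_measure \<sigma>
  using finite_sphere by (simp add: finite_sphere_measure_def)

lemma sigma_finite_plane: "sigma_finite_measure (lborel \<Otimes>\<^sub>M lborel :: (real \<times> real) measure)"
  unfolding lborel_prod by standard

sublocale SL: pair_sigma_finite \<sigma> "lborel \<Otimes>\<^sub>M lborel :: (real \<times> real) measure"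
  by (intro pair_sigma_finite.intro sigma_finite_plane S.sigma_finite_measure_axioms)

lemma \<theta>_pos: "\<theta> > 0" using mass_pos by (simp add: \<theta>_def)

lemma emeasure_sphere: "emeasure \<sigma> (space \<sigma>) = ennreal \<theta>"
  by (simp add: S.emeasure_eq_measure \<theta>_def)

lemma space_\<sigma>: "space \<sigma> = sphere 0 1"
  using finite_sphere sets_eq_imp_space_eq[of \<sigma> "restrict_space borel (sphere 0 1)"]
  by (simp add: finite_sphere_measure_def space_restrict_space)

lemma ident_measurable: "(\<lambda>s. s) \<in> measurable \<sigma> borel"
proof -
  have "(\<lambda>s. s) \<in> measurable (restrict_space borel (sphere 0 1)) borel"
    by (rule measurable_restrict_space1) simp
  then show ?thesis
    using finite_sphere by (simp add: finite_sphere_measure_def cong: measurable_cong_sets)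
qed

lemma coordinates_measurable[measurable]:
  "fst \<in> borel_measurable base" "(\<lambda>e. fst (snd e)) \<in> borel_measurable base" "(\<lambda>e. snd (snd e)) \<in> borel_measurable base"
  unfolding base_def
  by (rule measurable_compose[OF measurable_fst ident_measurable]) measurable

lemma weight_measurable[measurable]: "weight \<in> borel_measurable base"
proof -
  have "weight = (\<lambda>e. indicator {0<..1} (fst (snd e)) * indicator {0<..<1} (snd (snd e)) / fst (snd e))"
    by (auto simp: weight_def fun_eq_iff)
  also have "\<dots> \<in> borel_measurable base" by measurable
  finally show ?thesis .
qed

lemma sets_intensity[measurable_cong, simp]: "sets intensity = sets base"
  by (simp add: intensity_def)

lemma space_intensity[simp]: "space intensity = space base"
  by (simp add: intensity_def)

lemma annulus_measurable[measurable]: "annulus k \<in> sets base"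
  unfolding annulus_def by measurable

lemma nn_integral_intensity:
  assumes [measurable]: "f \<in> borel_measurable base"
  shows "(\<integral>\<^sup>+e. f e \<partial>intensity) = (\<integral>\<^sup>+s. \<integral>\<^sup>+r. \<integral>\<^sup>+u. f (s, r, u) * ennreal (weight (s, r, u)) \<partial>lborel \<partial>lborel \<partial>\<sigma>)"
proof -
  have [measurable]: "(\<lambda>e. ennreal (weight e) * f e) \<in> borel_measurable (\<sigma> \<Otimes>\<^sub>M (lborel \<Otimes>\<^sub>M lborel))"
    using assms weight_measurable by (auto simp: base_def)
  have "(\<integral>\<^sup>+e. f e \<partial>intensity) = (\<integral>\<^sup>+e. ennreal (weight e) * f e \<partial>base)"
    unfolding intensity_def by (rule nn_integral_density) measurable
  also have "\<dots> = (\<integral>\<^sup>+s. \<integral>\<^sup>+x. ennreal (weight (s, x)) * f (s, x) \<partial>(lborel \<Otimes>\<^sub>M lborel) \<partial>\<sigma>)"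
    unfolding base_def by (rule sigma_finite_measure.nn_integral_fst[OF sigma_finite_plane, symmetric]) measurable
  also have "\<dots> = (\<integral>\<^sup>+s. \<integral>\<^sup>+r. \<integral>\<^sup>+u. ennreal (weight (s, r, u)) * f (s, r, u) \<partial>lborel \<partial>lborel \<partial>\<sigma>)"
    by (intro nn_integral_cong lborel.nn_integral_fst[symmetric]) measurable
  finally show ?thesis by (simp add: mult.commute)
qed

lemma nn_integral_intensity_radial:
  assumes [measurable]: "f \<in> borel_measurable borel"
  shows "(\<integral>\<^sup>+e. f (fst (snd e)) \<partial>intensity) = ennreal \<theta> * (\<integral>\<^sup>+r. f r * indicator {0<..1} r * ennreal (1 / r) \<partial>lborel)"
proof -
  have "(\<integral>\<^sup>+u. f r * ennreal (weight (s, r, u)) \<partial>lborel) = f r * indicator {0<..1} r * ennreal (1 / r)" for s r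
  proof -
    have "ennreal (weight (s, r, u)) = indicator {0<..1} r * ennreal (1 / r) * indicator {0<..<1} u" for u :: real
      by (auto simp: weight_def indicator_def)
    then have "(\<integral>\<^sup>+u. f r * ennreal (weight (s, r, u)) \<partial>lborel) = (\<integral>\<^sup>+u. (f r * indicator {0<..1} r * ennreal (1 / r)) * indicator {0<..<1::real} u \<partial>lborel)"
      by (simp add: mult.assoc)
    then show ?thesis by (simp add: nn_integral_cmult_indicator)
  qed
  then show ?thesis
    by (subst nn_integral_intensity) (simp_all add: emeasure_sphere mult.commute)
qed

text \<open>The measure \<open>dr / r\<close> is invariant under scaling, so each shell
  \<open>(b / 2, b]\<close> has radial mass \<open>ln 2\<close>. This is why a single Poisson rate
  serves all shells.\<close>

lemma emeasure_annulus: "emeasure intensity (annulus k) = ennreal (\<theta> * ln 2)"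
proof -
  define a b where "a = ((1 / 2) ^ Suc k :: real)" and "b = ((1 / 2) ^ k :: real)"
  have ab: "0 < a" "a \<le> b" "b \<le> 1" "b = 2 * a" by (auto simp: a_def b_def power_le_one)
  have "emeasure intensity (annulus k) = (\<integral>\<^sup>+e. indicator {a<..b} (fst (snd e)) \<partial>intensity)"
    by (subst nn_integral_indicator[symmetric], simp)
       (intro nn_integral_cong, auto simp: annulus_def a_def b_def indicator_def)
  also have "\<dots> = ennreal \<theta> * (\<integral>\<^sup>+r. indicator {a<..b} r * indicator {0<..1} r * ennreal (1 / r) \<partial>lborel)"
    by (rule nn_integral_intensity_radial) simp
  also have "(\<integral>\<^sup>+r. indicator {a<..b} r * indicator {0<..1} r * ennreal (1 / r) \<partial>lborel) = (\<integral>\<^sup>+r. ennreal (1 / r) * indicator {a..b} r \<partial>lborel)"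
  proof (rule nn_integral_cong_AE)
    show "AE r in lborel. indicator {a<..b} r * indicator {0<..1} r * ennreal (1 / r) = ennreal (1 / r) * indicator {a..b} r"
      using AE_lborel_singleton[of a] by eventually_elim (use ab in \<open>auto simp: indicator_def\<close>)
  qed
  also have "\<dots> = ennreal (ln b - ln a)"
    by (rule nn_integral_FTC_Icc) (use ab in \<open>auto intro!: DERIV_ln_divide\<close>)
  also have "ln b - ln a = ln 2" using ab by (simp add: ln_mult)
  finally show ?thesis using \<theta>_pos by (simp add: ennreal_mult)
qed

lemma prob_space_mark_law: "prob_space (mark_law k)"
  unfolding mark_law_def using \<theta>_pos
  by (intro prob_space_uniform_measure) (auto simp: emeasure_annulus ennreal_eq_0_iff not_le)

definition rate :: real where "rate = \<theta> * ln 2"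

lemma rate_pos: "rate > 0" using \<theta>_pos by (simp add: rate_def)

sublocale poisson_blocks rate mark_law
  by (rule poisson_blocks.intro[OF rate_pos prob_space_mark_law])

section \<open>Thinned jumps and their Levy exponents\<close>

lemma thinned_measurable:
  assumes "measurable_thinning h"
  shows "thinned h \<in> borel_measurable base"
proof -
  have "(\<lambda>e. (fst e, fst (snd e))) \<in> measurable base (\<sigma> \<Otimes>\<^sub>M lborel)"
    unfolding base_def by (intro measurable_Pair measurable_fst measurable_compose[OF measurable_snd])
  from measurable_compose[OF this assms]
  have [measurable]: "(\<lambda>e. h (fst e) (fst (snd e))) \<in> borel_measurable base"
    by (simp only: prod.case)
  have "thinned h = (\<lambda>e. if norm (fst e) = 1 \<and> 0 < fst (snd e) \<and> fst (snd e) \<le> 1 \<and> snd (snd e) < h (fst e) (fst (snd e)) then fst (snd e) *\<^sub>R fst e else 0)"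
    by (auto simp: thinned_def fun_eq_iff)
  also have "\<dots> \<in> borel_measurable base" by measurable
  finally show ?thesis .
qed

lemma norm_thinned_le: "norm (thinned h e) \<le> radius e"
  by (cases e) (auto simp: thinned_def indicator_def)

lemma thinned_on_poisson_jumps:
  assumes h: "measurable_thinning h"
  shows "poisson_jumps rate mark_law (thinned_on h)"
proof
  fix k
  note thinned_measurable[OF h, measurable]
  have "thinned_on h k \<in> borel_measurable base"
    unfolding thinned_on_def[abs_def] by measurable
  then show "thinned_on h k \<in> borel_measurable (mark_law k)"
    by (simp add: mark_law_def cong: measurable_cong_sets)
  show "norm (thinned_on h k e) \<le> (1 / 2) ^ k" for e
  proof (cases "(1 / 2) ^ Suc k < fst (snd e) \<and> fst (snd e) \<le> (1 / 2) ^ k")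
    case True
    have "0 \<le> (1 / 2 :: real) ^ Suc k" by simp
    then have "0 \<le> fst (snd e)" using True by linarith
    then have "radius e \<le> fst (snd e)"
      by (intro mult_left_le) (auto simp: indicator_def)
    then have "norm (thinned h e) \<le> (1 / 2) ^ k"
      using norm_thinned_le[of h e] True by linarith
    then show ?thesis by (simp add: thinned_on_def)
  next
    case False
    then have "thinned_on h k e = 0" unfolding thinned_on_def by (rule if_not_P)
    then show ?thesis by simp
  qed
qed

text \<open>The jump size cancels the density \<open>1 / r\<close>. Although the intensity has
  infinite mass, the integrand of the Levy exponent is therefore integrable, being bounded by a
  multiple of the radius.\<close>

lemma nn_integral_norm_intensity: "(\<integral>\<^sup>+e. ennreal (radius e) \<partial>intensity) = ennreal \<theta>"
proof -
  have "(\<integral>\<^sup>+e. ennreal (radius e) \<partial>intensity) =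
      ennreal \<theta> * (\<integral>\<^sup>+r. ennreal (r * indicator {0<..1} r) * indicator {0<..1} r * ennreal (1 / r) \<partial>lborel)"
    by (rule nn_integral_intensity_radial) measurable
  also have "(\<lambda>r. ennreal (r * indicator {0<..1} r) * indicator {0<..1} r * ennreal (1 / r)) = indicator {0<..1}"
    by (auto simp: fun_eq_iff indicator_def ennreal_mult'[symmetric])
  finally show ?thesis by simp
qed

lemma integrable_radius: "integrable intensity (\<lambda>e. radius e)"
proof (rule integrableI_nonneg)
  show "AE e in intensity. 0 \<le> radius e"
    by (intro always_eventually allI) (simp add: indicator_def)
  show "(\<integral>\<^sup>+e. ennreal (radius e) \<partial>intensity) < \<infinity>"
    unfolding nn_integral_norm_intensity by simp
qed measurable

lemma exponent_integrand:
  assumes h: "measurable_thinning h"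
  shows "norm (iexp (z \<bullet> thinned h e) - 1) \<le> norm z * radius e"
    and "(\<lambda>e. iexp (z \<bullet> thinned h e) - 1) \<in> borel_measurable intensity"
    and "integrable intensity (\<lambda>e. iexp (z \<bullet> thinned h e) - 1)"
proof -
  note thinned_measurable[OF h, measurable]
  show b: "norm (iexp (z \<bullet> thinned h e) - 1) \<le> norm z * radius e" for e
  proof -
    have "norm (iexp (z \<bullet> thinned h e) - 1) \<le> \<bar>z \<bullet> thinned h e\<bar>"
      using norm_iexp_diff_le[of "z \<bullet> thinned h e" 0] by simp
    also have "\<dots> \<le> norm z * norm (thinned h e)" by (rule Cauchy_Schwarz_ineq2)
    also have "\<dots> \<le> norm z * radius e"
      by (intro mult_left_mono norm_thinned_le) simp
    finally show ?thesis .
  qed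
  show m: "(\<lambda>e. iexp (z \<bullet> thinned h e) - 1) \<in> borel_measurable intensity" by measurable
  show "integrable intensity (\<lambda>e. iexp (z \<bullet> thinned h e) - 1)"
  proof (rule Bochner_Integration.integrable_bound[OF _ m])
    show "integrable intensity (\<lambda>e. norm z * radius e)"
      by (intro integrable_mult_right integrable_radius)
    show "AE e in intensity. norm (iexp (z \<bullet> thinned h e) - 1) \<le> norm (norm z * radius e)"
      by (intro always_eventually allI order_trans[OF b]) simp
  qed
qed

lemma jump_exponent_0[simp]: "jump_exponent h 0 = 0"
  by (simp add: jump_exponent_def)

lemma jump_exponent_continuous:
  assumes h: "measurable_thinning h"
  shows "continuous_on UNIV (jump_exponent h)"
  unfolding continuous_on_sequentially
proof (intro allI ballI impI)
  fix x :: "nat \<Rightarrow> 'a" and a assume "(\<forall>n. x n \<in> UNIV) \<and> x \<longlonglongrightarrow> a"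
  then have x: "x \<longlonglongrightarrow> a" by simp
  then obtain B where B: "\<And>n. norm (x n) \<le> B"
    using convergent_imp_Bseq[of x] by (auto simp: convergent_def Bseq_def)
  show "(jump_exponent h \<circ> x) \<longlonglongrightarrow> jump_exponent h a"
    unfolding o_def jump_exponent_def
  proof (rule integral_dominated_convergence[where w = "\<lambda>e. B * radius e"])
    show "AE e in intensity. (\<lambda>n. iexp (x n \<bullet> thinned h e) - 1) \<longlonglongrightarrow> iexp (a \<bullet> thinned h e) - 1"
      by (intro always_eventually allI tendsto_intros x)
    show "AE e in intensity. norm (iexp (x n \<bullet> thinned h e) - 1) \<le> B * radius e" for n
      by (intro always_eventually allI order_trans[OF exponent_integrand(1)[OF h]] mult_right_mono B)
         (auto simp: indicator_def)
    show "integrable intensity (\<lambda>e. B * radius e)"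
      by (intro integrable_mult_right integrable_radius)
  qed (use exponent_integrand[OF h] in auto)
qed

text \<open>The factor \<open>rate\<close> undoes the normalisation of \<open>mark_law k\<close>, so
  each term is the integral over one shell; the shells exhaust all radii in \<open>(0, 1]\<close>,
  and outside them nothing jumps.\<close>

lemma mark_exponent_sums:
  assumes h: "measurable_thinning h"
  shows "(\<lambda>k. rate * poisson_jumps.mark_exponent mark_law (thinned_on h) k z) sums jump_exponent h z"
proof -
  interpret J: poisson_jumps rate mark_law "thinned_on h" by (rule thinned_on_poisson_jumps[OF h])
  note thinned_measurable[OF h, measurable]
  let ?g = "\<lambda>e. iexp (z \<bullet> thinned h e) - 1"
  have int: "integrable intensity (\<lambda>e. indicator A e *\<^sub>R ?g e)" if "A \<in> sets base" for A
    using that by (intro integrable_mult_indicator exponent_integrand[OF h]) simp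
  have term_eq: "rate * J.mark_exponent k z = (\<integral>e. indicator (annulus k) e *\<^sub>R ?g e \<partial>intensity)" for k
  proof -
    have dens: "mark_law k = density intensity (\<lambda>e. ennreal (indicator (annulus k) e / rate))"
      unfolding mark_law_def uniform_measure_def emeasure_annulus rate_def[symmetric]
      using rate_pos by (intro arg_cong[where f = "density intensity"] ext)
        (auto simp: indicator_def divide_ennreal simp flip: ennreal_1)
    have on: "indicator (annulus k) e *\<^sub>R (iexp (z \<bullet> thinned_on h k e) - 1) = indicator (annulus k) e *\<^sub>R ?g e" for e
      by (auto simp: indicator_def annulus_def thinned_on_def)
    have "J.mark_exponent k z = (\<integral>e. (indicator (annulus k) e / rate) *\<^sub>R (iexp (z \<bullet> thinned_on h k e) - 1) \<partial>intensity)"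
      unfolding J.mark_exponent_def dens
    proof (rule integral_density)
      show "(\<lambda>e. iexp (z \<bullet> thinned_on h k e) - 1) \<in> borel_measurable intensity"
        unfolding thinned_on_def by measurable
    qed (use rate_pos in auto)
    also have "\<dots> = (\<integral>e. (1 / rate) *\<^sub>R (indicator (annulus k) e *\<^sub>R ?g e) \<partial>intensity)"
      unfolding on[symmetric] by simp
    also have "\<dots> = (1 / rate) *\<^sub>R (\<integral>e. indicator (annulus k) e *\<^sub>R ?g e \<partial>intensity)"
      by (rule integral_scaleR_right)
    finally show ?thesis using rate_pos by (simp add: scaleR_conv_of_real)
  qed
  define T where "T = (\<lambda>n. {e \<in> space base. (1 / 2) ^ n < fst (snd e) \<and> fst (snd e) \<le> 1})"
  have T[measurable]: "T n \<in> sets base" for n unfolding T_def by measurable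
  have part: "(\<Sum>k<n. indicator (annulus k) e *\<^sub>R ?g e) = indicator (T n) e *\<^sub>R ?g e" for n e
  proof (induction n)
    case (Suc n)
    have "(1 / 2) ^ n \<le> (1::real)" by (simp add: power_le_one)
    moreover have "(1 / 2) ^ Suc n < r" if "(1 / 2) ^ n < r" for r :: real
    proof -
      have "(1 / 2) ^ Suc n \<le> ((1 / 2) ^ n :: real)" by simp
      then show ?thesis using that by linarith
    qed
    ultimately have "indicator (T (Suc n)) e = indicator (T n) e + (indicator (annulus n) e :: real)"
      by (auto simp: T_def annulus_def indicator_def simp del: power_Suc)
    then show ?case using Suc by (simp add: scaleR_add_left)
  qed (simp add: T_def)
  have "(\<lambda>n. \<integral>e. indicator (T n) e *\<^sub>R ?g e \<partial>intensity) \<longlonglongrightarrow> (\<integral>e. ?g e \<partial>intensity)"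
  proof (rule integral_dominated_convergence[where w = "\<lambda>e. norm (?g e)"])
    show "AE e in intensity. (\<lambda>n. indicator (T n) e *\<^sub>R ?g e) \<longlonglongrightarrow> ?g e"
    proof (rule AE_I2)
      fix e assume e: "e \<in> space intensity"
      show "(\<lambda>n. indicator (T n) e *\<^sub>R ?g e) \<longlonglongrightarrow> ?g e"
      proof (cases "0 < fst (snd e) \<and> fst (snd e) \<le> 1")
        case True
        have "(\<lambda>n. (1 / 2) ^ n :: real) \<longlonglongrightarrow> 0" by (rule LIMSEQ_power_zero) simp
        then have "\<forall>\<^sub>F n in sequentially. (1 / 2) ^ n < fst (snd e)"
          using True by (auto dest: order_tendstoD)
        then have "\<forall>\<^sub>F n in sequentially. indicator (T n) e *\<^sub>R ?g e = ?g e"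
          by (rule eventually_mono) (use True e in \<open>auto simp: T_def\<close>)
        then show ?thesis by (rule tendsto_eventually)
      next
        case False
        then have "thinned h e = 0" by (cases e) (auto simp: thinned_def)
        then show ?thesis by simp
      qed
    qed
  qed (use exponent_integrand[OF h] in \<open>auto simp: indicator_def\<close>)
  then show ?thesis
    unfolding sums_def term_eq jump_exponent_def
    by (simp add: part int flip: Bochner_Integration.integral_sum)
qed

lemma thinned_process_grid_exponent:
  assumes h: "measurable_thinning h"
  shows "grid_exponent \<Omega> (jump_process (thinned_on h)) (jump_exponent h)"
  by (rule poisson_jumps.jump_process_grid_exponent[OF thinned_on_poisson_jumps[OF h] mark_exponent_sums[OF h]])

end


section \<open>The characteristic function of the Dickman law\<close>

text \<open>Substituting \<open>w = u t\<^sup>\<theta>\<close> turns the fixed-point equation into \<open>t\<^sup>\<theta> g(t) = M(t\<^sup>\<theta>)\<close> with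
  \<open>M(x) = \<integral>\<^sub>0\<^sup>x m(w powr (1 / \<theta>)) dw\<close>, \<open>m = g h\<close>; differentiating gives \<open>g' = \<theta> g (h - 1) / t\<close>.\<close>

lemma dickman_equation_derivative:
  fixes g h :: "real \<Rightarrow> complex" and \<theta> t :: real
  assumes \<theta>: "\<theta> > 0" and g: "continuous_on UNIV g" and h: "continuous_on UNIV h"
    and fixpoint: "\<And>t. t > 0 \<Longrightarrow> g t = (LBINT u=0..1. g (u powr (1 / \<theta>) * t) * h (u powr (1 / \<theta>) * t))"
    and t: "t > 0"
  shows "(g has_vector_derivative (\<theta> * g t * (h t - 1) / t)) (at t)"
proof -
  define m where "m = (\<lambda>w. g (w powr (1 / \<theta>)) * h (w powr (1 / \<theta>)))"
  define M where "M = (\<lambda>x :: real. LBINT w=0..x. m w)"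
  have m: "continuous_on {0..} m"
    unfolding m_def using \<theta>
    by (intro continuous_on_mult continuous_on_compose2[OF g] continuous_on_compose2[OF h]
        continuous_on_powr' continuous_intros) auto
  have root: "(s powr \<theta>) powr (1 / \<theta>) = s" if "s > 0" for s
    using that \<theta> by (simp add: powr_powr)
  have eq: "g s = s powr (- \<theta>) *\<^sub>R M (s powr \<theta>)" if s: "s > 0" for s
  proof -
    have "(LBINT u=0..1. (s powr \<theta>) *\<^sub>R m (u * s powr \<theta>)) = (LBINT y=0 * s powr \<theta>..1 * s powr \<theta>. m y)"
    proof (rule interval_integral_substitution_finite[of 0 1, unfolded zero_ereal_def[symmetric] one_ereal_def[symmetric]])
      show "continuous_on ((\<lambda>u. u * s powr \<theta>) ` {0..1}) m"
        by (rule continuous_on_subset[OF m]) auto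
    qed (auto intro!: derivative_eq_intros)
    then have "(s powr \<theta>) *\<^sub>R (LBINT u=0..1. m (u * s powr \<theta>)) = M (s powr \<theta>)"
      by (simp add: M_def zero_ereal_def scaleR_conv_of_real)
    moreover have "(LBINT u=0..1. m (u * s powr \<theta>)) = g s"
    proof -
      have "(LBINT u=0..1. m (u * s powr \<theta>)) = (LBINT u=0..1. g (u powr (1 / \<theta>) * s) * h (u powr (1 / \<theta>) * s))"
        by (rule interval_integral_cong) (simp add: m_def powr_mult root s min_def max_def einterval_iff)
      then show ?thesis using fixpoint[OF s] by simp
    qed
    ultimately have "s powr \<theta> *\<^sub>R g s = M (s powr \<theta>)" by simp
    then have "s powr (- \<theta>) *\<^sub>R M (s powr \<theta>) = s powr (- \<theta>) *\<^sub>R s powr \<theta> *\<^sub>R g s" by simp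
    also have "\<dots> = g s" using s by (simp add: powr_minus)
    finally show ?thesis ..
  qed
  have "(M has_vector_derivative m (t powr \<theta>)) (at (t powr \<theta>))"
  proof -
    \<comment> \<open>The right end \<open>t powr \<theta> + 1\<close> makes the point interior, so
      that the derivative within the interval is a full derivative.\<close>
    have "(M has_vector_derivative m (t powr \<theta>)) (at (t powr \<theta>) within {0..t powr \<theta> + 1})"
      unfolding M_def zero_ereal_def
      by (rule interval_integral_FTC2) (auto intro: continuous_on_subset[OF m])
    moreover have "at (t powr \<theta>) within {0..t powr \<theta> + 1} = at (t powr \<theta>)"
      using t by (intro at_within_interior) auto
    ultimately show ?thesis by simp
  qed
  then have "((M \<circ> (\<lambda>t. t powr \<theta>)) has_vector_derivative (\<theta> * t powr (\<theta> - 1)) *\<^sub>R m (t powr \<theta>)) (at t)"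
    using t by (intro vector_diff_chain_at)
      (auto simp flip: has_real_derivative_iff_has_vector_derivative intro!: has_real_derivative_powr)
  then have "((\<lambda>t. t powr (- \<theta>) *\<^sub>R M (t powr \<theta>)) has_vector_derivative
      (t powr (- \<theta>) *\<^sub>R (\<theta> * t powr (\<theta> - 1)) *\<^sub>R m (t powr \<theta>) + (- \<theta> * t powr (- \<theta> - 1)) *\<^sub>R M (t powr \<theta>))) (at t)"
    unfolding o_def using t
    by (intro has_vector_derivative_scaleR has_real_derivative_powr)
  also have "t powr (- \<theta>) *\<^sub>R (\<theta> * t powr (\<theta> - 1)) *\<^sub>R m (t powr \<theta>) + (- \<theta> * t powr (- \<theta> - 1)) *\<^sub>R M (t powr \<theta>)
      = \<theta> * g t * (h t - 1) / t"
  proof -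
    have "t powr (- \<theta>) * (\<theta> * t powr (\<theta> - 1)) = \<theta> / t"
      using t by (simp add: powr_minus powr_diff divide_simps)
    then have "t powr (- \<theta>) *\<^sub>R (\<theta> * t powr (\<theta> - 1)) *\<^sub>R m (t powr \<theta>) = (\<theta> / t) *\<^sub>R (g t * h t)"
      by (simp add: m_def root t)
    moreover have "(- \<theta> * t powr (- \<theta> - 1)) *\<^sub>R M (t powr \<theta>) = - (\<theta> / t) *\<^sub>R g t"
      using t by (subst eq[OF t]) (simp add: powr_diff)
    ultimately show ?thesis by (simp add: scaleR_conv_of_real algebra_simps diff_divide_distrib)
  qed
  finally show ?thesis
    by (rule has_vector_derivative_transform_within_open[where S = "{0<..}"]) (use t eq in auto)
qed

text \<open>The integrating factor \<open>exp (- K t)\<close> makes the product constant. The start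
  is a positive \<delta> because the coefficient is continuous only on the open half-line.\<close>

lemma linear_ode_solution:
  fixes g k :: "real \<Rightarrow> complex"
  assumes \<delta>: "0 < \<delta>" "\<delta> \<le> 1" and k: "continuous_on {0<..} k"
    and g: "\<And>t. t > 0 \<Longrightarrow> (g has_vector_derivative (g t * k t)) (at t)"
  shows "g 1 = g \<delta> * exp (LBINT v=\<delta>..1. k v)"
proof -
  define K where "K = (\<lambda>t :: real. LBINT v=\<delta>..t. k v)"
  have dK: "(K has_vector_derivative k t) (at t within {\<delta>..1})" if "t \<in> {\<delta>..1}" for t
    unfolding K_def using that \<delta>
    by (intro interval_integral_FTC2 continuous_on_subset[OF k]) auto
  have "((\<lambda>t. g t * exp (- K t)) has_vector_derivative 0) (at t within {\<delta>..1})" if t: "t \<in> {\<delta>..1}" for t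
  proof -
    have "((\<lambda>t. - K t) has_vector_derivative - k t) (at t within {\<delta>..1})"
      by (intro has_vector_derivative_minus dK t)
    then have "((exp \<circ> (\<lambda>t. - K t)) has_vector_derivative (- k t) * exp (- K t)) (at t within {\<delta>..1})"
      by (rule field_vector_diff_chain_within) (rule DERIV_subset[OF DERIV_exp subset_UNIV])
    then have "((\<lambda>t. g t * exp (- K t)) has_vector_derivative (g t * ((- k t) * exp (- K t)) + (g t * k t) * exp (- K t))) (at t within {\<delta>..1})"
      unfolding o_def using t \<delta>
      by (intro has_vector_derivative_mult has_vector_derivative_at_within[OF g]) auto
    then show ?thesis by (simp add: algebra_simps)
  qed
  then obtain c where c: "\<And>t. t \<in> {\<delta>..1} \<Longrightarrow> g t * exp (- K t) = c"
    by (rule has_vector_derivative_zero_constant[rotated]) auto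
  have "g 1 * exp (- K 1) = g \<delta> * exp (- K \<delta>)" using c[of 1] c[of \<delta>] \<delta> by simp
  moreover have "K \<delta> = 0" by (simp add: K_def)
  ultimately have "g 1 * exp (- K 1) = g \<delta>" by simp
  then have "g 1 = g \<delta> * exp (K 1)" by (auto simp: exp_minus field_simps)
  then show ?thesis by (simp add: K_def one_ereal_def)
qed

context sphere_marks
begin

definition radial_exponent :: "'a \<Rightarrow> real \<Rightarrow> complex" where
  "radial_exponent z v = (\<integral>s. (iexp (v * (z \<bullet> s)) - 1) \<partial>\<sigma>)"

lemma inner_measurable[measurable]: "(\<lambda>s. z \<bullet> s) \<in> borel_measurable \<sigma>"
  by (rule measurable_compose[OF ident_measurable]) measurable

lemma integrable_iexp_sphere: "integrable \<sigma> (\<lambda>s. iexp (v * (z \<bullet> s)))"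
  by (rule S.integrable_const_bound[where B = 1]) auto

lemma radial_exponent_alt: "radial_exponent z v = (\<integral>s. iexp (v * (z \<bullet> s)) \<partial>\<sigma>) - \<theta>"
  unfolding radial_exponent_def
    Bochner_Integration.integral_diff[OF integrable_iexp_sphere S.integrable_const]
  by (simp add: \<theta>_def scaleR_conv_of_real)

text \<open>Linear decay at 0 offsets the factor \<open>1 / v\<close> and supplies the dominating
  function when the lower integration limit goes to 0.\<close>

lemma norm_radial_exponent_le: "norm (radial_exponent z v) \<le> \<theta> * norm z * \<bar>v\<bar>"
proof -
  have "norm (radial_exponent z v) \<le> (\<integral>s. norm (iexp (v * (z \<bullet> s)) - 1) \<partial>\<sigma>)"
    unfolding radial_exponent_def by (rule integral_norm_bound)
  also have "\<dots> \<le> (\<integral>s. \<bar>v\<bar> * norm z \<partial>\<sigma>)"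
  proof (rule integral_mono)
    show "norm (iexp (v * (z \<bullet> s)) - 1) \<le> \<bar>v\<bar> * norm z" if "s \<in> space \<sigma>" for s
    proof -
      have "norm (iexp (v * (z \<bullet> s)) - 1) \<le> \<bar>v * (z \<bullet> s)\<bar>"
        using norm_iexp_diff_le[of "v * (z \<bullet> s)" 0] by simp
      also have "\<dots> \<le> \<bar>v\<bar> * (norm z * norm s)"
        by (simp add: abs_mult mult_left_mono Cauchy_Schwarz_ineq2)
      finally show ?thesis using that by (simp add: space_\<sigma>)
    qed
    show "integrable \<sigma> (\<lambda>s. norm (iexp (v * (z \<bullet> s)) - 1))"
      by (intro integrable_norm Bochner_Integration.integrable_diff integrable_iexp_sphere S.integrable_const)
  qed simp
  finally show ?thesis by (simp add: \<theta>_def mult_ac)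
qed

lemma continuous_on_sphere_char: "continuous_on UNIV (\<lambda>v. \<integral>s. iexp (v * (z \<bullet> s)) \<partial>\<sigma>)"
  unfolding continuous_on_sequentially
proof (intro allI ballI impI)
  fix x :: "nat \<Rightarrow> real" and a assume "(\<forall>n. x n \<in> UNIV) \<and> x \<longlonglongrightarrow> a"
  then have x: "x \<longlonglongrightarrow> a" by simp
  show "((\<lambda>v. \<integral>s. iexp (v * (z \<bullet> s)) \<partial>\<sigma>) \<circ> x) \<longlonglongrightarrow> (\<integral>s. iexp (a * (z \<bullet> s)) \<partial>\<sigma>)"
    unfolding o_def
    by (rule integral_dominated_convergence[where w = "\<lambda>_. 1"]) (auto intro!: tendsto_intros x)
qed

lemma continuous_on_radial_exponent: "continuous_on UNIV (radial_exponent z)"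
  unfolding radial_exponent_alt[abs_def] by (intro continuous_intros continuous_on_sphere_char)

text \<open>With threshold 1 the variable \<open>u\<close> always accepts and integrates out to 1.
  Fubini then moves the sphere inside, leaving the radial integral that the differential equation
  produces.\<close>

lemma jump_exponent_unthinned:
  "jump_exponent (\<lambda>_ _. 1) z = (\<integral>r. indicator {0<..1} r *\<^sub>R (radial_exponent z r / r) \<partial>lborel)"
proof -
  have h: "(\<lambda>(s, r). 1 :: real) \<in> borel_measurable (\<sigma> \<Otimes>\<^sub>M lborel)" by simp
  let ?g = "\<lambda>e. iexp (z \<bullet> thinned (\<lambda>_ _. 1) e) - 1"
  define W where "W = (\<lambda>(r :: real, u :: real). indicator {0<..1} r * indicator {0<..<1} u / r)"
  have [measurable]: "W \<in> borel_measurable (lborel \<Otimes>\<^sub>M lborel)"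
  proof -
    have "W = (\<lambda>x. indicator {0<..1} (fst x) * indicator {0<..<1} (snd x) / fst x)"
      by (auto simp: W_def)
    also have "\<dots> \<in> borel_measurable (lborel \<Otimes>\<^sub>M lborel)" by measurable
    finally show ?thesis .
  qed
  have g_meas: "?g \<in> borel_measurable base"
    using exponent_integrand(2)[OF h, of z] by (simp cong: measurable_cong_sets)
  have nonneg: "AE e in base. 0 \<le> weight e"
    by (intro always_eventually allI) (auto simp: weight_def indicator_def)
  let ?P = "\<sigma> \<Otimes>\<^sub>M (lborel \<Otimes>\<^sub>M lborel :: (real \<times> real) measure)"
  let ?f = "\<lambda>s x. W x *\<^sub>R (iexp (fst x * (z \<bullet> s)) - 1)"
  \<comment> \<open>True on the sphere only, since \<open>thinned\<close> rejects marks with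
    \<open>norm s \<noteq> 1\<close>.\<close>
  have integrand: "weight (s, x) *\<^sub>R ?g (s, x) = ?f s x" if "s \<in> space \<sigma>" for s x
    using that by (cases x) (auto simp: weight_def W_def thinned_def space_\<sigma> indicator_def)
  have "integrable base (\<lambda>e. weight e *\<^sub>R ?g e)"
    using exponent_integrand(3)[OF h, of z] unfolding intensity_def
    by (subst (asm) integrable_density) (use g_meas nonneg in auto)
  also have "integrable base (\<lambda>e. weight e *\<^sub>R ?g e) \<longleftrightarrow> integrable ?P (\<lambda>(s, x). ?f s x)"
    unfolding base_def
    by (rule Bochner_Integration.integrable_cong) (auto simp: space_pair_measure integrand simp del: split_paired_All)
  finally have int: "integrable ?P (\<lambda>(s, x). ?f s x)" .
  have "jump_exponent (\<lambda>_ _. 1) z = (\<integral>e. weight e *\<^sub>R ?g e \<partial>base)"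
    unfolding jump_exponent_def intensity_def
    by (rule integral_density) (use g_meas nonneg in auto)
  also have "\<dots> = (\<integral>(s, x). ?f s x \<partial>?P)"
    unfolding base_def
    by (rule Bochner_Integration.integral_cong) (auto simp: space_pair_measure integrand)
  also have "\<dots> = (\<integral>x. (\<integral>s. ?f s x \<partial>\<sigma>) \<partial>(lborel \<Otimes>\<^sub>M lborel))"
    by (rule SL.integral_snd[OF int, symmetric])
  also have "\<dots> = (\<integral>x. W x *\<^sub>R radial_exponent z (fst x) \<partial>(lborel \<Otimes>\<^sub>M lborel))"
    by (simp add: radial_exponent_def)
  also have "\<dots> = (\<integral>r. (\<integral>u. W (r, u) *\<^sub>R radial_exponent z r \<partial>lborel) \<partial>lborel)"
  proof -
    have "integrable (lborel \<Otimes>\<^sub>M lborel) (\<lambda>x. W x *\<^sub>R radial_exponent z (fst x))"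
      using SL.integrable_snd[OF int] by (simp add: radial_exponent_def)
    from lborel_pair.integral_fst'[OF this] show ?thesis by simp
  qed
  also have "\<dots> = (\<integral>r. indicator {0<..1} r *\<^sub>R (radial_exponent z r / r) \<partial>lborel)"
  proof (rule Bochner_Integration.integral_cong[OF refl])
    fix r :: real
    have "(\<integral>u. W (r, u) *\<^sub>R radial_exponent z r \<partial>lborel) = (\<integral>u. indicator {0<..<1::real} u *\<^sub>R (indicator {0<..1} r *\<^sub>R (radial_exponent z r / r)) \<partial>lborel)"
      by (rule Bochner_Integration.integral_cong) (auto simp: W_def indicator_def scaleR_conv_of_real)
    also have "\<dots> = indicator {0<..1} r *\<^sub>R (radial_exponent z r / r)"
      by (subst integral_scaleR_left) (auto simp: integrable_indicator_iff)
    finally show "(\<integral>u. W (r, u) *\<^sub>R radial_exponent z r \<partial>lborel) = indicator {0<..1} r *\<^sub>R (radial_exponent z r / r)" .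
  qed
  finally show ?thesis .
qed

lemma radial_exponent_integral_limit:
  "(\<lambda>n. LBINT v=1 / Suc n..1. radial_exponent z v / v) \<longlonglongrightarrow> jump_exponent (\<lambda>_ _. 1) z"
proof -
  have [measurable]: "radial_exponent z \<in> borel_measurable borel"
    by (rule borel_measurable_continuous_onI[OF continuous_on_radial_exponent])
  have eq: "(LBINT v=1 / Suc n..1. radial_exponent z v / v) = (\<integral>v. indicator {1 / Suc n..1} v *\<^sub>R (radial_exponent z v / v) \<partial>lborel)" for n
    using interval_integral_Icc[of "1 / Suc n" 1] by (simp add: set_lebesgue_integral_def one_ereal_def)
  show ?thesis
    unfolding eq jump_exponent_unthinned
  proof (rule integral_dominated_convergence[where w = "\<lambda>v. indicator {0..1} v * (\<theta> * norm z)"])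
    show "AE v in lborel. (\<lambda>n. indicator {1 / real (Suc n)..1} v *\<^sub>R (radial_exponent z v / v)) \<longlonglongrightarrow> indicator {0<..1} v *\<^sub>R (radial_exponent z v / v)"
    proof (rule AE_I2)
      fix v :: real
      show "(\<lambda>n. indicator {1 / real (Suc n)..1} v *\<^sub>R (radial_exponent z v / v)) \<longlonglongrightarrow> indicator {0<..1} v *\<^sub>R (radial_exponent z v / v)"
      proof (cases "v > 0")
        case True
        have "(\<lambda>n. 1 / real (Suc n)) \<longlonglongrightarrow> 0"
          using LIMSEQ_inverse_real_of_nat by (simp add: inverse_eq_divide)
        then have "\<forall>\<^sub>F n in sequentially. 1 / real (Suc n) < v"
          using True by (auto dest: order_tendstoD)
        then show ?thesis
          by (intro tendsto_eventually, elim eventually_mono) (use True in \<open>auto simp: indicator_def\<close>)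
      next
        case False
        have "0 < 1 / real (Suc n)" for n by simp
        then have "v \<notin> {1 / real (Suc n)..1}" for n
          using False by (metis atLeastAtMost_iff dual_order.strict_trans1)
        then show ?thesis using False by (simp del: of_nat_Suc)
      qed
    qed
    show "AE v in lborel. norm (indicator {1 / real (Suc n)..1} v *\<^sub>R (radial_exponent z v / v)) \<le> indicator {0..1} v * (\<theta> * norm z)" for n
    proof (rule AE_I2)
      fix v :: real
      show "norm (indicator {1 / real (Suc n)..1} v *\<^sub>R (radial_exponent z v / v)) \<le> indicator {0..1} v * (\<theta> * norm z)"
      proof (cases "v \<in> {1 / real (Suc n)..1}")
        case True
        have "0 < 1 / real (Suc n)" by simp
        also have "\<dots> \<le> v" using True by simp
        finally have v: "0 < v" .
        have "norm (radial_exponent z v / v) \<le> \<theta> * norm z"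
          using norm_radial_exponent_le[of z v] v by (simp add: norm_divide pos_divide_le_eq)
        then show ?thesis using True v by (simp del: of_nat_Suc)
      next
        case False
        then show ?thesis using \<theta>_pos by (simp del: of_nat_Suc)
      qed
    qed
    show "integrable lborel (\<lambda>v :: real. indicator {0..1} v * (\<theta> * norm z))"
      by (intro integrable_mult_left) (auto simp: integrable_indicator_iff)
  qed measurable
qed

end

lemma integral_uniform_01:
  fixes f :: "real \<Rightarrow> complex"
  assumes [measurable]: "f \<in> borel_measurable borel"
  shows "(\<integral>u. f u \<partial>uniform_measure lborel {0<..<1}) = (LBINT u=0..1. f u)"
proof -
  have "uniform_measure lborel {0<..<1::real} = density lborel (\<lambda>u. ennreal (indicator {0<..<1} u))"
    unfolding uniform_measure_def by (intro arg_cong[where f = "density lborel"]) (auto simp: indicator_def)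
  then have "(\<integral>u. f u \<partial>uniform_measure lborel {0<..<1}) = (\<integral>u. indicator {0<..<1} u *\<^sub>R f u \<partial>lborel)"
    by (simp add: integral_density)
  then show ?thesis
    using interval_integral_Ioo[of 0 1 f] by (simp add: set_lebesgue_integral_def)
qed

context sphere_marks
begin

text \<open>The characteristic function of \<xi> along the ray through \<open>z\<close>.\<close>

definition sphere_char :: "'a \<Rightarrow> real \<Rightarrow> complex" where
  "sphere_char z v = (\<integral>s. iexp (v * (z \<bullet> s)) \<partial>\<sigma>) / \<theta>"

text \<open>Given \<open>u\<close>, the variables \<open>X\<close> and \<xi> are independent, so the
  characteristic function of the scaled sum is a product; the remaining average over
  \<open>u\<close> is the integral.\<close>

lemma MD_law_fixpoint:
  assumes MD: "MD_law \<sigma> \<mu>"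
  defines "\<phi> \<equiv> \<lambda>y. \<integral>x. iexp (y \<bullet> x) \<partial>\<mu>"
  shows "prob_space \<mu>" "continuous_on UNIV \<phi>"
    and "\<phi> y = (LBINT u=0..1. \<phi> (u powr (1 / \<theta>) *\<^sub>R y) * sphere_char y (u powr (1 / \<theta>)))"
proof -
  define N where "N = scale_measure (ennreal (1 / \<theta>)) \<sigma>"
  define U where "U = uniform_measure lborel {0<..<1::real}"
  let ?P = "\<mu> \<Otimes>\<^sub>M (N \<Otimes>\<^sub>M U)" and ?g = "\<lambda>u. \<phi> (u powr (1 / \<theta>) *\<^sub>R y) * sphere_char y (u powr (1 / \<theta>))"
  define T where "T = (\<lambda>p. snd (snd p) powr (1 / \<theta>) *\<^sub>R (fst p + fst (snd p)) :: 'a)"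
  have "T = (\<lambda>(x, s, u). u powr (1 / \<theta>) *\<^sub>R (x + s))" by (auto simp: T_def)
  then have \<mu>: "prob_space \<mu>" "sets \<mu> = sets borel" "\<mu> = distr ?P borel T"
    using MD \<theta>_pos by (simp_all add: MD_law_def Let_def \<theta>_def[symmetric] N_def U_def)
  show "prob_space \<mu>" by (rule \<mu>)
  have x_meas[measurable]: "(\<lambda>x. x) \<in> borel_measurable \<mu>" using \<mu>(2) by (simp cong: measurable_cong_sets)
  show \<phi>_cont: "continuous_on UNIV \<phi>"
    unfolding \<phi>_def by (rule continuous_on_char_fun[OF \<mu>(1) x_meas])
  have \<phi>_meas[measurable]: "\<phi> \<in> borel_measurable borel"
    by (rule borel_measurable_continuous_onI[OF \<phi>_cont])
  have N_dens: "N = density \<sigma> (\<lambda>_. ennreal (1 / \<theta>))"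
    unfolding N_def by (rule measure_eqI) (auto simp: emeasure_density_const)
  interpret \<mu>: prob_space \<mu> by (rule \<mu>)
  interpret N: prob_space N
    using \<theta>_pos by (intro prob_spaceI)
      (simp add: N_def space_scale_measure emeasure_sphere ennreal_mult'[symmetric])
  interpret U: prob_space U unfolding U_def by (intro prob_space_uniform_measure) auto
  interpret NU: pair_prob_space N U ..
  interpret P: prob_space "N \<Otimes>\<^sub>M U" by (rule NU.prob_space_axioms)
  interpret \<mu>NU: pair_prob_space \<mu> "N \<Otimes>\<^sub>M U" ..
  have N_ident: "(\<lambda>s. s) \<in> borel_measurable N"
    using ident_measurable by (simp add: N_def cong: measurable_cong_sets)
  have U_ident: "(\<lambda>u. u) \<in> borel_measurable U" by (simp add: U_def cong: measurable_cong_sets)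
  have c1: "fst \<in> borel_measurable (N \<Otimes>\<^sub>M U)" "snd \<in> borel_measurable (N \<Otimes>\<^sub>M U)"
    using measurable_compose[OF measurable_fst N_ident] measurable_compose[OF measurable_snd U_ident] by auto
  have c2: "fst \<in> borel_measurable ?P"
    "(\<lambda>p. fst (snd p)) \<in> borel_measurable ?P"
    "(\<lambda>p. snd (snd p)) \<in> borel_measurable ?P"
    using measurable_compose[OF measurable_fst x_meas] measurable_compose[OF measurable_snd c1(1)]
      measurable_compose[OF measurable_snd c1(2)] by auto
  note c1[measurable] c2[measurable]
  have T[measurable]: "T \<in> borel_measurable ?P"
    unfolding T_def by measurable
  have N_char: "(\<integral>s. iexp (c * (y \<bullet> s)) \<partial>N) = sphere_char y c" for c
  proof -
    have "(\<integral>s. iexp (c * (y \<bullet> s)) \<partial>N) = (\<integral>s. (1 / \<theta>) *\<^sub>R iexp (c * (y \<bullet> s)) \<partial>\<sigma>)"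
      unfolding N_dens using \<theta>_pos by (intro integral_density) auto
    also have "\<dots> = (1 / \<theta>) *\<^sub>R (\<integral>s. iexp (c * (y \<bullet> s)) \<partial>\<sigma>)"
      by (rule integral_scaleR_right)
    finally show ?thesis by (simp add: sphere_char_def scaleR_conv_of_real)
  qed
  have T_split: "iexp (y \<bullet> T (x, q)) = iexp ((snd q powr (1 / \<theta>) *\<^sub>R y) \<bullet> x) * iexp (snd q powr (1 / \<theta>) * (y \<bullet> fst q))" for x q
    by (simp add: T_def inner_add_right exp_add[symmetric] algebra_simps)
  have "\<phi> y = (\<integral>x. iexp (y \<bullet> x) \<partial>distr ?P borel T)"
    unfolding \<phi>_def by (rule arg_cong[OF \<mu>(3)])
  also have "\<dots> = (\<integral>p. iexp (y \<bullet> T p) \<partial>?P)"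
    by (rule integral_distr) measurable
  also have "\<dots> = (\<integral>q. (\<integral>x. iexp (y \<bullet> T (x, q)) \<partial>\<mu>) \<partial>(N \<Otimes>\<^sub>M U))"
  proof -
    have "integrable ?P (\<lambda>(x, q). iexp (y \<bullet> T (x, q)))"
      by (rule \<mu>NU.integrable_const_bound[where B = 1]) (auto simp: split_beta)
    from \<mu>NU.integral_snd[OF this] show ?thesis by (simp add: case_prod_unfold)
  qed
  also have "\<dots> = (\<integral>q. \<phi> (snd q powr (1 / \<theta>) *\<^sub>R y) * iexp (snd q powr (1 / \<theta>) * (y \<bullet> fst q)) \<partial>(N \<Otimes>\<^sub>M U))"
    unfolding T_split \<phi>_def by (simp only: integral_mult_left_zero)
  also have "\<dots> = (\<integral>u. (\<integral>s. \<phi> (u powr (1 / \<theta>) *\<^sub>R y) * iexp (u powr (1 / \<theta>) * (y \<bullet> s)) \<partial>N) \<partial>U)"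
  proof -
    have "norm (\<phi> v) \<le> 1" for v
    proof -
      have "norm (\<phi> v) \<le> (\<integral>x. norm (iexp (v \<bullet> x)) \<partial>\<mu>)" unfolding \<phi>_def by (rule integral_norm_bound)
      then show ?thesis by (simp add: \<mu>.prob_space)
    qed
    then have "integrable (N \<Otimes>\<^sub>M U) (\<lambda>(s, u). \<phi> (u powr (1 / \<theta>) *\<^sub>R y) * iexp (u powr (1 / \<theta>) * (y \<bullet> s)))"
      by (intro NU.integrable_const_bound[where B = 1]) (auto simp: split_beta norm_mult)
    from NU.integral_snd[OF this] show ?thesis by (simp add: case_prod_unfold)
  qed
  also have "\<dots> = (\<integral>u. ?g u \<partial>U)"
    by (simp only: integral_mult_right_zero N_char)
  also have "\<dots> = (LBINT u=0..1. ?g u)"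
  proof -
    have "continuous_on UNIV (sphere_char y)"
      unfolding sphere_char_def[abs_def] using \<theta>_pos by (intro continuous_intros continuous_on_sphere_char) auto
    then have [measurable]: "sphere_char y \<in> borel_measurable borel" by (rule borel_measurable_continuous_onI)
    show ?thesis unfolding U_def by (rule integral_uniform_01) measurable
  qed
  finally show "\<phi> y = (LBINT u=0..1. ?g u)" .
qed

text \<open>Along the ray the function \<open>g\<close> solves a linear equation on
  \<open>(0, 1]\<close>. Starting at \<open>1 / Suc n\<close>, the initial value tends to
  \<open>g 0 = 1\<close> by continuity, while the exponent tends to the full radial
  integral.\<close>

lemma MD_law_char:
  assumes MD: "MD_law \<sigma> \<mu>"
  shows "(\<integral>x. iexp (z \<bullet> x) \<partial>\<mu>) = exp (jump_exponent (\<lambda>_ _. 1) z)"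
proof -
  define \<phi> where "\<phi> = (\<lambda>y. \<integral>x. iexp (y \<bullet> x) \<partial>\<mu>)"
  interpret \<mu>: prob_space \<mu> by (rule MD_law_fixpoint(1)[OF MD])
  have \<phi>_cont: "continuous_on UNIV \<phi>"
    unfolding \<phi>_def by (rule MD_law_fixpoint(2)[OF MD])
  have fixpoint: "\<phi> y = (LBINT u=0..1. \<phi> (u powr (1 / \<theta>) *\<^sub>R y) * sphere_char y (u powr (1 / \<theta>)))" for y
    unfolding \<phi>_def by (rule MD_law_fixpoint(3)[OF MD])
  define g where "g = (\<lambda>t. \<phi> (t *\<^sub>R z))"
  have g_cont: "continuous_on UNIV g"
    unfolding g_def by (intro continuous_on_compose2[OF \<phi>_cont] continuous_intros) auto
  have h_cont: "continuous_on UNIV (sphere_char z)"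
    unfolding sphere_char_def[abs_def] using \<theta>_pos by (intro continuous_intros continuous_on_sphere_char) auto
  have "g t = (LBINT u=0..1. g (u powr (1 / \<theta>) * t) * sphere_char z (u powr (1 / \<theta>) * t))" for t
    unfolding g_def using fixpoint[of "t *\<^sub>R z"] by (simp add: sphere_char_def mult_ac)
  then have deriv: "(g has_vector_derivative (\<theta> * g t * (sphere_char z t - 1) / t)) (at t)" if "t > 0" for t
    by (intro dickman_equation_derivative \<theta>_pos g_cont h_cont that)
  have k: "\<theta> * g t * (sphere_char z t - 1) / t = g t * (radial_exponent z t / t)" for t
  proof -
    have "radial_exponent z t = \<theta> * (sphere_char z t - 1)"
      using \<theta>_pos by (simp add: sphere_char_def radial_exponent_alt right_diff_distrib)
    then show ?thesis by simp
  qed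
  have rad: "continuous_on {0<..} (\<lambda>t. radial_exponent z t / t)"
    by (intro continuous_intros continuous_on_subset[OF continuous_on_radial_exponent]) auto
  have sol: "g 1 = g (1 / Suc n) * exp (LBINT v=1 / Suc n..1. radial_exponent z v / v)" for n
    using linear_ode_solution[of "1 / real (Suc n)" "\<lambda>t. radial_exponent z t / t" g, OF _ _ rad deriv[unfolded k]]
    by simp
  have "(\<lambda>n. 1 / real (Suc n)) \<longlonglongrightarrow> 0"
    using LIMSEQ_inverse_real_of_nat by (simp add: inverse_eq_divide)
  then have "(\<lambda>n. g (1 / real (Suc n))) \<longlonglongrightarrow> g 0"
    using continuous_on_tendsto_compose[OF g_cont] by simp
  then have "(\<lambda>n. g (1 / real (Suc n)) * exp (LBINT v=1 / Suc n..1. radial_exponent z v / v)) \<longlonglongrightarrow> g 0 * exp (jump_exponent (\<lambda>_ _. 1) z)"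
    by (intro tendsto_mult tendsto_exp radial_exponent_integral_limit)
  then have "(\<lambda>n :: nat. g 1) \<longlonglongrightarrow> g 0 * exp (jump_exponent (\<lambda>_ _. 1) z)" by (simp only: sol[symmetric])
  moreover have "g 0 = 1" by (simp add: g_def \<phi>_def \<mu>.prob_space)
  ultimately have "g 1 = exp (jump_exponent (\<lambda>_ _. 1) z)" by (simp add: LIMSEQ_const_iff)
  then show ?thesis by (simp add: g_def \<phi>_def)
qed

end


section \<open>The small jumps of a GMGD\<close>

text \<open>The sign of the first derivative makes \<open>f\<close> nonincreasing, so its values
  stay below the limit at 0. With \<open>c = 1\<close> this turns \<open>q\<close> into an
  acceptance probability.\<close>

lemma completely_monotone_le_limit_at_0:
  assumes cm: "completely_monotone f" and lim: "(f \<longlongrightarrow> c) (at_right 0)" and r: "r > 0"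
  shows "f r \<le> c"
proof -
  have d: "f field_differentiable at x" "deriv f x \<le> 0" if "x > 0" for x
    using cm[unfolded completely_monotone_def, rule_format, OF that, of 0]
      cm[unfolded completely_monotone_def, rule_format, OF that, of 1] by auto
  have "f r \<le> f x" if x: "0 < x" "x < r" for x
  proof (rule DERIV_nonpos_imp_nonincreasing[of x r f])
    show "x \<le> r" using x by simp
    fix y assume "x \<le> y" "y \<le> r"
    then have "y > 0" using x by simp
    then show "\<exists>D. DERIV f y :> D \<and> D \<le> 0"
      using d[of y] DERIV_deriv_iff_field_differentiable by blast
  qed
  then have "\<forall>\<^sub>F x in at_right 0. f r \<le> f x"
    using r by (auto simp: eventually_at_right_field)
  then show ?thesis by (intro tendsto_lowerbound[OF lim]) auto
qed

context sphere_marks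
begin

text \<open>Away from the origin \<nu> is the image of the intensity under \<open>thinned h\<close>.
  Rejected marks all go to 0, possibly with infinite mass, but the integrand of the exponent
  vanishes there.\<close>

lemma jump_exponent_pushforward:
  assumes h: "measurable_thinning h"
    and h01: "\<And>s r. s \<in> space \<sigma> \<Longrightarrow> 0 < r \<Longrightarrow> 0 \<le> h s r \<and> h s r \<le> 1"
    and sets: "sets \<nu> = sets borel"
    and \<nu>: "\<And>B. B \<in> sets borel \<Longrightarrow> emeasure \<nu> B =
      (\<integral>\<^sup>+s. \<integral>\<^sup>+r. indicator {0<..1} r * indicator B (r *\<^sub>R s) * ennreal (h s r / r) \<partial>lborel \<partial>\<sigma>)"
  shows "(\<integral>x. (iexp (z \<bullet> x) - 1) \<partial>\<nu>) = jump_exponent h z"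
proof -
  let ?k = "\<lambda>B s r. indicator {0<..1} r * indicator B (r *\<^sub>R s) * ennreal (h s r / r)"
    and ?w = "\<lambda>B s r u. indicator (B - {0}) (thinned h (s, r, u)) * ennreal (weight (s, r, u))"
  note thinned_measurable[OF h, measurable]
  define L where "L = distr intensity borel (thinned h)"
  \<comment> \<open>Integrating out the uniform variable replaces the test \<open>u < h s r\<close>
    by its probability \<open>h s r\<close>, which is where the bounds 0 and 1 enter.\<close>
  have inner: "(\<integral>\<^sup>+u. ?w B s r u \<partial>lborel) =
      ?k B s r" if s: "s \<in> space \<sigma>" for s r and B :: "'a set"
  proof (cases "0 < r \<and> r \<le> 1 \<and> r *\<^sub>R s \<in> B")
    case True
    have s1: "norm s = 1" "s \<noteq> 0" using s by (auto simp: space_\<sigma>)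
    have "(\<integral>\<^sup>+u. ?w B s r u \<partial>lborel) =
        (\<integral>\<^sup>+u. ennreal (1 / r) * indicator {0<..<h s r} u \<partial>lborel)"
      using True s1 h01[OF s, of r]
      by (intro nn_integral_cong) (auto simp: thinned_def weight_def indicator_def)
    also have "\<dots> = ennreal (1 / r) * ennreal (h s r)"
      using True h01[OF s, of r] by (simp add: nn_integral_cmult_indicator)
    also have "\<dots> = ennreal (h s r / r)"
      using True h01[OF s, of r] by (simp flip: ennreal_mult)
    finally show ?thesis using True by simp
  next
    case False
    then have "?w B s r u = 0" for u
      by (auto simp: thinned_def weight_def indicator_def)
    then have "(\<integral>\<^sup>+u. ?w B s r u \<partial>lborel) = (\<integral>\<^sup>+u. 0 \<partial>(lborel :: real measure))"
      by (intro nn_integral_cong)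
    then show ?thesis using False by (auto simp: indicator_def)
  qed
  have "\<nu> = density L (\<lambda>x. ennreal (indicator (- {0}) x))"
  proof (rule measure_eqI)
    show "sets \<nu> = sets (density L (\<lambda>x. ennreal (indicator (- {0}) x)))" by (simp add: sets L_def)
    fix B assume "B \<in> sets \<nu>"
    then have B[measurable]: "B \<in> sets borel" by (simp add: sets)
    have "emeasure (density L (\<lambda>x. ennreal (indicator (- {0}) x))) B = (\<integral>\<^sup>+x. ennreal (indicator (- {0}) x) * indicator B x \<partial>L)"
      by (rule emeasure_density) (auto simp: L_def)
    also have "\<dots> = (\<integral>\<^sup>+e. ennreal (indicator (- {0}) (thinned h e)) * indicator B (thinned h e) \<partial>intensity)"
      unfolding L_def by (rule nn_integral_distr) measurable
    also have "\<dots> = (\<integral>\<^sup>+e. indicator (B - {0}) (thinned h e) \<partial>intensity)"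
      by (intro nn_integral_cong) (auto simp: indicator_def)
    also have "\<dots> = (\<integral>\<^sup>+s. \<integral>\<^sup>+r. \<integral>\<^sup>+u. ?w B s r u \<partial>lborel \<partial>lborel \<partial>\<sigma>)"
      by (rule nn_integral_intensity) measurable
    also have "\<dots> = emeasure \<nu> B"
      unfolding \<nu>[OF B] by (intro nn_integral_cong inner)
    finally show "emeasure \<nu> B = emeasure (density L (\<lambda>x. ennreal (indicator (- {0}) x))) B" ..
  qed
  then have "(\<integral>x. (iexp (z \<bullet> x) - 1) \<partial>\<nu>) = (\<integral>x. indicator (- {0}) x *\<^sub>R (iexp (z \<bullet> x) - 1) \<partial>L)"
    by (simp add: integral_density L_def)
  also have "\<dots> = (\<integral>x. (iexp (z \<bullet> x) - 1) \<partial>L)"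
    by (intro Bochner_Integration.integral_cong refl) (simp add: indicator_def)
  also have "\<dots> = jump_exponent h z"
    unfolding L_def jump_exponent_def by (rule integral_distr) measurable
  finally show ?thesis .
qed

text \<open>Measurability of \<open>q\<close> is given only over the open half-line times the
  sphere, so the composite is treated on positive radii and extended by 0.\<close>

lemma scaled_tempering_measurable:
  fixes q :: "real \<Rightarrow> 'a \<Rightarrow> real"
  assumes q: "(\<lambda>(r, s). q r s) \<in> borel_measurable (restrict_space borel ({0<..} \<times> sphere 0 1))"
    and \<epsilon>: "\<epsilon> > 0"
  shows "(\<lambda>(s, r). if 0 < r then q ((\<epsilon> * r) powr p) s else 0) \<in> borel_measurable (\<sigma> \<Otimes>\<^sub>M lborel)"
proof -
  let ?M = "\<sigma> \<Otimes>\<^sub>M (lborel :: real measure)"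
  define W where "W = (UNIV \<times> {0<..} :: ('a \<times> real) set)"
  have c: "fst \<in> borel_measurable ?M" "snd \<in> borel_measurable ?M"
    using measurable_compose[OF measurable_fst ident_measurable] by auto
  note c[measurable]
  have "W \<inter> space ?M = {x \<in> space ?M. 0 < snd x}" by (auto simp: W_def)
  also have "\<dots> \<in> sets ?M" by measurable
  finally have W: "W \<inter> space ?M \<in> sets ?M" .
  have "(\<lambda>x. ((\<epsilon> * snd x) powr p, fst x)) \<in> measurable (restrict_space ?M W) (restrict_space borel ({0<..} \<times> sphere 0 1))"
  proof (rule measurable_restrict_space2)
    show "(\<lambda>x. ((\<epsilon> * snd x) powr p, fst x)) \<in> space (restrict_space ?M W) \<rightarrow> {0<..} \<times> sphere 0 1"
      using \<epsilon> by (auto simp: space_restrict_space space_pair_measure W_def space_\<sigma>)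
    show "(\<lambda>x. ((\<epsilon> * snd x) powr p, fst x)) \<in> borel_measurable (restrict_space ?M W)"
      by (rule measurable_restrict_space1) measurable
  qed
  from measurable_compose[OF this q]
  have "(\<lambda>x. q ((\<epsilon> * snd x) powr p) (fst x)) \<in> borel_measurable (restrict_space ?M W)" by (simp only: prod.case)
  then have "(\<lambda>x. indicator W x *\<^sub>R q ((\<epsilon> * snd x) powr p) (fst x)) \<in> borel_measurable ?M"
    by (simp only: borel_measurable_restrict_space_iff[OF W])
  also have "(\<lambda>x. indicator W x *\<^sub>R q ((\<epsilon> * snd x) powr p) (fst x)) = (\<lambda>(s, r). if 0 < r then q ((\<epsilon> * r) powr p) s else 0)"
    by (auto simp: W_def fun_eq_iff)
  finally show ?thesis .
qed

end

text \<open>Dividing jumps by \<epsilon> leaves \<open>dr / r\<close> invariant, turns the cutoff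
  \<open>norm x \<le> \<epsilon>\<close> into \<open>r \<le> 1\<close>, and moves \<epsilon> into
  the argument of \<open>q\<close>. The image measure is then of the thinned form.\<close>

lemma small_jumps_exponent_scaled:
  fixes \<sigma> \<nu> :: "'a::euclidean_space measure" and q :: "real \<Rightarrow> 'a \<Rightarrow> real"
  assumes "sphere_marks \<sigma>" and \<epsilon>: "\<epsilon> > 0"
    and q: "(\<lambda>(r, s). q r s) \<in> borel_measurable (restrict_space borel ({0<..} \<times> sphere 0 1))"
    and q01: "\<And>s r. s \<in> sphere 0 1 \<Longrightarrow> 0 < r \<Longrightarrow> 0 \<le> q r s \<and> q r s \<le> 1"
    and sets: "sets \<nu> = sets borel"
    and \<nu>: "\<And>B. B \<in> sets borel \<Longrightarrow> emeasure \<nu> B =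
             (\<integral>\<^sup>+s. (\<integral>\<^sup>+r\<in>{0<..}. (indicator B (r *\<^sub>R s) * ennreal (q (r powr p) s / r)) \<partial>lborel) \<partial>\<sigma>)"
  shows "(\<integral>x. (iexp (z \<bullet> x) - 1) \<partial>small_jumps \<nu> \<epsilon>) =
    sphere_marks.jump_exponent \<sigma> (\<lambda>s r. if 0 < r then q ((\<epsilon> * r) powr p) s else 0) (\<epsilon> *\<^sub>R z)"
proof -
  interpret sphere_marks \<sigma> by fact
  define h where "h = (\<lambda>s r. if 0 < r then q ((\<epsilon> * r) powr p) s else 0)"
  have h: "measurable_thinning h"
    unfolding h_def by (rule scaled_tempering_measurable[OF q \<epsilon>])
  have m: "(\<lambda>x. (1 / \<epsilon>) *\<^sub>R x) \<in> measurable (small_jumps \<nu> \<epsilon>) borel"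
    by (simp add: small_jumps_def sets cong: measurable_cong_sets)
  define \<nu>' where "\<nu>' = distr (small_jumps \<nu> \<epsilon>) borel (\<lambda>x. (1 / \<epsilon>) *\<^sub>R x)"
  have "(\<integral>x. (iexp ((\<epsilon> *\<^sub>R z) \<bullet> x) - 1) \<partial>\<nu>') = (\<integral>x. (iexp ((\<epsilon> *\<^sub>R z) \<bullet> ((1 / \<epsilon>) *\<^sub>R x)) - 1) \<partial>small_jumps \<nu> \<epsilon>)"
    unfolding \<nu>'_def using m by (rule integral_distr) measurable
  also have "\<dots> = (\<integral>x. (iexp (z \<bullet> x) - 1) \<partial>small_jumps \<nu> \<epsilon>)" using \<epsilon> by simp
  finally have "(\<integral>x. (iexp (z \<bullet> x) - 1) \<partial>small_jumps \<nu> \<epsilon>) = (\<integral>x. (iexp ((\<epsilon> *\<^sub>R z) \<bullet> x) - 1) \<partial>\<nu>')" ..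
  also have "\<dots> = jump_exponent h (\<epsilon> *\<^sub>R z)"
  proof (rule jump_exponent_pushforward[OF h])
    show "0 \<le> h s r \<and> h s r \<le> 1" if "s \<in> space \<sigma>" "0 < r" for s r
      using q01[of s "(\<epsilon> * r) powr p"] that \<epsilon> by (simp add: h_def space_\<sigma>)
    show "sets \<nu>' = sets borel" by (simp add: \<nu>'_def)
    fix B :: "'a set" assume B[measurable]: "B \<in> sets borel"
    define C where "C = {x. norm x \<le> \<epsilon> \<and> (1 / \<epsilon>) *\<^sub>R x \<in> B}"
    let ?k = "\<lambda>s r. indicator {0<..1} r * indicator B (r *\<^sub>R s) * ennreal (h s r / r)"
      and ?c = "\<lambda>s r. indicator C (r *\<^sub>R s) * ennreal (q (r powr p) s / r)"
      and ?d = "\<lambda>s r. indicator C ((\<epsilon> * r) *\<^sub>R s) * ennreal (q ((\<epsilon> * r) powr p) s / (\<epsilon> * r)) * indicator {0<..} (\<epsilon> * r)"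
    have C[measurable]: "C \<in> sets borel" unfolding C_def by measurable
    have spn: "space \<nu> = UNIV" using sets_eq_imp_space_eq[OF sets] by simp
    have "emeasure \<nu>' B = emeasure (small_jumps \<nu> \<epsilon>) ((\<lambda>x. (1 / \<epsilon>) *\<^sub>R x) -` B)"
      unfolding \<nu>'_def by (subst emeasure_distr[OF m B]) (simp add: small_jumps_def spn)
    also have "\<dots> = (\<integral>\<^sup>+x. indicator {x. norm x \<le> \<epsilon>} x * indicator ((\<lambda>x. (1 / \<epsilon>) *\<^sub>R x) -` B) x \<partial>\<nu>)"
      unfolding small_jumps_def
    proof (rule emeasure_density)
      show "indicator {x. norm x \<le> \<epsilon>} \<in> borel_measurable \<nu>"
        using sets by (simp cong: measurable_cong_sets)
      show "(\<lambda>x. (1 / \<epsilon>) *\<^sub>R x) -` B \<in> sets \<nu>"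
        using measurable_sets[OF m B] by (simp add: small_jumps_def spn)
    qed
    also have "\<dots> = (\<integral>\<^sup>+x. indicator C x \<partial>\<nu>)"
      by (intro nn_integral_cong) (auto simp: C_def indicator_def)
    also have "\<dots> = emeasure \<nu> C" by (rule nn_integral_indicator) (simp add: sets)
    also have "\<dots> = (\<integral>\<^sup>+s. (\<integral>\<^sup>+r\<in>{0<..}. (?c s r) \<partial>lborel) \<partial>\<sigma>)"
      by (rule \<nu>) (rule C)
    also have "\<dots> = (\<integral>\<^sup>+s. \<integral>\<^sup>+r. ?k s r \<partial>lborel \<partial>\<sigma>)"
    proof (rule nn_integral_cong)
      fix s assume s: "s \<in> space \<sigma>"
      \<comment> \<open>Nothing is known about \<open>q\<close> at nonpositive radii; the section is
        made measurable by the value 0 there, and the indicator of the half-line hides the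
        change.\<close>
      have q_sect: "(\<lambda>r. if 0 < r then q (r powr p) s else 0) \<in> borel_measurable borel"
        using measurable_compose[OF measurable_Pair1'[OF s] scaled_tempering_measurable[OF q, of 1 p]]
        by (simp cong: if_cong)
      have "(\<lambda>r. indicator C (r *\<^sub>R s) * ennreal ((if 0 < r then q (r powr p) s else 0) / r) * indicator {0<..} r) \<in> borel_measurable borel"
        using q_sect by measurable
      also have "(\<lambda>r. indicator C (r *\<^sub>R s) * ennreal ((if 0 < r then q (r powr p) s else 0) / r) * indicator {0<..} r) =
          (\<lambda>r. ?c s r * indicator {0<..} r)"
        by (auto simp: fun_eq_iff indicator_def)
      finally have meas: "(\<lambda>r. ?c s r * indicator {0<..} r) \<in> borel_measurable borel" .
      have "(\<integral>\<^sup>+r\<in>{0<..}. (?c s r) \<partial>lborel) =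
          ennreal \<epsilon> * (\<integral>\<^sup>+r. ?d s r \<partial>lborel)"
        using nn_integral_real_affine[OF meas, of \<epsilon> 0] \<epsilon> by simp
      also have "\<dots> = (\<integral>\<^sup>+r. ennreal \<epsilon> * (?d s r) \<partial>lborel)"
        by (rule nn_integral_cmult[symmetric]) (use measurable_compose[OF _ meas, of "\<lambda>r. \<epsilon> * r" borel] in simp)
      also have "\<dots> = (\<integral>\<^sup>+r. ?k s r \<partial>lborel)"
      proof (rule nn_integral_cong)
        fix r :: real
        show "ennreal \<epsilon> * (?d s r) =
            ?k s r"
        proof (cases "0 < r")
          case True
          have "norm ((\<epsilon> * r) *\<^sub>R s) = \<epsilon> * r" using s True \<epsilon> by (simp add: space_\<sigma> abs_mult)
          then have "(\<epsilon> * r) *\<^sub>R s \<in> C \<longleftrightarrow> r \<le> 1 \<and> r *\<^sub>R s \<in> B" using \<epsilon> by (simp add: C_def)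
          moreover have "ennreal \<epsilon> * ennreal (q ((\<epsilon> * r) powr p) s / (\<epsilon> * r)) = ennreal (h s r / r)"
            using q01[of s "(\<epsilon> * r) powr p"] s True \<epsilon> by (simp add: h_def space_\<sigma> flip: ennreal_mult')
          ultimately show ?thesis using True \<epsilon> by (auto simp: indicator_def)
        next
          case False
          then have "\<not> 0 < \<epsilon> * r" using \<epsilon> by (simp add: zero_less_mult_iff)
          then show ?thesis using False by (simp add: indicator_def)
        qed
      qed
      finally show "(\<integral>\<^sup>+r\<in>{0<..}. (?c s r) \<partial>lborel) =
          (\<integral>\<^sup>+r. ?k s r \<partial>lborel)" .
    qed
    finally show "emeasure \<nu>' B = (\<integral>\<^sup>+s. \<integral>\<^sup>+r. ?k s r \<partial>lborel \<partial>\<sigma>)" .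
  qed
  finally show ?thesis by (simp add: h_def)
qed

lemma ID0_law_char:
  fixes X :: "'w \<Rightarrow> 'a::euclidean_space"
  assumes X: "X \<in> borel_measurable P" and ID: "ID0_law M 0 (distr P borel X)"
  shows "(\<integral>\<omega>. iexp (z \<bullet> X \<omega>) \<partial>P) = exp (\<integral>x. (iexp (z \<bullet> x) - 1) \<partial>M)"
proof -
  have "(\<integral>\<omega>. iexp (z \<bullet> X \<omega>) \<partial>P) = (\<integral>x. iexp (z \<bullet> x) \<partial>distr P borel X)"
    by (rule integral_distr[symmetric, OF X]) measurable
  then show ?thesis using ID by (simp add: ID0_law_def)
qed

context sphere_marks
begin

text \<open>The sequence is eventually constant at every mark: if \<open>u < 1\<close>, then
  \<open>u\<close> eventually falls below \<open>h n s r\<close>; if \<open>u \<ge> 1\<close>, the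
  mark is always rejected because \<open>h n s r \<le> 1\<close>.\<close>

lemma thinned_on_tendsto:
  assumes lim: "\<And>s r. s \<in> sphere 0 1 \<Longrightarrow> 0 < r \<Longrightarrow> (\<lambda>n. h n s r) \<longlonglongrightarrow> 1"
    and le: "\<And>n s r. s \<in> sphere 0 1 \<Longrightarrow> 0 < r \<Longrightarrow> h n s r \<le> 1"
  shows "(\<lambda>n. thinned_on (h n) k e) \<longlonglongrightarrow> thinned_on (\<lambda>_ _. 1) k e"
proof -
  obtain s r u where e: "e = (s, r, u)" by (cases e)
  have "\<forall>\<^sub>F n in sequentially. thinned (h n) e = thinned (\<lambda>_ _. 1) e"
  proof (cases "norm s = 1 \<and> 0 < r \<and> u < 1")
    case True
    then have "\<forall>\<^sub>F n in sequentially. u < h n s r"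
      using order_tendstoD(1)[OF lim[of s r]] by simp
    then show ?thesis by (rule eventually_mono) (use True in \<open>auto simp: e thinned_def\<close>)
  next
    case False
    have "thinned (h n) e = thinned (\<lambda>_ _. 1) e" for n
      using False le[of s r n] by (auto simp: e thinned_def)
    then show ?thesis by simp
  qed
  then have "\<forall>\<^sub>F n in sequentially. thinned_on (h n) k e = thinned_on (\<lambda>_ _. 1) k e"
    by (rule eventually_mono) (simp add: thinned_on_def)
  then show ?thesis by (rule tendsto_eventually)
qed

end

text \<open>Each expectation is replaced by that of a coupled process on the common space \<Omega>,
  since both have the same grid exponent; there convergence holds path by path along every sequence
  of \<epsilon>.\<close>

lemma scaled_small_jumps_functional_converges:
  fixes \<sigma> \<nu> :: "(real ^ 'd) measure" and q :: "real \<Rightarrow> real ^ 'd \<Rightarrow> real"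
    and P :: "real \<Rightarrow> 'w measure" and X :: "real \<Rightarrow> real \<Rightarrow> 'w \<Rightarrow> real ^ 'd"
    and Q :: "'v measure" and Y :: "real \<Rightarrow> 'v \<Rightarrow> real ^ 'd"
  assumes marks: "sphere_marks \<sigma>" and "p > 0"
    and q: "(\<lambda>(r, s). q r s) \<in> borel_measurable (restrict_space borel ({0<..} \<times> sphere 0 1))"
    and q01: "\<And>s r. s \<in> sphere 0 1 \<Longrightarrow> 0 < r \<Longrightarrow> 0 \<le> q r s \<and> q r s \<le> 1"
    and q_lim: "\<And>s. s \<in> sphere 0 1 \<Longrightarrow> ((\<lambda>r. q r s) \<longlongrightarrow> 1) (at_right 0)"
    and sets: "sets \<nu> = sets borel"
    and \<nu>: "\<And>B. B \<in> sets borel \<Longrightarrow> emeasure \<nu> B =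
             (\<integral>\<^sup>+s. (\<integral>\<^sup>+r\<in>{0<..}. (indicator B (r *\<^sub>R s) * ennreal (q (r powr p) s / r)) \<partial>lborel) \<partial>\<sigma>)"
    and X: "\<And>\<epsilon>. \<epsilon> > 0 \<Longrightarrow> levy_process (P \<epsilon>) (X \<epsilon>)"
    and X1: "\<And>\<epsilon>. \<epsilon> > 0 \<Longrightarrow> ID0_law (small_jumps \<nu> \<epsilon>) 0 (distr (P \<epsilon>) borel (X \<epsilon> 1))"
    and Y: "levy_process Q Y" and Y1: "MD_law \<sigma> (distr Q borel (Y 1))"
    and f: "continuous_map skorokhod_topology euclideanreal f"
    and bdd: "\<And>x. x \<in> skorokhod_space \<Longrightarrow> \<bar>f x\<bar> \<le> C"
  shows "((\<lambda>\<epsilon>. path_expectation f (P \<epsilon>) (\<lambda>t \<omega>. (1 / \<epsilon>) *\<^sub>R X \<epsilon> t \<omega>))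
      \<longlongrightarrow> path_expectation f Q Y) (at_right 0)"
proof -
  interpret sphere_marks \<sigma> by (rule marks)
  define h where "h = (\<lambda>\<epsilon> s r. if 0 < r then q ((\<epsilon> * r) powr p) s else 0)"
  have h: "(\<lambda>(s, r). h \<epsilon> s r) \<in> borel_measurable (\<sigma> \<Otimes>\<^sub>M lborel)" if "\<epsilon> > 0" for \<epsilon>
    unfolding h_def by (rule scaled_tempering_measurable[OF q that])
  have one: "(\<lambda>(s, r). 1) \<in> borel_measurable (\<sigma> \<Otimes>\<^sub>M (lborel :: real measure))" by simp
  have cadlag_W: "cadlag_process \<Omega> (jump_process (thinned_on k))"
    if "(\<lambda>(s, r). k s r) \<in> borel_measurable (\<sigma> \<Otimes>\<^sub>M lborel)" for k
    by (rule poisson_jumps.jump_process_cadlag_process[OF thinned_on_poisson_jumps[OF that]])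
  have eX: "path_expectation f (P \<epsilon>) (\<lambda>t \<omega>. (1 / \<epsilon>) *\<^sub>R X \<epsilon> t \<omega>) = path_expectation f \<Omega> (jump_process (thinned_on (h \<epsilon>)))"
    if \<epsilon>: "\<epsilon> > 0" for \<epsilon>
  proof (rule functional_expectation_eq[OF f bdd])
    interpret X: levy_process "P \<epsilon>" "X \<epsilon>" by (rule X[OF \<epsilon>])
    show "cadlag_process (P \<epsilon>) (\<lambda>t \<omega>. (1 / \<epsilon>) *\<^sub>R X \<epsilon> t \<omega>)"
      by (intro cadlag_process_scaleR levy_process_cadlag_process X[OF \<epsilon>])
    have exponent: "(\<integral>x. (iexp (z \<bullet> x) - 1) \<partial>small_jumps \<nu> \<epsilon>) = jump_exponent (h \<epsilon>) (\<epsilon> *\<^sub>R z)" for z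
      unfolding h_def by (rule small_jumps_exponent_scaled[OF marks \<epsilon> q q01 sets \<nu>])
    have cf: "(\<integral>\<omega>. iexp (z \<bullet> X \<epsilon> 1 \<omega>) \<partial>P \<epsilon>) = exp (jump_exponent (h \<epsilon>) (\<epsilon> *\<^sub>R z))" for z
      using ID0_law_char[OF X.measurable_at X1[OF \<epsilon>]] exponent by simp
    have "continuous_on UNIV (\<lambda>z. jump_exponent (h \<epsilon>) (\<epsilon> *\<^sub>R z))"
      by (intro continuous_on_compose2[OF jump_exponent_continuous[OF h[OF \<epsilon>]]] continuous_intros) auto
    from levy_process_grid_exponent[OF X[OF \<epsilon>] cf this]
    have "grid_exponent (P \<epsilon>) (X \<epsilon>) (\<lambda>z. jump_exponent (h \<epsilon>) (\<epsilon> *\<^sub>R z))" by simp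
    \<comment> \<open>The factor \<open>1 / \<epsilon>\<close> of the process cancels the \<epsilon>
      in the argument of the exponent.\<close>
    from grid_exponent_scaleR[OF this, of "1 / \<epsilon>"] \<epsilon>
    show "grid_exponent (P \<epsilon>) (\<lambda>t \<omega>. (1 / \<epsilon>) *\<^sub>R X \<epsilon> t \<omega>) (jump_exponent (h \<epsilon>))" by simp
    show "cadlag_process \<Omega> (jump_process (thinned_on (h \<epsilon>)))" by (rule cadlag_W[OF h[OF \<epsilon>]])
    show "grid_exponent \<Omega> (jump_process (thinned_on (h \<epsilon>))) (jump_exponent (h \<epsilon>))"
      by (rule thinned_process_grid_exponent[OF h[OF \<epsilon>]])
  qed
  have eY: "path_expectation f Q Y = path_expectation f \<Omega> (jump_process (thinned_on (\<lambda>_ _. 1)))"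
  proof (rule functional_expectation_eq[OF f bdd])
    interpret Y: levy_process Q Y by (rule Y)
    show "cadlag_process Q Y" by (rule levy_process_cadlag_process[OF Y])
    have m: "Y 1 \<in> borel_measurable Q" by (rule Y.measurable_at) simp
    have cf: "(\<integral>\<omega>. iexp (z \<bullet> Y 1 \<omega>) \<partial>Q) = exp (jump_exponent (\<lambda>_ _. 1) z)" for z
      unfolding MD_law_char[OF Y1, symmetric] by (rule integral_distr[symmetric, OF m]) measurable
    show "grid_exponent Q Y (jump_exponent (\<lambda>_ _. 1))"
      by (rule levy_process_grid_exponent[OF Y cf jump_exponent_continuous[OF one] jump_exponent_0])
    show "cadlag_process \<Omega> (jump_process (thinned_on (\<lambda>_ _. 1)))" by (rule cadlag_W[OF one])
    show "grid_exponent \<Omega> (jump_process (thinned_on (\<lambda>_ _. 1))) (jump_exponent (\<lambda>_ _. 1))"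
      by (rule thinned_process_grid_exponent[OF one])
  qed
  show ?thesis
  proof (rule tendsto_at_right_sequentially[where b = 1])
    fix S :: "nat \<Rightarrow> real" assume S: "\<And>n. 0 < S n" "S \<longlonglongrightarrow> 0"
    have h_lim: "(\<lambda>n. h (S n) s r) \<longlonglongrightarrow> 1" if "s \<in> sphere 0 1" "0 < r" for s r
    proof -
      \<comment> \<open>Since \<open>p > 0\<close> the limit is 0; as all terms are positive, it is
        approached from the right, the side on which the limit of \<open>q\<close> is known.\<close>
      have "(\<lambda>n. (S n * r) powr p) \<longlonglongrightarrow> (0 * r) powr p"
        using S(1) \<open>p > 0\<close> \<open>0 < r\<close>
        by (intro tendsto_powr' tendsto_mult S(2) tendsto_const) (auto simp: less_imp_le)
      moreover have "0 < (S n * r) powr p" for n using S(1)[of n] \<open>0 < r\<close> by simp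
      ultimately have "filterlim (\<lambda>n. (S n * r) powr p) (at_right 0) sequentially"
        by (simp add: filterlim_at less_imp_neq[symmetric])
      from filterlim_compose[OF q_lim[OF that(1)] this] show ?thesis using \<open>0 < r\<close> by (simp add: h_def)
    qed
    have h_le: "h (S n) s r \<le> 1" if "s \<in> sphere 0 1" "0 < r" for n s r
      using q01[OF that(1), of "(S n * r) powr p"] that S(1)[of n] by (simp add: h_def)
    show "(\<lambda>n. path_expectation f (P (S n)) (\<lambda>t \<omega>. (1 / S n) *\<^sub>R X (S n) t \<omega>)) \<longlonglongrightarrow> path_expectation f Q Y"
      unfolding eX[OF S(1)] eY
      by (rule jump_process_expectation_converges[OF thinned_on_poisson_jumps[OF h[OF S(1)]]
            thinned_on_poisson_jumps[OF one] thinned_on_tendsto[OF h_lim h_le] f bdd])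
  qed simp
qed

text \<open>With \<sigma> = 0 the mark laws cannot be normalised. But then \<nu> is null, both
  processes have exponent 0, and the expectations agree for every scaling factor.\<close>

lemma degenerate_small_jumps_functional_eq:
  fixes \<sigma> \<nu> :: "(real ^ 'd) measure" and X :: "real \<Rightarrow> 'w \<Rightarrow> real ^ 'd" and Y :: "real \<Rightarrow> 'v \<Rightarrow> real ^ 'd"
  assumes \<sigma>: "finite_measure \<sigma>" "measure \<sigma> (space \<sigma>) = 0"
    and sets: "sets \<nu> = sets borel"
    and \<nu>: "\<And>B. B \<in> sets borel \<Longrightarrow> emeasure \<nu> B = (\<integral>\<^sup>+s. k B s \<partial>\<sigma>)"
    and X: "levy_process P X" "ID0_law (small_jumps \<nu> \<epsilon>) 0 (distr P borel (X 1))"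
    and Y: "levy_process Q Y" "MD_law \<sigma> (distr Q borel (Y 1))"
    and f: "continuous_map skorokhod_topology euclideanreal f"
    and bdd: "\<And>x. x \<in> skorokhod_space \<Longrightarrow> \<bar>f x\<bar> \<le> C"
  shows "path_expectation f P (\<lambda>t \<omega>. c *\<^sub>R X t \<omega>) = path_expectation f Q Y"
proof (rule functional_expectation_eq[OF f bdd])
  interpret X: levy_process P X by fact
  interpret Y: levy_process Q Y by fact
  have mX: "X 1 \<in> borel_measurable P" and mY: "Y 1 \<in> borel_measurable Q"
    by (simp_all add: X.measurable_at Y.measurable_at)
  have null: "emeasure \<sigma> (space \<sigma>) = 0"
    using \<sigma> by (simp add: finite_measure.emeasure_eq_measure)
  then have "AE s in \<sigma>. k B s = 0" for B by (auto intro!: AE_I[of _ _ "space \<sigma>"])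
  then have "(\<integral>\<^sup>+s. k B s \<partial>\<sigma>) = (\<integral>\<^sup>+s. 0 \<partial>\<sigma>)" for B by (rule nn_integral_cong_AE)
  then have \<nu>0: "emeasure \<nu> UNIV = 0" using \<nu>[of UNIV] by simp
  have spn: "space \<nu> = UNIV" using sets_eq_imp_space_eq[OF sets] by simp
  \<comment> \<open>On a null measure every predicate holds almost everywhere, in particular the
    vanishing of the integrand.\<close>
  have "AE x in \<nu>. Q' x" for Q' by (rule AE_I[of _ _ UNIV]) (auto simp: \<nu>0 sets)
  then have "AE x in small_jumps \<nu> \<epsilon>. iexp (z \<bullet> x) - 1 = 0" for z
    unfolding small_jumps_def by (subst AE_density) (auto simp: sets cong: measurable_cong_sets)
  then have "(\<integral>x. (iexp (z \<bullet> x) - 1) \<partial>small_jumps \<nu> \<epsilon>) = 0" for z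
    by (rule integral_eq_zero_AE)
  then have cfX: "(\<integral>\<omega>. iexp (z \<bullet> X 1 \<omega>) \<partial>P) = exp 0" for z
    using ID0_law_char[OF mX X(2), of z] by simp
  have cfY: "(\<integral>\<omega>. iexp (z \<bullet> Y 1 \<omega>) \<partial>Q) = exp 0" for z
  proof -
    have "(\<integral>\<omega>. iexp (z \<bullet> Y 1 \<omega>) \<partial>Q) = (\<integral>x. iexp (z \<bullet> x) \<partial>distr Q borel (Y 1))"
      by (rule integral_distr[symmetric, OF mY]) measurable
    also have "distr Q borel (Y 1) = return borel 0" using Y(2) \<sigma>(2) by (simp add: MD_law_def)
    also have "(\<integral>x. iexp (z \<bullet> x) \<partial>return borel 0) = iexp (z \<bullet> 0)" by (rule integral_return) auto
    finally show ?thesis by simp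
  qed
  show "cadlag_process P (\<lambda>t \<omega>. c *\<^sub>R X t \<omega>)"
    by (intro cadlag_process_scaleR levy_process_cadlag_process X)
  show "grid_exponent P (\<lambda>t \<omega>. c *\<^sub>R X t \<omega>) (\<lambda>_. 0)"
    by (rule grid_exponent_scaleR[OF levy_process_grid_exponent[OF X(1) cfX], of c]) auto
  show "cadlag_process Q Y" by (rule levy_process_cadlag_process[OF Y(1)])
  show "grid_exponent Q Y (\<lambda>_. 0)"
    by (rule levy_process_grid_exponent[OF Y(1) cfY]) auto
qed

theorem mainTheorem2:
  fixes \<mu> \<nu> \<sigma> :: "(real ^ 'd) measure" and \<gamma> :: "real ^ 'd" and p :: real
    and q :: "real \<Rightarrow> real ^ 'd \<Rightarrow> real"
    and P :: "real \<Rightarrow> 'w measure" and X :: "real \<Rightarrow> real \<Rightarrow> 'w \<Rightarrow> real ^ 'd"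
    and Q :: "'v measure" and Y :: "real \<Rightarrow> 'v \<Rightarrow> real ^ 'd"
  assumes "p > 0"
    and "finite_sphere_measure \<sigma>"
    and "(\<lambda>(r, s). q r s) \<in> borel_measurable (restrict_space borel ({0<..} \<times> sphere 0 1))"
    and "\<And>r s. r > 0 \<Longrightarrow> s \<in> sphere 0 1 \<Longrightarrow> q r s \<ge> 0"
    and "\<And>s. s \<in> sphere 0 1 \<Longrightarrow> ((\<lambda>r. q r s) \<longlongrightarrow> 1) (at_right 0)"
    and "\<And>s. s \<in> sphere 0 1 \<Longrightarrow> completely_monotone (\<lambda>r. q r s)"
    and "ID0_law \<nu> \<gamma> \<mu>"
    and "\<And>B. B \<in> sets borel \<Longrightarrow>
           emeasure \<nu> B =
             (\<integral>\<^sup>+s. (\<integral>\<^sup>+r\<in>{0<..}. (indicator B (r *\<^sub>R s) * ennreal (q (r powr p) s / r)) \<partial>lborel) \<partial>\<sigma>)"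
    and "\<And>\<epsilon>. \<epsilon> > 0 \<Longrightarrow> levy_process (P \<epsilon>) (X \<epsilon>)"
    and "\<And>\<epsilon>. \<epsilon> > 0 \<Longrightarrow> ID0_law (small_jumps \<nu> \<epsilon>) 0 (distr (P \<epsilon>) borel (X \<epsilon> 1))"
    and "levy_process Q Y"
    and "MD_law \<sigma> (distr Q borel (Y 1))"
  shows "process_converges_in_distribution P (\<lambda>\<epsilon> t \<omega>. (1 / \<epsilon>) *\<^sub>R X \<epsilon> t \<omega>) Q Y (at_right 0)"
  unfolding process_converges_in_distribution_def converges_in_distribution_def
proof (intro allI impI conjI)
  fix f :: "(real \<Rightarrow> real ^ 'd) \<Rightarrow> real"
  assume "continuous_map skorokhod_topology euclideanreal f \<and> bounded (f ` topspace skorokhod_topology)"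
  then have f: "continuous_map skorokhod_topology euclideanreal f"
    and "bounded (f ` skorokhod_space)" by (simp_all add: topspace_skorokhod_topology)
  then obtain C where C: "\<And>x. x \<in> skorokhod_space \<Longrightarrow> \<bar>f x\<bar> \<le> C"
    unfolding bounded_iff by auto
  \<comment> \<open>The upper bound makes thinning possible: complete monotonicity and the limit 1
    at 0 keep \<open>q\<close> within \<open>[0, 1]\<close>.\<close>
  have q01: "0 \<le> q r s \<and> q r s \<le> 1" if "s \<in> sphere 0 1" "0 < r" for s r
    using assms(4)[OF that(2,1)] completely_monotone_le_limit_at_0[OF assms(6)[OF that(1)] assms(5)[OF that(1)] that(2)] by simp
  have sets: "sets \<nu> = sets borel" using assms(7) by (simp add: ID0_law_def levy_measure_def)
  have pos: "\<forall>\<^sub>F \<epsilon> in at_right (0 :: real). \<epsilon> > 0" by (simp add: eventually_at_right_less)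
  show "\<forall>\<^sub>F \<epsilon> in at_right 0. (\<lambda>\<omega>. f (sample_path (\<lambda>t \<omega>. (1 / \<epsilon>) *\<^sub>R X \<epsilon> t \<omega>) \<omega>)) \<in> borel_measurable (P \<epsilon>)"
    using pos by (rule eventually_mono)
      (intro functional_of_process(1)[OF f C] cadlag_process_scaleR levy_process_cadlag_process assms(9))
  show "(\<lambda>\<omega>. f (sample_path Y \<omega>)) \<in> borel_measurable Q"
    by (rule functional_of_process(1)[OF f C levy_process_cadlag_process[OF assms(11)]])
  show "((\<lambda>\<epsilon>. path_expectation f (P \<epsilon>) (\<lambda>t \<omega>. (1 / \<epsilon>) *\<^sub>R X \<epsilon> t \<omega>))
      \<longlongrightarrow> path_expectation f Q Y) (at_right 0)"
  \<comment> \<open>The locale \<open>sphere_marks\<close> needs positive mass, and the Dickman law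
    is defined separately for mass 0.\<close>
  proof (cases "measure \<sigma> (space \<sigma>) = 0")
    case True
    have fin: "finite_measure \<sigma>" using assms(2) by (simp add: finite_sphere_measure_def)
    have "\<forall>\<^sub>F \<epsilon> in at_right 0. path_expectation f (P \<epsilon>) (\<lambda>t \<omega>. (1 / \<epsilon>) *\<^sub>R X \<epsilon> t \<omega>) = path_expectation f Q Y"
      using pos
      by (rule eventually_mono)
         (rule degenerate_small_jumps_functional_eq[OF fin True sets assms(8) assms(9) assms(10) assms(11,12) f C])
    then show ?thesis by (rule tendsto_eventually)
  next
    case False
    then have "sphere_marks \<sigma>"
      using assms(2) by unfold_locales (auto simp: zero_less_measure_iff)
    then show ?thesis
      by (rule scaled_small_jumps_functional_converges[OF _ assms(1,3) q01 assms(5) sets assms(8-12) f C])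
  qed
qed

end
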